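(* For every integer $n > 1$, the coefficient of $t^{n-1}$ in the inverse Kazhdan--Lusztig polynomial $Q_{B_{2n}}(t)$ of the braid matroid $B_{2n}$ is equal to $$(2n-1)^{n-2}\cdot (2n-3)!!,$$ and the coefficient of $t^{n-2}$ in the inverse Kazhdan--Lusztig polynomial $Q_{B_{2n-1}}(t)$ of the braid matroid $B_{2n-1}$ is equal to $$\frac{(n-1)^{n-5}\cdot (2n-1)!}{3\cdot (n-2)!}.$$
   Context: For a positive integer $k$, the braid matroid $B_k$ is the graphic (cycle) matroid of the complete graph on $k$ vertices; it has rank $k-1$. For a loopless matroid $M$ with ground set $E$ and lattice of flats $\mathscr{L}(M)$, $M|_F$ denotes the restriction of $M$ to the flat $F$ and $M/F$ the contraction. The Kazhdan--Lusztig polynomials $P_M(t)\in\mathbb{Z}[t]$ are the unique family of polynomials, indexed by loopless matroids (and depending only on the isomorphism class), such that: $P_M(t)=1$ if $\mathrm{rk}\, M=0$; $\deg P_M(t)<\frac12\mathrm{rk}\, M$ if $\mathrm{rk}\, M>0$; and $t^{\mathrm{rk}\, M}P_M(t^{-1})=\sum_{F\in\mathscr{L}(M)}\chi_{M|_F}(t)\,P_{M/F}(t)$ for all $M$, where $\chi$ is the characteristic polynomial. The inverse Kazhdan--Lusztig polynomials $Q_M(t)$ are determined recursively by $Q_M(t)=1$ if $\mathrm{rk}\, M=0$ and, for $\mathrm{rk}\, M>0$, $$\sum_{F\in \mathscr{L}(M)} (-1)^{\mathrm{rk}\, M/F}\,P_{M|_F}(t)\,Q_{M/F}(t)=0.$$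 $m!!$ denotes the double factorial ($1!!=1$, $m!!=m\cdot(m-2)!!$), and powers with negative exponents are rational numbers. *)

theory Defs
  imports Complex_Main "HOL-Computational_Algebra.Polynomial"
begin

text \<open>Finite matroids, given by ground set and independent sets.\<close>

datatype 'a matroid = Matroid (ground: "'a set") (indep: "'a set set")

definition is_matroid :: "'a matroid \<Rightarrow> bool" where
  "is_matroid M \<longleftrightarrow>
     finite (ground M) \<and>
     indep M \<subseteq> Pow (ground M) \<and>
     {} \<in> indep M \<and>
     (\<forall>I J. I \<in> indep M \<longrightarrow> J \<subseteq> I \<longrightarrow> J \<in> indep M) \<and>
     (\<forall>I J. I \<in> indep M \<longrightarrow> J \<in> indep M \<longrightarrow> card I < card J \<longrightarrow>
        (\<exists>e \<in> J - I. insert e I \<in> indep M))"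

definition loopless :: "'a matroid \<Rightarrow> bool" where
  "loopless M \<longleftrightarrow> (\<forall>e \<in> ground M. {e} \<in> indep M)"

definition matroid_iso :: "'a matroid \<Rightarrow> 'b matroid \<Rightarrow> bool" where
  "matroid_iso M N \<longleftrightarrow>
     (\<exists>f. bij_betw f (ground M) (ground N) \<and>
          (\<forall>I. I \<subseteq> ground M \<longrightarrow> (I \<in> indep M \<longleftrightarrow> f ` I \<in> indep N)))"

definition rank_of :: "'a matroid \<Rightarrow> 'a set \<Rightarrow> nat" where
  "rank_of M X = Max (card ` {I \<in> indep M. I \<subseteq> X})"

definition rk :: "'a matroid \<Rightarrow> nat" where
  "rk M = rank_of M (ground M)"

definition flats :: "'a matroid \<Rightarrow> 'a set set" where
  "flats M = {F. F \<subseteq> ground M \<and> (\<forall>e \<in> ground M - F. rank_of M F < rank_of M (insert e F))}"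

definition restriction :: "'a matroid \<Rightarrow> 'a set \<Rightarrow> 'a matroid" where
  "restriction M X = Matroid X {I \<in> indep M. I \<subseteq> X}"

definition basis_of :: "'a matroid \<Rightarrow> 'a set \<Rightarrow> 'a set \<Rightarrow> bool" where
  "basis_of M X B \<longleftrightarrow>
     B \<in> indep M \<and> B \<subseteq> X \<and> (\<forall>C \<in> indep M. B \<subseteq> C \<longrightarrow> C \<subseteq> X \<longrightarrow> C = B)"

definition contraction :: "'a matroid \<Rightarrow> 'a set \<Rightarrow> 'a matroid" where
  "contraction M X =
     Matroid (ground M - X) {I. I \<subseteq> ground M - X \<and> (\<exists>B. basis_of M X B \<and> I \<union> B \<in> indep M)}"

text \<open>The Moebius function of a family of finite sets ordered by inclusion.  The test for
  finiteness only serves termination.\<close>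

function moebius :: "'a set set \<Rightarrow> 'a set \<Rightarrow> 'a set \<Rightarrow> int" where
  "moebius L X Y =
     (if X = Y then 1
      else if finite Y then - (\<Sum>Z \<in> {Z \<in> L. X \<subseteq> Z \<and> Z \<subset> Y}. moebius L X Z)
      else 0)"
  by pat_completeness auto
termination
  by (relation "measure (\<lambda>(L, X, Y). card Y)") (auto intro: psubset_card_mono)

declare moebius.simps [simp del]

text \<open>The bottom element of the lattice of flats of a loopless matroid is the empty set.  If there
  are loops, every summand below vanishes, in accordance with the usual convention.\<close>

definition matroid_char_poly :: "'a matroid \<Rightarrow> int poly" where
  "matroid_char_poly M = (\<Sum>F \<in> flats M. monom (moebius (flats M) {} F) (rk M - rank_of M F))"

text \<open>The polynomial \<open>t ^ r * p (1 / t)\<close>, for \<open>degree p \<le> r\<close>.\<close>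

definition reverse_at :: "nat \<Rightarrow> int poly \<Rightarrow> int poly" where
  "reverse_at r p = (\<Sum>i\<le>r. monom (coeff p i) (r - i))"

text \<open>Families indexed by loopless matroids are total functions that are \<open>0\<close> elsewhere, so that
  they can be determined uniquely.  Restricting to a flat and contracting a flat do not leave the
  type of ground set elements, so the recursions make sense for each such type separately.\<close>

definition KL_family :: "('a matroid \<Rightarrow> int poly) \<Rightarrow> bool" where
  "KL_family P \<longleftrightarrow>
     (\<forall>M. \<not> (is_matroid M \<and> loopless M) \<longrightarrow> P M = 0) \<and>
     (\<forall>M N. is_matroid M \<longrightarrow> loopless M \<longrightarrow> is_matroid N \<longrightarrow> loopless N \<longrightarrow>
        matroid_iso M N \<longrightarrow> P M = P N) \<and>
     (\<forall>M. is_matroid M \<longrightarrow> loopless M \<longrightarrow>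
        (rk M = 0 \<longrightarrow> P M = 1) \<and>
        (rk M > 0 \<longrightarrow> 2 * degree (P M) < rk M) \<and>
        reverse_at (rk M) (P M) =
          (\<Sum>F \<in> flats M. matroid_char_poly (restriction M F) * P (contraction M F)))"

definition KL_poly :: "'a matroid \<Rightarrow> int poly" where
  "KL_poly = (THE P. KL_family P)"

definition inverse_KL_family :: "('a matroid \<Rightarrow> int poly) \<Rightarrow> bool" where
  "inverse_KL_family Q \<longleftrightarrow>
     (\<forall>M. \<not> (is_matroid M \<and> loopless M) \<longrightarrow> Q M = 0) \<and>
     (\<forall>M. is_matroid M \<longrightarrow> loopless M \<longrightarrow>
        (rk M = 0 \<longrightarrow> Q M = 1) \<and>
        (rk M > 0 \<longrightarrow>
           (\<Sum>F \<in> flats M. (- 1) ^ rk (contraction M F) *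
              KL_poly (restriction M F) * Q (contraction M F)) = 0))"

definition inverse_KL_poly :: "'a matroid \<Rightarrow> int poly" where
  "inverse_KL_poly = (THE Q. inverse_KL_family Q)"

text \<open>Simple graphs are given by their edges, which are two-element sets of vertices.\<close>

definition is_cycle :: "'v set set \<Rightarrow> bool" where
  "is_cycle C \<longleftrightarrow>
     (\<exists>vs. length vs \<ge> 3 \<and> distinct vs \<and>
           C = {{vs ! i, vs ! (Suc i mod length vs)} | i. i < length vs})"

definition cycle_matroid :: "'v set set \<Rightarrow> 'v set matroid" where
  "cycle_matroid E = Matroid E {A. A \<subseteq> E \<and> \<not> (\<exists>C \<subseteq> A. is_cycle C)}"

definition braid_matroid :: "nat \<Rightarrow> nat set matroid" where
  "braid_matroid k = cycle_matroid {e. e \<subseteq> {..<k} \<and> card e = 2}"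

fun double_fact :: "nat \<Rightarrow> nat" where
  "double_fact 0 = 1"
| "double_fact (Suc 0) = 1"
| "double_fact (Suc (Suc m)) = Suc (Suc m) * double_fact m"

end

theory Submission
  imports Defs "HOL-Computational_Algebra.Formal_Power_Series" "HOL-Library.Disjoint_Sets"
begin

text \<open>Let \<open>P\<close> be the Kazhdan--Lusztig function in the incidence algebra of the lattice of flats and
  \<open>c = P\<^sup>-\<^sup>1\<close>, so that \<open>Q = (-1)^rk c\<close>.  A function \<open>c\<close> is this inverse as soon as the degrees of its values are
  less than half the rank and \<open>c(y)\<close> is the sum of \<open>\<Lambda>(z) t^(rk y - rk z)\<close> over \<open>z \<le> y\<close> with palindromic \<open>\<Lambda>(z)\<close>.

  The flats of the braid matroid are the set partitions, and we take \<open>\<Lambda>\<close> multiplicative over the blocks.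
  If \<open>L(x)\<close> is the exponential generating function of the values on one block, that of \<open>c\<close> is
  \<open>(exp (t L(x)) - 1) / t\<close>.  The right choice is \<open>L = ln (1 + t T) / t + ln (1 + T) - T\<close>, where \<open>T\<close> is the
  power series with \<open>T = x exp (t T\<^sup>2 / 2)\<close>: it is palindromic, and
  \<open>exp (t L) = (1 + t T) (1 + T)\<^sup>t exp (- t T)\<close> satisfies the degree bounds.  Its extremal coefficients are
  polynomials in \<open>T\<close> times \<open>exp (- T\<^sup>2 / 2)\<close> at \<open>t = 1\<close>; their derivatives are polynomials in \<open>T\<close>, namely
  \<open>T\<^sup>3 / 3 - T\<close> and \<open>T\<^sup>2 - 7/12 T\<^sup>4 + T\<^sup>6 / 18\<close>, and the coefficients of the powers of \<open>T\<close> are explicit.\<close>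

section \<open>Matroids and their flats\<close>

text \<open>The choice of \<open>T\<close> is forced by the degree bound. In (1 + t u) (1 + u)^t exp
  (- t u) a monomial u^k t^i has 2 i <= k + 1, since ln (1 + u) - u starts with - u^2 / 2, so that
  every t brings at least u^2, except for the factor 1 + t u. Equality occurs along the series u exp
  (- u^2 / 2). The bound deg < rank / 2, before the division by t, asks for 2 i < n + 1 at x^n with
  n >= 2. The substitution of T preserves the defect n + 1 - 2 i, so the extreme part becomes u exp
  (- u^2 / 2) at u = T, which has to be x alone: T is the compositional inverse.

  Palindromicity restricts L in turn. The power T^k contributes t^((n - k)/2) at x^n, and its
  coefficient in L is a multiple of t^(k - 1) + 1; the two exponents add up to n - 1, the rank
  belonging to a block of size n.

  The polynomials P and Q are definite descriptions, so existence has to be established too. It is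
  obtained by a recursion that repairs the low half of a polynomial so as to make a sum palindromic,
  which never meets a solvability condition.

  The next two diagonals, of defect 1 and 2, carry the two coefficients asked for; the parity of the
  number of vertices decides between them.\<close>

lemma finite_indep:
  assumes "is_matroid M" "I \<in> indep M"
  shows "finite I" "I \<subseteq> ground M"
proof -
  show "I \<subseteq> ground M" using assms unfolding is_matroid_def by (elim conjE) blast
  moreover have "finite (ground M)" using assms unfolding is_matroid_def by (elim conjE)
  ultimately show "finite I" by (rule finite_subset)
qed

lemma indep_mono: "is_matroid M \<Longrightarrow> I \<in> indep M \<Longrightarrow> J \<subseteq> I \<Longrightarrow> J \<in> indep M"
  unfolding is_matroid_def by (elim conjE) metis

lemma indep_augment:
  assumes M: "is_matroid M" and IJ: "I \<in> indep M" "J \<in> indep M" "card I < card J"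
  obtains e where "e \<in> J - I" "insert e I \<in> indep M"
proof -
  have "\<forall>I J. I \<in> indep M \<longrightarrow> J \<in> indep M \<longrightarrow> card I < card J \<longrightarrow>
    (\<exists>e \<in> J - I. insert e I \<in> indep M)"
    using M unfolding is_matroid_def by (elim conjE)
  from this[rule_format, OF IJ] show ?thesis using that by (elim bexE)
qed

lemma finite_indep_sets: "is_matroid M \<Longrightarrow> finite (indep M)"
  unfolding is_matroid_def by (meson finite_Pow_iff finite_subset)

lemma card_le_rank_of:
  assumes "is_matroid M" "I \<in> indep M" "I \<subseteq> X"
  shows "card I \<le> rank_of M X"
  unfolding rank_of_def using assms finite_indep_sets[OF assms(1)] by (intro Max_ge) auto

lemma rank_of_attained:
  assumes "is_matroid M"
  obtains I where "I \<in> indep M" "I \<subseteq> X" "card I = rank_of M X"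
proof -
  have "{} \<in> indep M" using assms by (simp add: is_matroid_def)
  hence "rank_of M X \<in> card ` {I \<in> indep M. I \<subseteq> X}"
    unfolding rank_of_def using finite_indep_sets[OF assms] by (intro Max_in) auto
  thus ?thesis using that by auto
qed

lemma rank_of_mono:
  assumes "is_matroid M" "X \<subseteq> Y"
  shows "rank_of M X \<le> rank_of M Y"
proof -
  obtain I where "I \<in> indep M" "I \<subseteq> X" "card I = rank_of M X" using rank_of_attained[OF assms(1)] .
  thus ?thesis using card_le_rank_of[OF assms(1), of I Y] assms(2) by auto
qed

lemma rank_of_empty: "is_matroid M \<Longrightarrow> rank_of M {} = 0"
  by (metis card.empty rank_of_attained subset_empty)

lemma extend_indep:
  assumes M: "is_matroid M" and "I \<in> indep M" "I \<subseteq> X"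
  obtains J where "J \<in> indep M" "I \<subseteq> J" "J \<subseteq> X" "card J = rank_of M X"
proof -
  have "\<exists>J \<in> indep M. I \<subseteq> J \<and> J \<subseteq> X \<and> card J = rank_of M X"
    using assms(2,3)
  proof (induction "rank_of M X - card I" arbitrary: I)
    case 0
    then have "card I = rank_of M X" using card_le_rank_of[OF M 0(2,3)] by simp
    then show ?case using 0(2,3) by blast
  next
    case (Suc k)
    obtain B where B: "B \<in> indep M" "B \<subseteq> X" "card B = rank_of M X"
      using rank_of_attained[OF M] .
    have "card I < card B" using Suc(2) B by simp
    then obtain e where e: "e \<in> B - I" "insert e I \<in> indep M"
      by (rule indep_augment[OF M Suc.prems(1) B(1)])
    have "card (insert e I) = Suc (card I)" using e finite_indep[OF M Suc.prems(1)] by simp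
    hence "k = rank_of M X - card (insert e I)" using Suc(2) by simp
    moreover have "insert e I \<subseteq> X" using e B Suc.prems by auto
    ultimately show ?case using Suc(1)[of "insert e I"] e(2) by auto
  qed
  thus ?thesis using that by blast
qed

text \<open>Contraction is defined through inclusion-maximal independent subsets, rank through
  cardinality; augmentation identifies the two notions.\<close>

lemma basis_of_iff:
  assumes M: "is_matroid M"
  shows "basis_of M X B \<longleftrightarrow> B \<in> indep M \<and> B \<subseteq> X \<and> card B = rank_of M X"
proof
  assume b: "basis_of M X B"
  then obtain J where "J \<in> indep M" "B \<subseteq> J" "J \<subseteq> X" "card J = rank_of M X"
    using extend_indep[OF M, of B X] unfolding basis_of_def by blast
  thus "B \<in> indep M \<and> B \<subseteq> X \<and> card B = rank_of M X"
    using b unfolding basis_of_def by blast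
next
  assume b: "B \<in> indep M \<and> B \<subseteq> X \<and> card B = rank_of M X"
  have "C = B" if "C \<in> indep M" "B \<subseteq> C" "C \<subseteq> X" for C
    using card_le_rank_of[OF M that(1,3)] b finite_indep(1)[OF M that(1)] that(2)
    card_seteq[of C B] by simp
  thus "basis_of M X B" using b unfolding basis_of_def by blast
qed

lemma basis_of_exists:
  assumes "is_matroid M"
  obtains B where "basis_of M X B"
proof -
  obtain I where "I \<in> indep M" "I \<subseteq> X" "card I = rank_of M X" by (rule rank_of_attained[OF assms])
  thus ?thesis using that[of I] by (simp add: basis_of_iff[OF assms])
qed

lemma rank_of_insert_gtD:
  assumes M: "is_matroid M" and gt: "rank_of M X < rank_of M (insert e X)" and B: "basis_of M X B"
  shows "insert e B \<in> indep M" "e \<notin> X"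
proof -
  have B': "B \<in> indep M" "B \<subseteq> X" "card B = rank_of M X" using B basis_of_iff[OF M, of X B] by auto
  obtain J where J: "J \<in> indep M" "B \<subseteq> J" "J \<subseteq> insert e X" "card J = rank_of M (insert e X)"
    using extend_indep[OF M B'(1), of "insert e X"] B'(2) by blast
  have "e \<in> J"
  proof (rule ccontr)
    assume "e \<notin> J"
    hence "J \<subseteq> X" using J by auto
    hence "card J \<le> rank_of M X" by (rule card_le_rank_of[OF M J(1)])
    thus False using J(4) gt by simp
  qed
  thus "insert e B \<in> indep M" using J B' indep_mono[OF M J(1), of "insert e B"] by auto
  show "e \<notin> X" using gt by (auto simp: insert_absorb)
qed

lemma rank_of_insert_gtI:
  assumes M: "is_matroid M" and B: "basis_of M X B" and "insert e B \<in> indep M" "e \<notin> B"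
  shows "rank_of M X < rank_of M (insert e X)"
proof -
  have "B \<subseteq> X" "card B = rank_of M X" "finite B"
    using B basis_of_iff[OF M, of X B] finite_indep[OF M, of B] by auto
  moreover have "card (insert e B) \<le> rank_of M (insert e X)"
    using card_le_rank_of[OF M assms(3), of "insert e X"] calculation by auto
  ultimately show ?thesis using assms(4) by simp
qed

text \<open>Extend a basis \<open>C\<close> of the smaller set to a basis \<open>B\<close> of the
  larger one: an element independent of \<open>B\<close> is independent of \<open>C\<close>. This is
  the monotonicity of the closure operator.\<close>

lemma rank_of_insert_gt_antimono:
  assumes M: "is_matroid M" and "Y \<subseteq> X" and gt: "rank_of M X < rank_of M (insert e X)"
  shows "rank_of M Y < rank_of M (insert e Y)"
proof -
  obtain C where C: "basis_of M Y C" using basis_of_exists[OF M] .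
  then have C': "C \<in> indep M" "C \<subseteq> Y" using basis_of_iff[OF M, of Y C] by auto
  obtain B where B: "B \<in> indep M" "C \<subseteq> B" "B \<subseteq> X" "card B = rank_of M X"
    using extend_indep[OF M C'(1), of X] C' assms(2) by blast
  hence e: "insert e B \<in> indep M" "e \<notin> X"
    using rank_of_insert_gtD[OF M gt, of B] basis_of_iff[OF M, of X B] by auto
  show ?thesis
  proof (rule rank_of_insert_gtI[OF M C])
    show "insert e C \<in> indep M" using B by (intro indep_mono[OF M e(1)]) auto
    show "e \<notin> C" using C' assms(2) e(2) by auto
  qed
qed

lemma flatsD: "F \<in> flats M \<Longrightarrow> F \<subseteq> ground M"
  by (simp add: flats_def)

lemma rank_of_flats_strict:
  assumes M: "is_matroid M" and "F \<in> flats M" "G \<in> flats M" "F \<subset> G"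
  shows "rank_of M F < rank_of M G"
proof -
  obtain e where "e \<in> G - F" using assms(4) by auto
  hence "rank_of M F < rank_of M (insert e F)" using assms(2,3) unfolding flats_def by auto
  also have "\<dots> \<le> rank_of M G" using assms(4) \<open>e \<in> G - F\<close> by (intro rank_of_mono[OF M]) auto
  finally show ?thesis .
qed

lemma ground_in_flats: "ground M \<in> flats M"
  by (simp add: flats_def)

lemma empty_in_flats:
  assumes "is_matroid M" "loopless M"
  shows "{} \<in> flats M"
proof -
  have "0 < rank_of M {e}" if "e \<in> ground M" for e
    using card_le_rank_of[OF assms(1), of "{e}" "{e}"] that assms(2) by (simp add: loopless_def)
  thus ?thesis by (simp add: flats_def rank_of_empty[OF assms(1)])
qed

lemma finite_flats:
  assumes "is_matroid M"
  shows "finite (flats M)" "F \<in> flats M \<Longrightarrow> finite F"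
proof -
  have fin: "finite (ground M)" using assms by (simp add: is_matroid_def)
  have "flats M \<subseteq> Pow (ground M)" by (auto simp: flats_def)
  thus "finite (flats M)" by (rule finite_subset) (simp add: fin)
  show "F \<in> flats M \<Longrightarrow> finite F" by (rule finite_subset[OF flatsD fin])
qed

section \<open>Restriction and contraction\<close>

lemma ground_restriction [simp]: "ground (restriction M X) = X"
  and indep_restriction: "indep (restriction M X) = {I \<in> indep M. I \<subseteq> X}"
  by (simp_all add: restriction_def)

lemma is_matroid_restriction:
  assumes M: "is_matroid M" and X: "X \<subseteq> ground M"
  shows "is_matroid (restriction M X)"
  unfolding is_matroid_def
proof (intro conjI allI impI)
  have "finite (ground M)" using M by (simp add: is_matroid_def)
  thus "finite (ground (restriction M X))" using X by (auto intro: finite_subset)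
  show "indep (restriction M X) \<subseteq> Pow (ground (restriction M X))" by (auto simp: indep_restriction)
  show "{} \<in> indep (restriction M X)" using M by (simp add: indep_restriction is_matroid_def)
next
  fix I J assume "I \<in> indep (restriction M X)" "J \<subseteq> I"
  thus "J \<in> indep (restriction M X)" using indep_mono[OF M, of I J] by (auto simp: indep_restriction)
next
  fix I J assume "I \<in> indep (restriction M X)" "J \<in> indep (restriction M X)" and less: "card I < card J"
  hence IJ: "I \<in> indep M" "J \<in> indep M" "I \<subseteq> X" "J \<subseteq> X" by (auto simp: indep_restriction)
  obtain e where e: "e \<in> J - I" "insert e I \<in> indep M" by (rule indep_augment[OF M IJ(1,2) less])
  thus "\<exists>e\<in>J - I. insert e I \<in> indep (restriction M X)"
    using IJ by (intro bexI[of _ e]) (auto simp: indep_restriction)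
qed

lemma loopless_restriction: "loopless M \<Longrightarrow> X \<subseteq> ground M \<Longrightarrow> loopless (restriction M X)"
  unfolding loopless_def by (auto simp: indep_restriction)

lemma rank_of_restriction: "Y \<subseteq> X \<Longrightarrow> rank_of (restriction M X) Y = rank_of M Y"
  unfolding rank_of_def indep_restriction
  by (rule arg_cong[where f = "\<lambda>A. Max (card ` A)"]) auto

lemma flats_restriction:
  assumes M: "is_matroid M" and F: "F \<in> flats M"
  shows "flats (restriction M F) = {G \<in> flats M. G \<subseteq> F}"
proof (intro equalityI subsetI)
  fix G assume G: "G \<in> flats (restriction M F)"
  hence GF: "G \<subseteq> F" by (auto simp: flats_def)
  have "rank_of M G < rank_of M (insert e G)" if "e \<in> ground M - G" for e
  proof (cases "e \<in> F")
    case True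
    thus ?thesis using G that GF unfolding flats_def by (auto simp: rank_of_restriction)
  next
    case False
    \<comment> \<open>Outside \<open>F\<close> the element raises the rank of the flat
      \<open>F\<close>, hence that of its subset \<open>G\<close>.\<close>
    thus ?thesis using that F rank_of_insert_gt_antimono[OF M GF, of e] unfolding flats_def by auto
  qed
  thus "G \<in> {G \<in> flats M. G \<subseteq> F}" using GF flatsD[OF F] by (auto simp: flats_def)
next
  fix G assume "G \<in> {G \<in> flats M. G \<subseteq> F}"
  thus "G \<in> flats (restriction M F)" using flatsD[OF F]
    by (auto simp: flats_def rank_of_restriction)
qed

lemma ground_contraction [simp]: "ground (contraction M X) = ground M - X"
  by (simp add: contraction_def)

lemma indep_contraction:
  "I \<in> indep (contraction M X) \<longleftrightarrow> I \<subseteq> ground M - X \<and> (\<exists>B. basis_of M X B \<and> I \<union> B \<in> indep M)"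
  by (simp add: contraction_def)

lemma is_matroid_contraction:
  assumes M: "is_matroid M"
  shows "is_matroid (contraction M X)"
  unfolding is_matroid_def
proof (intro conjI allI impI)
  show "finite (ground (contraction M X))" using M by (simp add: is_matroid_def)
  show "indep (contraction M X) \<subseteq> Pow (ground (contraction M X))"
    by (auto simp: indep_contraction)
  obtain B where "basis_of M X B" using basis_of_exists[OF M] .
  thus "{} \<in> indep (contraction M X)" unfolding indep_contraction basis_of_def by auto
next
  fix I J assume "I \<in> indep (contraction M X)" "J \<subseteq> I"
  then show "J \<in> indep (contraction M X)"
    unfolding indep_contraction by (metis M Un_mono indep_mono order_refl order_trans)
next
  fix I J assume I: "I \<in> indep (contraction M X)" and J: "J \<in> indep (contraction M X)"
    and less: "card I < card J"
  from I obtain B where B: "basis_of M X B" "I \<union> B \<in> indep M" "I \<subseteq> ground M - X"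
    unfolding indep_contraction by auto
  from J obtain C where C: "basis_of M X C" "J \<union> C \<in> indep M" "J \<subseteq> ground M - X"
    unfolding indep_contraction by auto
  note B' = B(1)[unfolded basis_of_iff[OF M]] and C' = C(1)[unfolded basis_of_iff[OF M]]
  have "card (I \<union> B) = card I + card B"
    using finite_indep(1)[OF M B(2)] B(3) B' by (intro card_Un_disjoint) auto
  moreover have "card (J \<union> C) = card J + card C"
    using finite_indep(1)[OF M C(2)] C(3) C' by (intro card_Un_disjoint) auto
  ultimately have "card (I \<union> B) < card (J \<union> C)" using less B' C' by simp
  then obtain e where e: "e \<in> (J \<union> C) - (I \<union> B)" "insert e (I \<union> B) \<in> indep M"
    by (rule indep_augment[OF M B(2) C(2)])
  \<comment> \<open>An augmenting element taken from \<open>C\<close> would enlarge the basis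
    \<open>B\<close> inside \<open>X\<close>.\<close>
  have "e \<notin> C"
  proof
    assume "e \<in> C"
    hence "insert e B \<subseteq> X" using B' C' by auto
    moreover have "insert e B \<in> indep M" using indep_mono[OF M e(2), of "insert e B"] by auto
    ultimately show False using B(1) e(1) unfolding basis_of_def by blast
  qed
  hence "e \<in> J - I" "insert e I \<subseteq> ground M - X" using e(1) B(3) C(3) by auto
  moreover have "insert e I \<union> B \<in> indep M" using e(2) by simp
  ultimately show "\<exists>e\<in>J - I. insert e I \<in> indep (contraction M X)"
    using B(1) unfolding indep_contraction by blast
qed

lemma rank_of_contraction:
  assumes M: "is_matroid M" and Y: "Y \<subseteq> ground M - X"
  shows "rank_of (contraction M X) Y + rank_of M X = rank_of M (Y \<union> X)"
proof (rule order_antisym)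
  note C = is_matroid_contraction[OF M, of X]
  obtain I where I: "I \<in> indep (contraction M X)" "I \<subseteq> Y" "card I = rank_of (contraction M X) Y"
    using rank_of_attained[OF C] .
  then obtain B where B: "basis_of M X B" "I \<union> B \<in> indep M" by (auto simp: indep_contraction)
  note B' = B(1)[unfolded basis_of_iff[OF M]]
  have "card (I \<union> B) = card I + card B"
    using finite_indep(1)[OF M B(2)] B' I Y by (intro card_Un_disjoint) auto
  moreover have "card (I \<union> B) \<le> rank_of M (Y \<union> X)"
    using B B' I by (intro card_le_rank_of[OF M]) auto
  ultimately show "rank_of (contraction M X) Y + rank_of M X \<le> rank_of M (Y \<union> X)"
    using B' I by simp
next
  note C = is_matroid_contraction[OF M, of X]
  obtain B where B: "basis_of M X B" using basis_of_exists[OF M] .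
  note B' = B(1)[unfolded basis_of_iff[OF M]]
  obtain J where J: "J \<in> indep M" "B \<subseteq> J" "J \<subseteq> Y \<union> X" "card J = rank_of M (Y \<union> X)"
    using extend_indep[OF M, of B "Y \<union> X"] B' by blast
  have fin: "finite J" using finite_indep[OF M J(1)] by simp
  \<comment> \<open>By maximality of \<open>B\<close> in \<open>X\<close>, everything that
    \<open>J\<close> adds to \<open>B\<close> lies in \<open>Y\<close>.\<close>
  have "J \<inter> X \<in> indep M" by (rule indep_mono[OF M J(1)]) simp
  moreover have "B \<subseteq> J \<inter> X" using B' J by simp
  ultimately have "J \<inter> X = B" using B unfolding basis_of_def by simp
  hence eq: "J - B \<subseteq> Y" using J by auto
  have "J - B \<union> B = J" using J by auto
  hence "J - B \<in> indep (contraction M X)" using eq Y B J unfolding indep_contraction by auto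
  hence "card (J - B) \<le> rank_of (contraction M X) Y" using eq by (intro card_le_rank_of[OF C]) auto
  moreover have "card (J - B) = card J - card B" using J fin finite_subset by (intro card_Diff_subset) auto
  ultimately show "rank_of M (Y \<union> X) \<le> rank_of (contraction M X) Y + rank_of M X"
    using J B' by simp
qed

lemma loopless_contraction:
  assumes M: "is_matroid M" and F: "F \<in> flats M"
  shows "loopless (contraction M F)"
  unfolding loopless_def
proof
  fix e assume "e \<in> ground (contraction M F)"
  hence e: "e \<in> ground M - F" by simp
  obtain B where B: "basis_of M F B" using basis_of_exists[OF M] .
  have "insert e B \<in> indep M"
    using F e B rank_of_insert_gtD[OF M] unfolding flats_def by blast
  thus "{e} \<in> indep (contraction M F)" using B e unfolding indep_contraction by auto
qed

lemma flats_contraction: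
  assumes M: "is_matroid M" and F: "F \<in> flats M"
  shows "Y \<in> flats (contraction M F) \<longleftrightarrow> Y \<inter> F = {} \<and> Y \<union> F \<in> flats M"
proof -
  have *: "rank_of (contraction M F) Y < rank_of (contraction M F) (insert e Y) \<longleftrightarrow>
    rank_of M (Y \<union> F) < rank_of M (insert e (Y \<union> F))"
    if "Y \<subseteq> ground M - F" "e \<in> ground M - F - Y" for e
    using rank_of_contraction[OF M, of Y F] rank_of_contraction[OF M, of "insert e Y" F] that by auto
  have eq: "ground M - (Y \<union> F) = ground M - F - Y" by auto
  show ?thesis
  proof (cases "Y \<subseteq> ground M - F")
    case True
    hence "Y \<in> flats (contraction M F) \<longleftrightarrow> Y \<union> F \<in> flats M"
      using *[OF True] flatsD[OF F] by (auto simp: flats_def eq)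
    thus ?thesis using True by auto
  next
    case False
    thus ?thesis by (auto simp: flats_def)
  qed
qed

lemma rk_contraction:
  assumes M: "is_matroid M" and F: "F \<subseteq> ground M"
  shows "rk (contraction M F) + rank_of M F = rk M"
  using rank_of_contraction[OF M, of "ground M - F" F] F by (simp add: rk_def Un_absorb2)

lemma matroid_iso_flats:
  assumes M: "is_matroid M" and N: "is_matroid N"
    and f: "bij_betw f (ground M) (ground N)"
      "\<And>I. I \<subseteq> ground M \<Longrightarrow> I \<in> indep M \<longleftrightarrow> f ` I \<in> indep N"
  shows "X \<subseteq> ground M \<Longrightarrow> rank_of N (f ` X) = rank_of M X"
    and "flats N = (`) f ` flats M"
proof -
  have inj: "inj_on f (ground M)" and im: "f ` ground M = ground N"
    using f(1) by (auto simp: bij_betw_def)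
  show rank: "rank_of N (f ` X) = rank_of M X" if X: "X \<subseteq> ground M" for X
  proof -
    have "card ` {I \<in> indep N. I \<subseteq> f ` X} = card ` {I \<in> indep M. I \<subseteq> X}"
    proof (intro equalityI subsetI)
      fix k assume "k \<in> card ` {I \<in> indep N. I \<subseteq> f ` X}"
      then obtain I where I: "I \<in> indep N" "I \<subseteq> f ` X" "k = card I" by auto
      then obtain J where J: "J \<subseteq> X" "I = f ` J" by (meson subset_imageE)
      have "card I = card J" using J X inj by (metis card_image inj_on_subset)
      moreover have "J \<in> indep M" using J X f(2)[of J] I by auto
      ultimately show "k \<in> card ` {I \<in> indep M. I \<subseteq> X}" using I J by auto
    next
      fix k assume "k \<in> card ` {I \<in> indep M. I \<subseteq> X}"
      then obtain J where J: "J \<in> indep M" "J \<subseteq> X" "k = card J" by auto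
      have "card (f ` J) = card J" using J X inj by (metis card_image inj_on_subset)
      thus "k \<in> card ` {I \<in> indep N. I \<subseteq> f ` X}" using J X f(2)[of J] by force
    qed
    thus ?thesis by (simp add: rank_of_def)
  qed
  have fl: "f ` F \<in> flats N \<longleftrightarrow> F \<in> flats M" if F: "F \<subseteq> ground M" for F
  proof -
    have "ground N - f ` F = f ` (ground M - F)" using im inj F by (simp add: inj_on_image_set_diff)
    moreover have "rank_of N (insert (f e) (f ` F)) = rank_of M (insert e F)" if "e \<in> ground M" for e
      using rank[of "insert e F"] that F by simp
    moreover have "f ` F \<subseteq> ground N" using F im by auto
    ultimately show ?thesis using F rank[OF F] unfolding flats_def by auto
  qed
  show "flats N = (`) f ` flats M"
  proof (intro equalityI subsetI)
    fix G assume G: "G \<in> flats N"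
    then obtain F where "F \<subseteq> ground M" "G = f ` F" using im by (metis flatsD subset_imageE)
    thus "G \<in> (`) f ` flats M" using fl G by blast
  next
    fix G assume "G \<in> (`) f ` flats M"
    thus "G \<in> flats N" using fl flatsD by blast
  qed
qed

section \<open>Kazhdan--Lusztig polynomials of ranked families of sets\<close>

text \<open>Generalises \<open>reverse_at\<close> to other coefficient rings, because the
  palindromic functions on partitions are rational. Coefficients above \<open>n\<close> are dropped,
  so invariance under \<open>rev_at n\<close> includes the bound \<open>n\<close> on the
  degree.\<close>

definition rev_at :: "nat \<Rightarrow> 'b::comm_ring_1 poly \<Rightarrow> 'b poly" where
  "rev_at n p = (\<Sum>i\<le>n. monom (coeff p i) (n - i))"

lemma reverse_at_eq_rev_at: "reverse_at n p = rev_at n p"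
  by (simp add: reverse_at_def rev_at_def)

lemma coeff_rev_at: "coeff (rev_at n p) k = (if k \<le> n then coeff p (n - k) else 0)"
proof (cases "k \<le> n")
  case True
  have "coeff (rev_at n p) k = (\<Sum>i\<le>n. if i = n - k then coeff p i else 0)"
    unfolding rev_at_def coeff_sum coeff_monom using True by (intro sum.cong) auto
  thus ?thesis using True by simp
qed (auto simp: rev_at_def coeff_sum intro!: sum.neutral)

lemma rev_at_sum: "rev_at n (sum f A) = (\<Sum>x\<in>A. rev_at n (f x))"
  by (rule poly_eqI) (simp add: coeff_rev_at coeff_sum)

lemma rev_at_smult: "rev_at n (smult c p) = smult c (rev_at n p)"
  by (rule poly_eqI) (simp add: coeff_rev_at)

lemma rev_at_monom_mult:
  assumes "k \<le> n"
  shows "rev_at n (monom 1 k * p) = rev_at (n - k) p"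
  by (rule poly_eqI) (use assms in \<open>auto simp: coeff_rev_at coeff_monom_mult add.commute\<close>)

lemma degree_le_rev_at: "degree (rev_at n p) \<le> n"
  by (rule degree_le) (simp add: coeff_rev_at)

lemma rev_at_add_monom_mult:
  assumes "k \<le> m" "degree q \<le> n"
  shows "rev_at (m + n) (monom c k * q) = monom c (m - k) * rev_at n q"
proof (rule poly_eqI)
  fix i
  show "coeff (rev_at (m + n) (monom c k * q)) i = coeff (monom c (m - k) * rev_at n q) i"
  proof (cases "i < m - k")
    case True
    hence "degree q < m + n - i - k" using assms by simp
    thus ?thesis using True by (simp add: coeff_rev_at coeff_monom_mult coeff_eq_0)
  next
    case False
    hence "m + n - (i + k) = n - (i - (m - k))" if "i + k \<le> m + n" using that assms by simp
    thus ?thesis using False assms by (auto simp: coeff_rev_at coeff_monom_mult)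
  qed
qed

lemma rev_at_mult:
  assumes "degree p \<le> m" "degree q \<le> n"
  shows "rev_at (m + n) (p * q) = rev_at m p * rev_at n q"
proof -
  have "p = (\<Sum>k\<le>m. monom (coeff p k) k)" by (rule poly_as_sum_of_monoms'[OF assms(1), symmetric])
  hence "p * q = (\<Sum>k\<le>m. monom (coeff p k) k) * q" by (rule arg_cong)
  hence "rev_at (m + n) (p * q) = rev_at (m + n) (\<Sum>k\<le>m. monom (coeff p k) k * q)"
    by (simp only: sum_distrib_right)
  also have "\<dots> = (\<Sum>k\<le>m. monom (coeff p k) (m - k) * rev_at n q)"
    using assms(2) by (simp add: rev_at_sum rev_at_add_monom_mult)
  also have "\<dots> = rev_at m p * rev_at n q"
    by (simp add: rev_at_def sum_distrib_right)
  finally show ?thesis .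
qed

text \<open>Reversal pairs the index i with n - i, and one of the two is at least n / 2. All
  uniqueness arguments for Kazhdan--Lusztig polynomials end here.\<close>

lemma palindromic_low_degree_eq_0:
  assumes "rev_at n p = p" "\<And>i. n \<le> 2 * i \<Longrightarrow> coeff p i = 0"
  shows "p = 0"
proof (rule poly_eqI)
  fix i
  show "coeff p i = coeff 0 i"
  proof (cases "n \<le> 2 * i")
    case False
    hence "coeff p i = coeff p (n - i)" using coeff_rev_at[of n p i] assms(1) by simp
    thus ?thesis using False assms(2) by simp
  qed (use assms(2) in simp)
qed

text \<open>The correction of degree below n / 2 that makes \<open>S\<close> palindromic: each low
  coefficient is replaced by its mirror image, and the middle one needs no change.\<close>

definition half_part :: "nat \<Rightarrow> int poly \<Rightarrow> int poly" where
  "half_part n S = (\<Sum>i | 2 * i < n. monom (coeff S (n - i) - coeff S i) i)"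

lemma coeff_half_part: "coeff (half_part n S) k = (if 2 * k < n then coeff S (n - k) - coeff S k else 0)"
proof -
  have "finite {i. 2 * i < n}" by (rule finite_subset[of _ "{..n}"]) auto
  thus ?thesis by (simp add: half_part_def coeff_sum)
qed

lemma degree_half_part: "n > 0 \<Longrightarrow> 2 * degree (half_part n S) < n"
  using leading_coeff_0_iff[of "half_part n S"] coeff_half_part[of n S "degree (half_part n S)"]
  by (cases "half_part n S = 0") (auto split: if_splits)

lemma rev_at_half_part_add:
  assumes "degree S \<le> n"
  shows "rev_at n (half_part n S + S) = half_part n S + S"
proof (rule poly_eqI)
  fix k
  show "coeff (rev_at n (half_part n S + S)) k = coeff (half_part n S + S) k"
  proof (cases "k \<le> n")
    case True
    hence "2 * k < n \<or> 2 * (n - k) < n \<or> n - k = k" by linarith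
    thus ?thesis using True by (auto simp: coeff_rev_at coeff_half_part)
  qed (use assms in \<open>auto simp: coeff_rev_at coeff_half_part coeff_eq_0\<close>)
qed

section \<open>Intervals, the recursions for P and its inverse, and isomorphism invariance\<close>

definition ivl :: "'a set set \<Rightarrow> 'a set \<Rightarrow> 'a set \<Rightarrow> 'a set set" where
  "ivl L x y = {z \<in> L. x \<subseteq> z \<and> z \<subseteq> y}"

text \<open>The low-degree part is chosen so as to make the polynomials \<open>zpoly\<close> below palindromic, which is
  possible without any solvability condition; \<open>kl_char\<close> shows that this gives the Kazhdan--Lusztig
  polynomial of the interval from \<open>x\<close> to \<open>y\<close>.\<close>

function kl :: "'a set set \<Rightarrow> ('a set \<Rightarrow> nat) \<Rightarrow> 'a set \<Rightarrow> 'a set \<Rightarrow> int poly" where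
  "kl L r y x = (if finite L \<and> x \<subset> y
     then half_part (r y - r x) (\<Sum>z \<in> {z \<in> L. x \<subset> z \<and> z \<subseteq> y}. monom 1 (r z - r x) * kl L r y z)
     else 1)"
  by pat_completeness auto
termination
  by (relation "measure (\<lambda>(L, r, y, x). card {z \<in> L. x \<subset> z})") (auto intro!: psubset_card_mono)

declare kl.simps [simp del]

text \<open>The unsigned inverse of \<open>kl\<close> in the incidence algebra; the sign (-1)^rk
  enters only with \<open>lattice_inverse_KL\<close>. The recursion moves the lower end
  \<open>x\<close>, the last argument. The value 1 for incomparable arguments is a default.\<close>

function ikl :: "'a set set \<Rightarrow> ('a set \<Rightarrow> nat) \<Rightarrow> 'a set \<Rightarrow> 'a set \<Rightarrow> int poly" where
  "ikl L r y x = (if finite L \<and> x \<subset> y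
     then - (\<Sum>z \<in> {z \<in> L. x \<subset> z \<and> z \<subseteq> y}. kl L r z x * ikl L r y z)
     else 1)"
  by pat_completeness auto
termination
  by (relation "measure (\<lambda>(L, r, y, x). card {z \<in> L. x \<subset> z})") (auto intro!: psubset_card_mono)

declare ikl.simps [simp del]

lemma kl_refl [simp]: "kl L r x x = 1"
  by (simp add: kl.simps)

lemma ikl_refl [simp]: "ikl L r x x = 1"
  by (simp add: ikl.simps)

lemma finite_ivl: "finite L \<Longrightarrow> finite (ivl L x y)"
  by (simp add: ivl_def)

lemma ivl_refl: "x \<in> L \<Longrightarrow> ivl L x x = {x}"
  by (auto simp: ivl_def)

lemma ivl_split_bot: "x \<in> L \<Longrightarrow> x \<subset> y \<Longrightarrow> ivl L x y = insert x {z \<in> L. x \<subset> z \<and> z \<subseteq> y}"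
  by (auto simp: ivl_def)

text \<open>Both sides run over the chains x <= z <= w <= y; this is the exchange behind
  associativity of convolution.\<close>

lemma sum_ivl_swap:
  assumes "finite L"
  shows "(\<Sum>w\<in>ivl L x y. \<Sum>z\<in>ivl L x w. f z w) = (\<Sum>z\<in>ivl L x y. \<Sum>w\<in>ivl L z y. f z w)"
proof -
  have "(\<Sum>w\<in>ivl L x y. \<Sum>z\<in>ivl L x w. f z w) = (\<Sum>w\<in>ivl L x y. \<Sum>z | z \<in> ivl L x y \<and> z \<subseteq> w. f z w)"
    by (intro sum.cong) (auto simp: ivl_def)
  also have "\<dots> = (\<Sum>z\<in>ivl L x y. \<Sum>w | w \<in> ivl L x y \<and> z \<subseteq> w. f z w)"
    by (rule sum.swap_restrict) (simp_all add: finite_ivl assms)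
  also have "\<dots> = (\<Sum>z\<in>ivl L x y. \<Sum>w\<in>ivl L z y. f z w)"
    by (intro sum.cong) (auto simp: ivl_def)
  finally show ?thesis .
qed

lemma sum_moebius:
  assumes "finite L" "x \<in> L" "y \<in> L" "finite y" "x \<subseteq> y"
  shows "(\<Sum>z\<in>ivl L x y. moebius L x z) = (if x = y then 1 else 0)"
proof (cases "x = y")
  case False
  have "ivl L x y = insert y {z \<in> L. x \<subseteq> z \<and> z \<subset> y}" using assms by (auto simp: ivl_def)
  thus ?thesis using False assms moebius.simps[of L x y] by simp
qed (use assms in \<open>simp add: ivl_refl moebius.simps\<close>)

lemma moebius_restrict:
  assumes "finite y" "y \<subseteq> F"
  shows "moebius {z \<in> L. z \<subseteq> F} x y = moebius L x y"
  using assms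
proof (induction "card y" arbitrary: y rule: less_induct)
  case less
  have "{z \<in> {z \<in> L. z \<subseteq> F}. x \<subseteq> z \<and> z \<subset> y} = {z \<in> L. x \<subseteq> z \<and> z \<subset> y}" using less.prems by auto
  moreover have "moebius {z \<in> L. z \<subseteq> F} x z = moebius L x z" if "z \<subset> y" for z
    using that less.prems by (intro less.hyps psubset_card_mono) (auto intro: finite_subset)
  ultimately show ?case
    using moebius.simps[of L x y] moebius.simps[of "{z \<in> L. z \<subseteq> F}" x y] by simp
qed

text \<open>Only differences of ranks are compared, so that passing to a contraction, which lowers
  all ranks by that of the contracted flat, is covered.\<close>

definition ivl_iso :: "('a set \<Rightarrow> 'b set) \<Rightarrow> 'a set set \<Rightarrow> ('a set \<Rightarrow> nat) \<Rightarrow> 'a set \<Rightarrow> 'a set \<Rightarrow>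
    'b set set \<Rightarrow> ('b set \<Rightarrow> nat) \<Rightarrow> bool" where
  "ivl_iso \<phi> L r x y L' r' \<longleftrightarrow> x \<in> L \<and> y \<in> L \<and> x \<subseteq> y \<and>
     \<phi> ` ivl L x y = ivl L' (\<phi> x) (\<phi> y) \<and>
     (\<forall>u\<in>ivl L x y. \<forall>v\<in>ivl L x y. (\<phi> u \<subseteq> \<phi> v \<longleftrightarrow> u \<subseteq> v) \<and>
        (u \<subseteq> v \<longrightarrow> r' (\<phi> v) - r' (\<phi> u) = r v - r u))"

lemma ivl_iso_sub:
  assumes "ivl_iso \<phi> L r x y L' r'" "u \<in> ivl L x y" "v \<in> ivl L x y" "u \<subseteq> v"
  shows "ivl_iso \<phi> L r u v L' r'"
proof -
  have sub: "ivl L u v \<subseteq> ivl L x y" using assms by (auto simp: ivl_def)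
  have ord: "\<phi> a \<subseteq> \<phi> b \<longleftrightarrow> a \<subseteq> b" if "a \<in> ivl L x y" "b \<in> ivl L x y" for a b
    using assms(1) that unfolding ivl_iso_def by blast
  have xy: "x \<in> ivl L x y" "y \<in> ivl L x y" using assms(1) by (auto simp: ivl_iso_def ivl_def)
  have im: "\<phi> ` ivl L x y = ivl L' (\<phi> x) (\<phi> y)" using assms(1) by (simp add: ivl_iso_def)
  have "\<phi> ` ivl L u v = ivl L' (\<phi> u) (\<phi> v)"
  proof (intro equalityI subsetI)
    fix w' assume "w' \<in> \<phi> ` ivl L u v"
    then obtain w where w: "w \<in> ivl L u v" "w' = \<phi> w" by (elim imageE) simp
    hence "w' \<in> ivl L' (\<phi> x) (\<phi> y)" using imageI[OF subsetD[OF sub w(1)], of \<phi>] im by simp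
    moreover have "w \<in> ivl L x y" "u \<subseteq> w" "w \<subseteq> v" using w(1) sub by (auto simp: ivl_def)
    hence "\<phi> u \<subseteq> w'" "w' \<subseteq> \<phi> v" using ord[OF assms(2)] ord[OF _ assms(3)] w(2) by simp_all
    ultimately show "w' \<in> ivl L' (\<phi> u) (\<phi> v)" by (simp add: ivl_def)
  next
    fix w' assume w': "w' \<in> ivl L' (\<phi> u) (\<phi> v)"
    have "x \<subseteq> u" "v \<subseteq> y" using assms(2,3) by (auto simp: ivl_def)
    hence "\<phi> x \<subseteq> \<phi> u" "\<phi> v \<subseteq> \<phi> y"
      using ord[OF xy(1) assms(2)] ord[OF assms(3) xy(2)] by simp_all
    hence "w' \<in> ivl L' (\<phi> x) (\<phi> y)" using w' by (auto simp: ivl_def)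
    then obtain w where w: "w \<in> ivl L x y" "w' = \<phi> w" unfolding im[symmetric] by (rule imageE)
    have "\<phi> u \<subseteq> \<phi> w" "\<phi> w \<subseteq> \<phi> v" using w' w(2) by (auto simp: ivl_def)
    hence "u \<subseteq> w" "w \<subseteq> v" using ord[OF assms(2) w(1)] ord[OF w(1) assms(3)] by simp_all
    thus "w' \<in> \<phi> ` ivl L u v" using w by (auto simp: ivl_def)
  qed
  moreover have "u \<in> L" "v \<in> L" using assms(2,3) by (auto simp: ivl_def)
  moreover have "\<forall>a\<in>ivl L u v. \<forall>b\<in>ivl L u v. (\<phi> a \<subseteq> \<phi> b \<longleftrightarrow> a \<subseteq> b) \<and>
      (a \<subseteq> b \<longrightarrow> r' (\<phi> b) - r' (\<phi> a) = r b - r a)"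
    using assms(1) subsetD[OF sub] unfolding ivl_iso_def by simp
  ultimately show ?thesis using assms(4) unfolding ivl_iso_def by (intro conjI)
qed

lemma ivl_iso_upper:
  assumes "ivl_iso \<phi> L r x y L' r'"
  shows "{z \<in> L'. \<phi> x \<subset> z \<and> z \<subseteq> \<phi> y} = \<phi> ` {z \<in> L. x \<subset> z \<and> z \<subseteq> y}"
    and "inj_on \<phi> (ivl L x y)" and "\<phi> x \<subset> \<phi> y \<longleftrightarrow> x \<subset> y"
proof -
  have xy: "x \<in> ivl L x y" "y \<in> ivl L x y" using assms by (auto simp: ivl_iso_def ivl_def)
  have ord: "\<phi> a \<subseteq> \<phi> b \<longleftrightarrow> a \<subseteq> b" if "a \<in> ivl L x y" "b \<in> ivl L x y" for a b
    using assms that unfolding ivl_iso_def by blast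
  show inj: "inj_on \<phi> (ivl L x y)"
  proof (rule inj_onI)
    fix a b assume ab: "a \<in> ivl L x y" "b \<in> ivl L x y" "\<phi> a = \<phi> b"
    show "a = b" using ord[OF ab(1,2)] ord[OF ab(2,1)] ab(3) by simp
  qed
  have strict: "\<phi> a \<subset> \<phi> b \<longleftrightarrow> a \<subset> b" if "a \<in> ivl L x y" "b \<in> ivl L x y" for a b
    using ord[OF that] ord[OF that(2,1)] by (simp add: less_le_not_le)
  show "\<phi> x \<subset> \<phi> y \<longleftrightarrow> x \<subset> y" by (rule strict[OF xy])
  have "{z \<in> L'. \<phi> x \<subset> z \<and> z \<subseteq> \<phi> y} = {z \<in> \<phi> ` ivl L x y. \<phi> x \<subset> z}"
    using assms unfolding ivl_iso_def by (auto simp: ivl_def)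
  also have "\<dots> = \<phi> ` {z \<in> ivl L x y. x \<subset> z}"
  proof -
    have "{w \<in> \<phi> ` A. Q w} = \<phi> ` {z \<in> A. P z}" if "\<And>z. z \<in> A \<Longrightarrow> Q (\<phi> z) \<longleftrightarrow> P z" for A P Q
      using that by auto
    from this[of "ivl L x y" "\<lambda>w. \<phi> x \<subset> w" "\<lambda>z. x \<subset> z", OF strict[OF xy(1)]] show ?thesis .
  qed
  also have "{z \<in> ivl L x y. x \<subset> z} = {z \<in> L. x \<subset> z \<and> z \<subseteq> y}" by (auto simp: ivl_def)
  finally show "{z \<in> L'. \<phi> x \<subset> z \<and> z \<subseteq> \<phi> y} = \<phi> ` {z \<in> L. x \<subset> z \<and> z \<subseteq> y}" .
qed

text \<open>The recursion sees only the order and the rank differences inside the interval. This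
  yields isomorphism invariance and identifies the values on restrictions and contractions with
  values inside one lattice.\<close>

lemma kl_iso:
  assumes "finite L" "finite L'" "ivl_iso \<phi> L r x y L' r'"
  shows "kl L' r' (\<phi> y) (\<phi> x) = kl L r y x"
  using assms(3)
proof (induction "card {z \<in> L. x \<subset> z}" arbitrary: x rule: less_induct)
  case less
  note iso = less.prems
  have xy: "x \<in> ivl L x y" "y \<in> ivl L x y" using iso by (auto simp: ivl_iso_def ivl_def)
  have rd: "r' (\<phi> v) - r' (\<phi> x) = r v - r x" if "v \<in> ivl L x y" for v
    using iso that xy unfolding ivl_iso_def by (auto simp: ivl_def)
  show ?case
  proof (cases "x \<subset> y")
    case True
    have sub: "{z \<in> L. x \<subset> z \<and> z \<subseteq> y} \<subseteq> ivl L x y" by (auto simp: ivl_def)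
    have IH: "kl L' r' (\<phi> y) (\<phi> z) = kl L r y z" if "z \<in> {z \<in> L. x \<subset> z \<and> z \<subseteq> y}" for z
    proof (rule less.hyps)
      show "card {w \<in> L. z \<subset> w} < card {z \<in> L. x \<subset> z}"
        using that assms(1) by (intro psubset_card_mono) auto
      show "ivl_iso \<phi> L r z y L' r'" using that sub xy by (intro ivl_iso_sub[OF iso]) auto
    qed
    have "(\<Sum>z \<in> {z \<in> L'. \<phi> x \<subset> z \<and> z \<subseteq> \<phi> y}. monom 1 (r' z - r' (\<phi> x)) * kl L' r' (\<phi> y) z) =
      (\<Sum>z \<in> {z \<in> L. x \<subset> z \<and> z \<subseteq> y}. monom 1 (r' (\<phi> z) - r' (\<phi> x)) * kl L' r' (\<phi> y) (\<phi> z))"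
      unfolding ivl_iso_upper(1)[OF iso]
      by (subst sum.reindex[OF inj_on_subset[OF ivl_iso_upper(2)[OF iso] sub]]) simp
    also have "\<dots> = (\<Sum>z \<in> {z \<in> L. x \<subset> z \<and> z \<subseteq> y}. monom 1 (r z - r x) * kl L r y z)"
      using IH rd sub by (intro sum.cong) auto
    finally show ?thesis
      using True ivl_iso_upper(3)[OF iso] assms rd[OF xy(2)]
      by (simp add: kl.simps[of L r y x] kl.simps[of L' r' "\<phi> y" "\<phi> x"])
  next
    case False
    thus ?thesis using ivl_iso_upper(3)[OF iso]
      by (simp add: kl.simps[of L r y x] kl.simps[of L' r' "\<phi> y" "\<phi> x"])
  qed
qed

lemma ikl_iso:
  assumes "finite L" "finite L'" "ivl_iso \<phi> L r x y L' r'"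
  shows "ikl L' r' (\<phi> y) (\<phi> x) = ikl L r y x"
  using assms(3)
proof (induction "card {z \<in> L. x \<subset> z}" arbitrary: x rule: less_induct)
  case less
  note iso = less.prems
  have xy: "x \<in> ivl L x y" "y \<in> ivl L x y" using iso by (auto simp: ivl_iso_def ivl_def)
  show ?case
  proof (cases "x \<subset> y")
    case True
    have sub: "{z \<in> L. x \<subset> z \<and> z \<subseteq> y} \<subseteq> ivl L x y" by (auto simp: ivl_def)
    have IH: "ikl L' r' (\<phi> y) (\<phi> z) = ikl L r y z" if "z \<in> {z \<in> L. x \<subset> z \<and> z \<subseteq> y}" for z
    proof (rule less.hyps)
      show "card {w \<in> L. z \<subset> w} < card {z \<in> L. x \<subset> z}"
        using that assms(1) by (intro psubset_card_mono) auto
      show "ivl_iso \<phi> L r z y L' r'" using that sub xy by (intro ivl_iso_sub[OF iso]) auto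
    qed
    have klz: "kl L' r' (\<phi> z) (\<phi> x) = kl L r z x" if "z \<in> {z \<in> L. x \<subset> z \<and> z \<subseteq> y}" for z
      using that sub xy by (intro kl_iso[OF assms(1,2)] ivl_iso_sub[OF iso]) auto
    have "(\<Sum>z \<in> {z \<in> L'. \<phi> x \<subset> z \<and> z \<subseteq> \<phi> y}. kl L' r' z (\<phi> x) * ikl L' r' (\<phi> y) z) =
      (\<Sum>z \<in> {z \<in> L. x \<subset> z \<and> z \<subseteq> y}. kl L' r' (\<phi> z) (\<phi> x) * ikl L' r' (\<phi> y) (\<phi> z))"
      unfolding ivl_iso_upper(1)[OF iso]
      by (subst sum.reindex[OF inj_on_subset[OF ivl_iso_upper(2)[OF iso] sub]]) simp
    also have "\<dots> = (\<Sum>z \<in> {z \<in> L. x \<subset> z \<and> z \<subseteq> y}. kl L r z x * ikl L r y z)"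
      using IH klz by (intro sum.cong) auto
    finally show ?thesis
      using True ivl_iso_upper(3)[OF iso] assms
      by (simp add: ikl.simps[of L r y x] ikl.simps[of L' r' "\<phi> y" "\<phi> x"])
  next
    case False
    thus ?thesis using ivl_iso_upper(3)[OF iso]
      by (simp add: ikl.simps[of L r y x] ikl.simps[of L' r' "\<phi> y" "\<phi> x"])
  qed
qed

lemma ikl_inverse:
  assumes "finite L" "x \<in> L" "x \<subseteq> y"
  shows "(\<Sum>z\<in>ivl L x y. kl L r z x * ikl L r y z) = (if x = y then 1 else 0)"
proof (cases "x = y")
  case False
  hence "x \<subset> y" using assms by auto
  thus ?thesis using assms False by (simp add: ivl_split_bot ikl.simps[of L r y x])
qed (use assms in \<open>simp add: ivl_refl\<close>)

abbreviation rat_poly :: "int poly \<Rightarrow> rat poly" where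
  "rat_poly \<equiv> map_poly of_int"

lemma rat_poly_mult: "rat_poly (p * q) = rat_poly p * rat_poly q"
  by (rule poly_eqI) (simp add: coeff_map_poly coeff_mult)

lemma rat_poly_sum: "rat_poly (sum f A) = (\<Sum>x\<in>A. rat_poly (f x))"
  by (rule poly_eqI) (simp add: coeff_map_poly coeff_sum)

lemma rat_poly_monom: "rat_poly (monom 1 k) = monom 1 k"
  by (rule poly_eqI) (simp add: coeff_map_poly)

lemma rat_poly_rev_at: "rat_poly (rev_at n p) = rev_at n (rat_poly p)"
  by (rule poly_eqI) (simp add: coeff_map_poly coeff_rev_at)

lemma degree_rat_poly: "degree (rat_poly p) = degree p"
  by (rule degree_map_poly) simp

section \<open>Palindromicity, the defining recursion, and recognition of the inverse\<close>

locale ranked_family =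
  fixes L :: "'a set set" and r :: "'a set \<Rightarrow> nat"
  assumes finite_family: "finite L"
    and finite_member: "x \<in> L \<Longrightarrow> finite x"
    and rank_strict: "x \<in> L \<Longrightarrow> y \<in> L \<Longrightarrow> x \<subset> y \<Longrightarrow> r x < r y"
begin

lemma rank_mono: "x \<in> L \<Longrightarrow> y \<in> L \<Longrightarrow> x \<subseteq> y \<Longrightarrow> r x \<le> r y"
  using rank_strict by (metis less_imp_le order_refl psubsetI)

lemma degree_kl:
  assumes "x \<in> L" "y \<in> L" "x \<subset> y"
  shows "2 * degree (kl L r y x) < r y - r x"
  using assms rank_strict[OF assms] finite_family degree_half_part
  by (simp add: kl.simps[of L r y x])

lemma degree_kl_le:
  assumes "x \<in> L" "y \<in> L" "x \<subseteq> y"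
  shows "degree (kl L r y x) \<le> r y - r x"
  using degree_kl[OF assms(1,2)] assms(3) by (cases "x = y") (auto simp: psubset_eq)

text \<open>The Z-polynomial of the interval from \<open>x\<close> to \<open>y\<close>.\<close>

definition zpoly :: "'a set \<Rightarrow> 'a set \<Rightarrow> int poly" where
  "zpoly y x = (\<Sum>z\<in>ivl L x y. monom 1 (r z - r x) * kl L r y z)"

lemma degree_zpoly_summand:
  assumes "x \<in> L" "y \<in> L" "z \<in> ivl L x y"
  shows "degree (monom 1 (r z - r x) * kl L r y z) \<le> r y - r x"
proof -
  have z: "z \<in> L" "x \<subseteq> z" "z \<subseteq> y" using assms by (auto simp: ivl_def)
  have "degree (monom 1 (r z - r x) * kl L r y z) \<le> (r z - r x) + (r y - r z)"
    using degree_mult_le[of "monom 1 (r z - r x)" "kl L r y z"] degree_kl_le[OF z(1) assms(2) z(3)]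
    by (simp add: degree_monom_eq)
  also have "\<dots> = r y - r x" using rank_mono[OF z(1) assms(2) z(3)] rank_mono[OF assms(1) z(1,2)] by simp
  finally show ?thesis .
qed

lemma rev_at_zpoly:
  assumes "x \<in> L" "y \<in> L" "x \<subseteq> y"
  shows "rev_at (r y - r x) (zpoly y x) = zpoly y x"
proof (cases "x = y")
  case True
  thus ?thesis using assms by (simp add: zpoly_def ivl_refl rev_at_def)
next
  case False
  hence xy: "x \<subset> y" using assms by auto
  let ?S = "\<Sum>z \<in> {z \<in> L. x \<subset> z \<and> z \<subseteq> y}. monom 1 (r z - r x) * kl L r y z"
  have "zpoly y x = kl L r y x + ?S"
    using finite_family by (simp add: zpoly_def ivl_split_bot[OF assms(1) xy])
  moreover have "kl L r y x = half_part (r y - r x) ?S"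
    using xy finite_family by (simp add: kl.simps[of L r y x])
  moreover have "degree ?S \<le> r y - r x"
    by (rule degree_sum_le) (use finite_family assms degree_zpoly_summand in \<open>auto simp: ivl_def\<close>)
  ultimately show ?thesis using rev_at_half_part_add[of ?S "r y - r x"] by simp
qed

text \<open>Both sides equal the sum of \<open>\<mu>(x,z) Z(z,y)\<close> over \<open>z\<close>, where \<open>Z\<close> is the palindromic \<open>zpoly\<close>.\<close>

lemma kl_char:
  assumes "x \<in> L" "y \<in> L" "x \<subseteq> y"
  shows "rev_at (r y - r x) (kl L r y x) =
    (\<Sum>z\<in>ivl L x y. (\<Sum>g\<in>ivl L x z. monom (moebius L x g) (r z - r g)) * kl L r y z)"
proof -
  have mono: "monom c k = [:c:] * monom 1 k" for c :: int and k by (simp add: smult_monom)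
  have "(\<Sum>z\<in>ivl L x y. (\<Sum>g\<in>ivl L x z. monom (moebius L x g) (r z - r g)) * kl L r y z) =
    (\<Sum>z\<in>ivl L x y. \<Sum>g\<in>ivl L x z. [:moebius L x g:] * (monom 1 (r z - r g) * kl L r y z))"
    by (subst mono) (simp only: sum_distrib_right mult.assoc)
  also have "\<dots> = (\<Sum>g\<in>ivl L x y. [:moebius L x g:] * zpoly y g)"
    unfolding sum_ivl_swap[OF finite_family] zpoly_def by (simp only: sum_distrib_left)
  \<comment> \<open>After reversal the shift by r z - r g is absorbed: the summand depends on
    \<open>z\<close> and \<open>y\<close> only, and the remaining sum over \<open>g\<close> is a sum
    of Moebius values, which vanishes unless z = x.\<close>
  also have "\<dots> = (\<Sum>g\<in>ivl L x y. [:moebius L x g:] * rev_at (r y - r g) (zpoly y g))"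
    using assms by (intro sum.cong) (auto simp: ivl_def rev_at_zpoly)
  also have "\<dots> = (\<Sum>g\<in>ivl L x y. \<Sum>z\<in>ivl L g y. [:moebius L x g:] * rev_at (r y - r z) (kl L r y z))"
  proof (intro sum.cong refl)
    fix g assume g: "g \<in> ivl L x y"
    have "rev_at (r y - r g) (monom 1 (r z - r g) * kl L r y z) = rev_at (r y - r z) (kl L r y z)"
      if z: "z \<in> ivl L g y" for z
    proof -
      have "r g \<le> r z" "r z \<le> r y" using g z assms rank_mono by (auto simp: ivl_def)
      thus ?thesis by (simp add: rev_at_monom_mult)
    qed
    thus "[:moebius L x g:] * rev_at (r y - r g) (zpoly y g) =
      (\<Sum>z\<in>ivl L g y. [:moebius L x g:] * rev_at (r y - r z) (kl L r y z))"
      by (simp add: zpoly_def rev_at_sum sum_distrib_left)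
  qed
  also have "\<dots> = (\<Sum>z\<in>ivl L x y. \<Sum>g\<in>ivl L x z. [:moebius L x g:] * rev_at (r y - r z) (kl L r y z))"
    by (rule sum_ivl_swap[OF finite_family, symmetric])
  also have "\<dots> = (\<Sum>z\<in>ivl L x y. [:\<Sum>g\<in>ivl L x z. moebius L x g:] * rev_at (r y - r z) (kl L r y z))"
    by (intro sum.cong refl) (simp add: sum_distrib_right[symmetric] smult_sum)
  also have "\<dots> = (\<Sum>z\<in>ivl L x y. if z = x then rev_at (r y - r x) (kl L r y x) else 0)"
    using assms sum_moebius[OF finite_family assms(1)] finite_member
    by (intro sum.cong) (auto simp: ivl_def)
  also have "\<dots> = rev_at (r y - r x) (kl L r y x)"
    using assms finite_family by (simp add: finite_ivl) (auto simp: ivl_def)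
  finally show ?thesis by simp
qed

text \<open>The hypotheses say that \<open>c = \<Lambda> * \<zeta>\<^sup>r\<^sup>e\<^sup>v\<close> with \<open>\<Lambda>\<close> palindromic.  As \<open>\<zeta>\<^sup>r\<^sup>e\<^sup>v * P\<close> is palindromic, so is
  \<open>c * P\<close>; its degree is too small for that unless it vanishes, hence \<open>c\<close> is the inverse of \<open>P\<close>.\<close>

lemma ikl_eqI:
  fixes \<Lambda> c :: "'a set \<Rightarrow> rat poly"
  assumes bot: "b \<in> L" "\<And>x. x \<in> L \<Longrightarrow> b \<subseteq> x" "r b = 0" "\<Lambda> b = 1"
    and pal: "\<And>z. z \<in> L \<Longrightarrow> rev_at (r z) (\<Lambda> z) = \<Lambda> z"
    and c: "\<And>y. y \<in> L \<Longrightarrow> c y = (\<Sum>z\<in>ivl L b y. \<Lambda> z * monom 1 (r y - r z))"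
    and deg: "\<And>y. y \<in> L \<Longrightarrow> y \<noteq> b \<Longrightarrow> 2 * degree (c y) < r y"
    and y: "y \<in> L"
  shows "rat_poly (ikl L r y b) = c y"
proof -
  define D where "D y = (\<Sum>w\<in>ivl L b y. c w * rat_poly (kl L r y w))" for y
  have cb: "c b = 1" using bot by (simp add: c ivl_refl)
  have D: "D y = (if y = b then 1 else 0)" if y: "y \<in> L" for y
  proof (cases "y = b")
    case True
    thus ?thesis using bot cb by (simp add: D_def ivl_refl)
  next
    case False
    have "D y = (\<Sum>w\<in>ivl L b y. \<Sum>z\<in>ivl L b w. \<Lambda> z * (monom 1 (r w - r z) * rat_poly (kl L r y w)))"
      unfolding D_def by (intro sum.cong refl) (auto simp: ivl_def c sum_distrib_right mult.assoc)
    also have "\<dots> = (\<Sum>z\<in>ivl L b y. \<Lambda> z * rat_poly (zpoly y z))"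
      unfolding sum_ivl_swap[OF finite_family] zpoly_def
      by (simp add: rat_poly_sum rat_poly_mult rat_poly_monom sum_distrib_left)
    finally have D_eq: "D y = (\<Sum>z\<in>ivl L b y. \<Lambda> z * rat_poly (zpoly y z))" .
    have "rev_at (r y) (\<Lambda> z * rat_poly (zpoly y z)) = \<Lambda> z * rat_poly (zpoly y z)"
      if z: "z \<in> ivl L b y" for z
    proof -
      have z': "z \<in> L" "z \<subseteq> y" using z by (auto simp: ivl_def)
      have pz: "rev_at (r y - r z) (rat_poly (zpoly y z)) = rat_poly (zpoly y z)"
        using rev_at_zpoly[OF z'(1) y z'(2)] by (metis rat_poly_rev_at)
      have "rev_at (r z + (r y - r z)) (\<Lambda> z * rat_poly (zpoly y z)) =
          rev_at (r z) (\<Lambda> z) * rev_at (r y - r z) (rat_poly (zpoly y z))"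
        using degree_le_rev_at[of "r z" "\<Lambda> z"] pal[OF z'(1)]
          degree_le_rev_at[of "r y - r z" "rat_poly (zpoly y z)"] pz by (intro rev_at_mult) simp_all
      thus ?thesis using rank_mono[OF z'(1) y z'(2)] pz pal[OF z'(1)] by simp
    qed
    hence "rev_at (r y) (D y) = D y" unfolding D_eq rev_at_sum by simp
    moreover have "coeff (D y) i = 0" if i: "r y \<le> 2 * i" for i
      unfolding D_def coeff_sum
    proof (intro sum.neutral ballI)
      fix w assume "w \<in> ivl L b y"
      hence w: "w \<in> L" "w \<subseteq> y" "b \<subseteq> w" by (auto simp: ivl_def)
      have ry: "0 < r y" using rank_strict[OF bot(1) y] bot(2)[OF y] bot(3) False by simp
      have rw: "r w \<le> r y" by (rule rank_mono[OF w(1) y w(2)])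
      have a: "2 * degree (c w) \<le> r w" "w \<noteq> b \<Longrightarrow> 2 * degree (c w) < r w"
        using deg[OF w(1)] cb by (cases "w = b"; auto)+
      have b: "2 * degree (kl L r y w) \<le> r y - r w" "w \<noteq> y \<Longrightarrow> 2 * degree (kl L r y w) < r y - r w"
        using degree_kl[OF w(1) y] w(2) by (cases "w = y"; auto)+
      \<comment> \<open>Each factor has at most half of its rank as degree, strictly off the
        diagonal. Since \<open>y\<close> differs from \<open>b\<close>, at least one of the two
        factors is off the diagonal.\<close>
      have "2 * (degree (c w) + degree (kl L r y w)) < r y"
        using a b rw ry False by (cases "w = b"; cases "w = y") auto
      hence "degree (c w * rat_poly (kl L r y w)) < i"
        using degree_mult_le[of "c w" "rat_poly (kl L r y w)"] i by (simp add: degree_rat_poly)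
      thus "coeff (c w * rat_poly (kl L r y w)) i = 0" by (rule coeff_eq_0)
    qed
    ultimately have "D y = 0" by (rule palindromic_low_degree_eq_0)
    thus ?thesis using False by simp
  qed
  \<comment> \<open>By \<open>D\<close> the convolution c * P is the identity on intervals starting
    at \<open>b\<close>; multiplying it by \<open>ikl\<close> from the right and reassociating turns
    \<open>c\<close> into \<open>ikl\<close>.\<close>
  have "c y = (\<Sum>w\<in>ivl L b y. if w = y then c y else 0)"
    using y bot(2)[OF y] by (simp add: finite_ivl finite_family) (auto simp: ivl_def)
  also have "\<dots> = (\<Sum>w\<in>ivl L b y. c w * rat_poly (\<Sum>z\<in>ivl L w y. kl L r z w * ikl L r y z))"
    by (intro sum.cong refl) (auto simp: ivl_def[of L b] ikl_inverse[OF finite_family] map_poly_1')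
  also have "\<dots> = (\<Sum>w\<in>ivl L b y. \<Sum>z\<in>ivl L w y. c w * rat_poly (kl L r z w) * rat_poly (ikl L r y z))"
    by (simp add: rat_poly_sum rat_poly_mult sum_distrib_left mult.assoc)
  also have "\<dots> = (\<Sum>z\<in>ivl L b y. D z * rat_poly (ikl L r y z))"
    unfolding sum_ivl_swap[OF finite_family, symmetric] D_def by (simp add: sum_distrib_right)
  also have "\<dots> = (\<Sum>z\<in>ivl L b y. if z = b then rat_poly (ikl L r y b) else 0)"
    by (intro sum.cong refl) (auto simp: ivl_def D)
  also have "\<dots> = rat_poly (ikl L r y b)"
    using bot y by (simp add: finite_ivl finite_family) (auto simp: ivl_def)
  finally show ?thesis by simp
qed

end

section \<open>Kazhdan--Lusztig polynomials of matroids\<close>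

lemma rank_of_eq_0_iff:
  assumes "is_matroid M" "loopless M" "F \<in> flats M"
  shows "rank_of M F = 0 \<longleftrightarrow> F = {}"
  using rank_of_flats_strict[OF assms(1) empty_in_flats[OF assms(1,2)] assms(3)] rank_of_empty[OF assms(1)]
  by (cases "F = {}") (simp_all add: psubset_eq)

lemma rk_contraction_less:
  assumes "is_matroid M" "loopless M" "F \<in> flats M" "F \<noteq> {}"
  shows "rk (contraction M F) < rk M"
  using rk_contraction[OF assms(1) flatsD[OF assms(3)]] rank_of_eq_0_iff[OF assms(1-3)] assms(4) by simp

lemma contraction_empty:
  assumes "is_matroid M"
  shows "contraction M {} = M"
proof (rule matroid.expand)
  have "basis_of M {} B \<longleftrightarrow> B = {}" for B
    using assms by (auto simp: basis_of_def is_matroid_def)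
  thus "ground (contraction M {}) = ground M \<and> indep (contraction M {}) = indep M"
    using finite_indep(2)[OF assms] by (auto simp: indep_contraction)
qed

lemma ranked_family_flats:
  assumes "is_matroid M"
  shows "ranked_family (flats M) (rank_of M)"
  by unfold_locales (use assms finite_flats rank_of_flats_strict in blast)+

lemma ivl_iso_restriction:
  assumes M: "is_matroid M" "loopless M" and F: "F \<in> flats M"
  shows "ivl_iso id (flats M) (rank_of M) {} F (flats (restriction M F)) (rank_of (restriction M F))"
  using empty_in_flats[OF M] F
  by (auto simp: ivl_iso_def ivl_def flats_restriction[OF M(1) F] rank_of_restriction)

lemma ivl_iso_contraction:
  assumes M: "is_matroid M" and F: "F \<in> flats M"
  shows "ivl_iso (\<lambda>G. G - F) (flats M) (rank_of M) F (ground M)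
    (flats (contraction M F)) (rank_of (contraction M F))"
proof -
  have rank: "rank_of (contraction M F) (G - F) = rank_of M G - rank_of M F"
    if "G \<in> flats M" "F \<subseteq> G" for G
    using rank_of_contraction[OF M, of "G - F" F] flatsD[OF that(1)] that(2) by (simp add: Diff_mono Un_absorb2)
  have "(\<lambda>G. G - F) ` ivl (flats M) F (ground M) = ivl (flats (contraction M F)) (F - F) (ground M - F)"
  proof (intro equalityI subsetI)
    fix Y assume "Y \<in> (\<lambda>G. G - F) ` ivl (flats M) F (ground M)"
    then obtain G where "G \<in> flats M" "F \<subseteq> G" "Y = G - F" by (auto simp: ivl_def)
    thus "Y \<in> ivl (flats (contraction M F)) (F - F) (ground M - F)"
      using flatsD[of G M] by (auto simp: ivl_def flats_contraction[OF M F] Un_absorb2)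
  next
    fix Y assume "Y \<in> ivl (flats (contraction M F)) (F - F) (ground M - F)"
    hence "Y \<inter> F = {}" "Y \<union> F \<in> flats M" by (auto simp: ivl_def flats_contraction[OF M F])
    thus "Y \<in> (\<lambda>G. G - F) ` ivl (flats M) F (ground M)"
      using flatsD[of "Y \<union> F" M] by (intro image_eqI[of _ _ "Y \<union> F"]) (auto simp: ivl_def)
  qed
  moreover have "G - F \<subseteq> H - F \<longleftrightarrow> G \<subseteq> H" if "F \<subseteq> G" "F \<subseteq> H" for G H using that by auto
  moreover have "(rank_of M H - rank_of M F) - (rank_of M G - rank_of M F) = rank_of M H - rank_of M G"
    if "F \<subseteq> G" for G H using rank_of_mono[OF M that] by simp
  ultimately show ?thesis
    using F flatsD[OF F] ground_in_flats[of M] rank by (simp add: ivl_iso_def) (simp add: ivl_def)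
qed

lemma ivl_flats_ground: "ivl (flats M) {} (ground M) = flats M"
  using flatsD[of _ M] by (auto simp: ivl_def)

lemma ivl_iso_matroid_iso:
  assumes M: "is_matroid M" "loopless M" and N: "is_matroid N"
    and f: "bij_betw f (ground M) (ground N)"
      "\<And>I. I \<subseteq> ground M \<Longrightarrow> I \<in> indep M \<longleftrightarrow> f ` I \<in> indep N"
  shows "ivl_iso ((`) f) (flats M) (rank_of M) {} (ground M) (flats N) (rank_of N)"
proof -
  have inj: "inj_on f (ground M)" and im: "f ` ground M = ground N" using f(1) by (auto simp: bij_betw_def)
  have "f ` F \<subseteq> f ` G \<longleftrightarrow> F \<subseteq> G" if "F \<in> flats M" "G \<in> flats M" for F G
    using inj_on_image_mem_iff[OF inj _ flatsD[OF that(2)]] flatsD[OF that(1)] by blast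
  moreover have "(`) f ` flats M = ivl (flats N) {} (ground N)"
    by (simp only: ivl_flats_ground flip: matroid_iso_flats(2)[OF M(1) N f])
  ultimately show ?thesis
    using empty_in_flats[OF M] ground_in_flats[of M] matroid_iso_flats(1)[OF M(1) N f] flatsD[of _ M]
    by (simp add: ivl_iso_def ivl_flats_ground[of M] im)
qed

lemma matroid_char_poly_restriction:
  assumes M: "is_matroid M" and F: "F \<in> flats M"
  shows "matroid_char_poly (restriction M F) =
    (\<Sum>G\<in>ivl (flats M) {} F. monom (moebius (flats M) {} G) (rank_of M F - rank_of M G))"
proof -
  have "flats (restriction M F) = ivl (flats M) {} F"
    by (auto simp: ivl_def flats_restriction[OF M F])
  thus ?thesis
    unfolding matroid_char_poly_def rk_def ground_restriction
    using finite_flats(2)[OF M]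
    by (intro sum.cong)
      (auto simp: ivl_def flats_restriction[OF M F] moebius_restrict rank_of_restriction)
qed

section \<open>Existence and uniqueness of both families on matroids\<close>

definition lattice_KL :: "'a matroid \<Rightarrow> int poly" where
  "lattice_KL M = (if is_matroid M \<and> loopless M then kl (flats M) (rank_of M) (ground M) {} else 0)"

definition lattice_inverse_KL :: "'a matroid \<Rightarrow> int poly" where
  "lattice_inverse_KL M = (if is_matroid M \<and> loopless M
     then (- 1) ^ rk M * ikl (flats M) (rank_of M) (ground M) {} else 0)"

lemma
  assumes M: "is_matroid M" "loopless M" and F: "F \<in> flats M"
  shows lattice_KL_restriction:
      "lattice_KL (restriction M F) = kl (flats M) (rank_of M) F {}"
    and lattice_KL_contraction:
      "lattice_KL (contraction M F) = kl (flats M) (rank_of M) (ground M) F"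
    and lattice_inverse_KL_contraction:
      "lattice_inverse_KL (contraction M F) =
        (- 1) ^ rk (contraction M F) * ikl (flats M) (rank_of M) (ground M) F"
proof -
  have R: "is_matroid (restriction M F)" "loopless (restriction M F)"
    using is_matroid_restriction[OF M(1) flatsD[OF F]] loopless_restriction[OF M(2) flatsD[OF F]] .
  have C: "is_matroid (contraction M F)" "loopless (contraction M F)"
    using is_matroid_contraction[OF M(1)] loopless_contraction[OF M(1) F] .
  show "lattice_KL (restriction M F) = kl (flats M) (rank_of M) F {}"
    using kl_iso[OF _ _ ivl_iso_restriction[OF M F]] finite_flats(1)[OF M(1)] finite_flats(1)[OF R(1)] R
    by (simp add: lattice_KL_def)
  show "lattice_KL (contraction M F) = kl (flats M) (rank_of M) (ground M) F"
    using kl_iso[OF _ _ ivl_iso_contraction[OF M(1) F]] finite_flats(1)[OF M(1)] finite_flats(1)[OF C(1)] C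
    by (simp add: lattice_KL_def)
  show "lattice_inverse_KL (contraction M F) =
        (- 1) ^ rk (contraction M F) * ikl (flats M) (rank_of M) (ground M) F"
    using ikl_iso[OF _ _ ivl_iso_contraction[OF M(1) F]] finite_flats(1)[OF M(1)] finite_flats(1)[OF C(1)] C
    by (simp add: lattice_inverse_KL_def)
qed

lemma rk_eq_0D:
  assumes "is_matroid M" "loopless M" "rk M = 0"
  shows "ground M = {}"
  using rank_of_eq_0_iff[OF assms(1,2) ground_in_flats] assms(3) by (simp add: rk_def)

text \<open>The witness for the definite description \<open>KL_poly\<close>. Its recursion is
  \<open>kl_char\<close> on the whole lattice of flats, with restrictions and contractions read as
  lower and upper intervals.\<close>

lemma KL_family_lattice_KL: "KL_family lattice_KL"
  unfolding KL_family_def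
proof (intro conjI allI impI)
  fix M :: "'a matroid" assume "\<not> (is_matroid M \<and> loopless M)"
  thus "lattice_KL M = 0" unfolding lattice_KL_def by (rule if_not_P)
next
  fix M N :: "'a matroid"
  assume M: "is_matroid M" "loopless M" and N: "is_matroid N" "loopless N" and "matroid_iso M N"
  then obtain f where f: "bij_betw f (ground M) (ground N)"
      "\<And>I. I \<subseteq> ground M \<Longrightarrow> I \<in> indep M \<longleftrightarrow> f ` I \<in> indep N"
    unfolding matroid_iso_def by blast
  have "kl (flats N) (rank_of N) (f ` ground M) (f ` {}) = kl (flats M) (rank_of M) (ground M) {}"
    by (rule kl_iso[OF finite_flats(1)[OF M(1)] finite_flats(1)[OF N(1)] ivl_iso_matroid_iso[OF M N(1) f]])
  moreover have "f ` ground M = ground N" using f(1) by (simp add: bij_betw_def)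
  ultimately show "lattice_KL M = lattice_KL N" using M N by (simp add: lattice_KL_def)
next
  fix M :: "'a matroid" assume M: "is_matroid M" "loopless M"
  note E = empty_in_flats[OF M] and G = ground_in_flats[of M]
  interpret ranked_family "flats M" "rank_of M" by (rule ranked_family_flats[OF M(1)])
  have r0: "rank_of M {} = 0" by (rule rank_of_empty[OF M(1)])
  {
    assume "rk M = 0"
    hence "ground M = {}" by (rule rk_eq_0D[OF M])
    thus "lattice_KL M = 1" using M by (simp add: lattice_KL_def)
  next
    assume "rk M > 0"
    hence "{} \<subset> ground M" using r0 by (auto simp: rk_def)
    thus "2 * degree (lattice_KL M) < rk M"
      using degree_kl[OF E G] M r0 by (simp add: lattice_KL_def rk_def)
  next
    show "reverse_at (rk M) (lattice_KL M) =
      (\<Sum>F\<in>flats M. matroid_char_poly (restriction M F) * lattice_KL (contraction M F))"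
      using kl_char[OF E G] M r0
      by (simp add: reverse_at_eq_rev_at lattice_KL_def[of M] rk_def ivl_flats_ground
          matroid_char_poly_restriction lattice_KL_contraction)
  }
qed

lemma matroid_char_poly_restriction_empty:
  assumes "is_matroid M" "loopless M"
  shows "matroid_char_poly (restriction M {}) = 1"
  using empty_in_flats[OF assms]
  by (simp add: matroid_char_poly_restriction[OF assms(1)] ivl_refl moebius.simps monom_0 one_pCons)

lemma sum_flats_split:
  assumes "is_matroid M" "loopless M"
  shows "sum f (flats M) = f {} + sum f (flats M - {{}})"
  by (rule sum.remove[OF finite_flats(1)[OF assms(1)] empty_in_flats[OF assms]])

text \<open>The empty flat contributes P(M) itself, so the recursion fixes the difference between
  the reversal of P(M) and P(M) by smaller ranks. Two solutions therefore differ by a palindrome of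
  degree below half the rank.\<close>

lemma KL_family_unique:
  assumes P: "KL_family P" and P': "KL_family P'"
  shows "P = P'"
proof
  fix M show "P M = P' M"
  proof (induction "rk M" arbitrary: M rule: less_induct)
    case less
    show ?case
    proof (cases "is_matroid M \<and> loopless M")
      case False
      hence "P M = 0" "P' M = 0" using P P' unfolding KL_family_def by (metis (full_types))+
      thus ?thesis by simp
    next
      case True
      hence M: "is_matroid M" "loopless M" by auto
      show ?thesis
      proof (cases "rk M = 0")
        case True
        thus ?thesis using P P' M unfolding KL_family_def by simp
      next
        case False
        let ?R = "\<lambda>P. \<Sum>F\<in>flats M - {{}}. matroid_char_poly (restriction M F) * P (contraction M F)"
        have rev: "rev_at (rk M) (P M) - P M = ?R P \<and> 2 * degree (P M) < rk M" if "KL_family P" for P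
        proof -
          have "reverse_at (rk M) (P M) =
              (\<Sum>F\<in>flats M. matroid_char_poly (restriction M F) * P (contraction M F))"
            and "2 * degree (P M) < rk M"
            using that M False unfolding KL_family_def by simp_all
          thus ?thesis
            by (simp add: sum_flats_split[OF M] matroid_char_poly_restriction_empty[OF M]
                contraction_empty[OF M(1)] reverse_at_eq_rev_at)
        qed
        have "P (contraction M F) = P' (contraction M F)" if "F \<in> flats M - {{}}" for F
          using that by (intro less.hyps rk_contraction_less[OF M]) auto
        hence eq: "rev_at (rk M) (P M) - P M = rev_at (rk M) (P' M) - P' M"
          using rev[OF P] rev[OF P'] by simp
        have "P M - P' M = 0"
        proof (rule palindromic_low_degree_eq_0)
          have "rev_at (rk M) (P M - P' M) = rev_at (rk M) (P M) - rev_at (rk M) (P' M)"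
            by (rule poly_eqI) (simp add: coeff_rev_at)
          also have "\<dots> = P M - P' M" using eq by (simp add: algebra_simps)
          finally show "rev_at (rk M) (P M - P' M) = P M - P' M" .
          show "coeff (P M - P' M) i = 0" if "rk M \<le> 2 * i" for i
            using that rev[OF P] rev[OF P'] by (simp add: coeff_eq_0)
        qed
        thus ?thesis by simp
      qed
    qed
  qed
qed

lemma KL_poly_eq: "KL_poly = lattice_KL"
  unfolding KL_poly_def
  by (rule the_equality[where P = KL_family, OF KL_family_lattice_KL KL_family_unique[OF _ KL_family_lattice_KL]])

lemma inverse_KL_family_lattice: "inverse_KL_family lattice_inverse_KL"
  unfolding inverse_KL_family_def
proof (intro conjI allI impI)
  fix M :: "'a matroid" assume "\<not> (is_matroid M \<and> loopless M)"
  thus "lattice_inverse_KL M = 0" unfolding lattice_inverse_KL_def by (rule if_not_P)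
next
  fix M :: "'a matroid" assume M: "is_matroid M" "loopless M" "rk M = 0"
  hence "ground M = {}" by (intro rk_eq_0D)
  thus "lattice_inverse_KL M = 1" using M by (simp add: lattice_inverse_KL_def)
next
  fix M :: "'a matroid" assume M: "is_matroid M" "loopless M" and "rk M > 0"
  hence "{} \<noteq> ground M" using rank_of_empty[OF M(1)] by (auto simp: rk_def)
  hence "(\<Sum>F\<in>flats M. kl (flats M) (rank_of M) F {} * ikl (flats M) (rank_of M) (ground M) F) = 0"
    using ikl_inverse[OF finite_flats(1)[OF M(1)] empty_in_flats[OF M], of "ground M"]
    by (simp add: ivl_flats_ground)
  \<comment> \<open>The sign of the recursion and the sign inside \<open>lattice_inverse_KL\<close>
    are the same and cancel.\<close>
  moreover have "(- 1) ^ rk (contraction M F) * KL_poly (restriction M F) * lattice_inverse_KL (contraction M F) =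
      kl (flats M) (rank_of M) F {} * ikl (flats M) (rank_of M) (ground M) F" if "F \<in> flats M" for F
    using that M
    by (simp add: KL_poly_eq lattice_KL_restriction lattice_inverse_KL_contraction
        mult.left_commute flip: power_mult_distrib mult.assoc)
  ultimately show "(\<Sum>F\<in>flats M. (- 1) ^ rk (contraction M F) * KL_poly (restriction M F) *
      lattice_inverse_KL (contraction M F)) = 0" by simp
qed

lemma inverse_KL_family_unique:
  assumes Q: "inverse_KL_family Q" and Q': "inverse_KL_family Q'"
  shows "Q = Q'"
proof
  fix M show "Q M = Q' M"
  proof (induction "rk M" arbitrary: M rule: less_induct)
    case less
    show ?case
    proof (cases "is_matroid M \<and> loopless M")
      case False
      hence "Q M = 0" "Q' M = 0" using Q Q' unfolding inverse_KL_family_def by (metis (full_types))+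
      thus ?thesis by simp
    next
      case True
      hence M: "is_matroid M" "loopless M" by auto
      show ?thesis
      proof (cases "rk M = 0")
        case True
        thus ?thesis using Q Q' M unfolding inverse_KL_family_def by simp
      next
        case False
        let ?R = "\<lambda>Q. \<Sum>F\<in>flats M - {{}}. (- 1) ^ rk (contraction M F) *
          KL_poly (restriction M F) * Q (contraction M F)"
        have *: "(- 1) ^ rk M * Q M = - ?R Q" if "inverse_KL_family Q" for Q
        proof -
          have "(\<Sum>F\<in>flats M. (- 1) ^ rk (contraction M F) * KL_poly (restriction M F) * Q (contraction M F)) = 0"
            using that M False unfolding inverse_KL_family_def by simp
          thus ?thesis
            by (simp add: sum_flats_split[OF M] KL_poly_eq lattice_KL_restriction[OF M empty_in_flats[OF M]]
                contraction_empty[OF M(1)] add_eq_0_iff2)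
        qed
        have "Q (contraction M F) = Q' (contraction M F)" if "F \<in> flats M - {{}}" for F
          using that by (intro less.hyps rk_contraction_less[OF M]) auto
        hence "(- 1) ^ rk M * Q M = (- 1) ^ rk M * Q' M" unfolding *[OF Q] *[OF Q'] by simp
        thus ?thesis by simp
      qed
    qed
  qed
qed

lemma inverse_KL_poly_eq: "inverse_KL_poly = lattice_inverse_KL"
  unfolding inverse_KL_poly_def
  by (rule the_equality[where P = inverse_KL_family, OF inverse_KL_family_lattice inverse_KL_family_unique[OF _ inverse_KL_family_lattice]])

section \<open>The flats of the braid matroid\<close>

definition joined :: "'v set set \<Rightarrow> 'v \<Rightarrow> 'v \<Rightarrow> bool" where
  "joined A = (\<lambda>u v. {u, v} \<in> A)\<^sup>*\<^sup>*"

lemma joined_refl [simp]: "joined A u u"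
  by (simp add: joined_def)

lemma joined_trans: "joined A u v \<Longrightarrow> joined A v w \<Longrightarrow> joined A u w"
  unfolding joined_def by (rule rtranclp_trans)

lemma joined_edge: "{u, v} \<in> A \<Longrightarrow> joined A u v"
  unfolding joined_def by (rule r_into_rtranclp)

lemma joined_least:
  assumes "joined A u v" "\<And>a b. {a, b} \<in> A \<Longrightarrow> joined B a b"
  shows "joined B u v"
  using assms(1) unfolding joined_def[of A]
  by (induction rule: rtranclp_induct) (auto intro: joined_trans assms(2))

lemma joined_mono: "joined A u v \<Longrightarrow> A \<subseteq> B \<Longrightarrow> joined B u v"
  by (rule joined_least) (auto intro: joined_edge)

lemma joined_sym: "joined A u v \<Longrightarrow> joined A v u"
  unfolding joined_def by (rule sympD[OF symp_rtranclp]) (auto simp: symp_def insert_commute)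

lemma joined_insertD:
  assumes "joined (insert {u, v} A) a b"
  shows "joined A a b \<or> (joined A a u \<and> joined A v b) \<or> (joined A a v \<and> joined A u b)"
  using assms unfolding joined_def[of "insert {u, v} A"]
proof (induction rule: rtranclp_induct)
  case base
  show ?case by simp
next
  case (step b c)
  from step(2) consider "{b, c} \<in> A" | "b = u" "c = v" | "b = v" "c = u"
    by (auto simp: doubleton_eq_iff)
  then show ?case
  proof cases
    case 1
    thus ?thesis using step.IH joined_trans[OF _ joined_edge[OF 1]] by blast
  qed (use step.IH in auto)
qed

lemma joined_distinct_path:
  assumes "joined A u v"
  shows "\<exists>vs. vs \<noteq> [] \<and> hd vs = u \<and> last vs = v \<and> distinct vs \<and>
    (\<forall>i. Suc i < length vs \<longrightarrow> {vs ! i, vs ! Suc i} \<in> A)"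
  using assms unfolding joined_def
proof (induction rule: rtranclp_induct)
  case base
  show ?case by (intro exI[of _ "[u]"]) simp
next
  case (step v w)
  then obtain vs where vs: "vs \<noteq> []" "hd vs = u" "last vs = v" "distinct vs"
    "\<forall>i. Suc i < length vs \<longrightarrow> {vs ! i, vs ! Suc i} \<in> A" by blast
  show ?case
  proof (cases "w \<in> set vs")
    case True
    then obtain j where j: "j < length vs" "vs ! j = w" by (auto simp: in_set_conv_nth)
    \<comment> \<open>If the walk returns to \<open>w\<close>, it is cut at the earlier visit, which
      keeps the vertices distinct.\<close>
    let ?ws = "take (Suc j) vs"
    have "last ?ws = w" using j by (simp add: take_Suc_conv_app_nth)
    moreover have "hd ?ws = u" "?ws \<noteq> []" using vs by simp_all
    ultimately show ?thesis using vs by (intro exI[of _ ?ws]) auto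
  next
    case False
    have "{(vs @ [w]) ! i, (vs @ [w]) ! Suc i} \<in> A" if "Suc i < length (vs @ [w])" for i
    proof (cases "Suc i < length vs")
      case True
      thus ?thesis using vs(5) by (simp add: nth_append)
    next
      case last: False
      hence i: "i = length vs - 1" "Suc i = length vs" using that by auto
      hence "vs ! i = v" using vs(1,3) by (simp add: last_conv_nth)
      thus ?thesis using step(2) i by (simp add: nth_append)
    qed
    thus ?thesis using vs False by (intro exI[of _ "vs @ [w]"]) auto
  qed
qed

definition forest :: "'v set set \<Rightarrow> bool" where
  "forest A \<longleftrightarrow> \<not> (\<exists>C \<subseteq> A. is_cycle C)"

text \<open>No cycles means that every edge is a bridge: a detour around an edge may be taken with
  distinct vertices and closed by that edge, and a cycle without one of its edges still joins the
  ends of that edge.\<close>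

lemma forest_iff:
  "forest A \<longleftrightarrow> (\<forall>u v. u \<noteq> v \<longrightarrow> {u, v} \<in> A \<longrightarrow> \<not> joined (A - {{u, v}}) u v)"
proof (intro iffI allI impI notI)
  fix u v assume f: "forest A" and uv: "u \<noteq> v" "{u, v} \<in> A" and j: "joined (A - {{u, v}}) u v"
  obtain vs where vs: "vs \<noteq> []" "hd vs = u" "last vs = v" "distinct vs"
    "\<forall>i. Suc i < length vs \<longrightarrow> {vs ! i, vs ! Suc i} \<in> A - {{u, v}}"
    using joined_distinct_path[OF j] by blast
  have ends: "vs ! 0 = u" "vs ! (length vs - 1) = v" using vs by (simp_all add: hd_conv_nth last_conv_nth)
  \<comment> \<open>Length 1 would make the ends equal, and at length 2 the only step would be the
    removed edge.\<close>
  have "length vs \<noteq> 0" "length vs \<noteq> 1" "length vs \<noteq> 2"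
    using vs(1) ends uv(1) vs(5)[rule_format, of 0] by (auto simp: numeral_2_eq_2)
  hence len: "length vs \<ge> 3" by linarith
  let ?C = "{{vs ! i, vs ! (Suc i mod length vs)} | i. i < length vs}"
  have "{vs ! i, vs ! (Suc i mod length vs)} \<in> A" if "i < length vs" for i
  proof (cases "Suc i = length vs")
    case True
    hence "i = length vs - 1" by simp
    thus ?thesis using True ends uv(2) by (simp add: insert_commute)
  next
    case False
    thus ?thesis using vs(5) that by simp
  qed
  hence "?C \<subseteq> A" by auto
  moreover have "is_cycle ?C" unfolding is_cycle_def using len vs(4) by blast
  ultimately show False using f unfolding forest_def by blast
next
  assume r: "\<forall>u v. u \<noteq> v \<longrightarrow> {u, v} \<in> A \<longrightarrow> \<not> joined (A - {{u, v}}) u v"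
  have False if "C \<subseteq> A" "is_cycle C" for C
  proof -
    from that(2) obtain vs where vs: "length vs \<ge> 3" "distinct vs"
      "C = {{vs ! i, vs ! (Suc i mod length vs)} | i. i < length vs}"
      unfolding is_cycle_def by blast
    let ?n = "length vs - 1"
    \<comment> \<open>The closing edge of the cycle serves as the edge that fails to be a
      bridge.\<close>
    let ?e = "{vs ! 0, vs ! ?n}"
    have n: "Suc ?n = length vs" using vs(1) by auto
    have C: "{vs ! i, vs ! (Suc i mod length vs)} \<in> C" if "i < length vs" for i
      unfolding vs(3) using that by (intro CollectI exI[of _ i] conjI refl)
    have "?e \<in> A" using subsetD[OF \<open>C \<subseteq> A\<close> C[of ?n]] n by (simp add: insert_commute)
    moreover have "vs ! 0 \<noteq> vs ! ?n" using vs by (subst nth_eq_iff_index_eq) auto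
    moreover have "joined (A - {?e}) (vs ! 0) (vs ! i)" if "i \<le> ?n" for i
      using that
    proof (induction i)
      case (Suc i)
      have "{vs ! i, vs ! Suc i} \<in> A" using subsetD[OF \<open>C \<subseteq> A\<close> C[of i]] Suc.prems n by simp
      moreover have "{vs ! i, vs ! Suc i} \<noteq> ?e"
      proof
        assume "{vs ! i, vs ! Suc i} = ?e"
        hence "vs ! i = vs ! 0 \<and> vs ! Suc i = vs ! ?n \<or> vs ! Suc i = vs ! 0"
          by (auto simp: doubleton_eq_iff)
        moreover have "i < length vs" "Suc i < length vs" "0 < length vs" "?n < length vs"
          using Suc.prems n vs(1) by linarith+
        ultimately have "i = 0 \<and> Suc i = ?n" using nth_eq_iff_index_eq[OF vs(2)] by auto
        thus False using vs(1) by linarith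
      qed
      ultimately have "joined (A - {?e}) (vs ! i) (vs ! Suc i)" by (intro joined_edge) blast
      thus ?case using Suc by (auto intro: joined_trans)
    qed simp
    ultimately show False using r by blast
  qed
  thus "forest A" unfolding forest_def by blast
qed

lemma forest_empty: "forest {}"
  by (simp add: forest_iff)

lemma forest_mono: "forest A \<Longrightarrow> B \<subseteq> A \<Longrightarrow> forest B"
  unfolding forest_def by blast

text \<open>If an old edge {a, b} acquired a detour through the new edge, the rest of that detour
  together with {a, b} would join \<open>u\<close> and \<open>v\<close> inside
  \<open>I\<close>.\<close>

lemma forest_insert:
  assumes "forest I" "\<not> joined I u v"
  shows "forest (insert {u, v} I)"
  unfolding forest_iff
proof (intro allI impI notI)
  fix a b assume ab: "a \<noteq> b" "{a, b} \<in> insert {u, v} I" and j: "joined (insert {u, v} I - {{a, b}}) a b"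
  show False
  proof (cases "{a, b} = {u, v}")
    case True
    hence "joined I a b" using j by (elim joined_mono) auto
    thus False using True assms(2) joined_sym[of I v u] by (auto simp: doubleton_eq_iff)
  next
    case False
    hence abI: "{a, b} \<in> I" using ab by auto
    have "insert {u, v} I - {{a, b}} = insert {u, v} (I - {{a, b}})" using False by auto
    from joined_insertD[OF j[unfolded this]]
    consider "joined (I - {{a, b}}) a b" | "joined I a u" "joined I v b" | "joined I a v" "joined I u b"
      by (meson Diff_subset joined_mono)
    thus False
    proof cases
      case 1
      thus False using assms(1) abI ab(1) unfolding forest_iff by blast
    qed (use assms(2) joined_edge[OF abI] in \<open>meson joined_sym joined_trans\<close>)+
  qed
qed

definition component :: "'v set \<Rightarrow> 'v set set \<Rightarrow> 'v \<Rightarrow> 'v set" where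
  "component V A u = {v \<in> V. joined A u v}"

definition components :: "'v set \<Rightarrow> 'v set set \<Rightarrow> 'v set set" where
  "components V A = component V A ` V"

lemma component_eq_iff:
  assumes "u \<in> V" "v \<in> V"
  shows "component V A u = component V A v \<longleftrightarrow> joined A u v"
proof
  assume "component V A u = component V A v"
  hence "v \<in> component V A u" using assms by (simp add: component_def)
  thus "joined A u v" by (simp add: component_def)
next
  assume j: "joined A u v"
  have "joined A u w \<longleftrightarrow> joined A v w" for w
    using joined_trans[OF j] joined_trans[OF joined_sym[OF j]] by blast
  thus "component V A u = component V A v" by (simp add: component_def)
qed

lemma partition_on_components: "partition_on V (components V A)"
proof (rule partition_onI)
  show "\<Union> (components V A) = V" by (auto simp: components_def component_def)
  show "disjnt p q" if pq: "p \<in> components V A" "q \<in> components V A" "p \<noteq> q" for p q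
  proof (rule ccontr)
    obtain u v where uv: "u \<in> V" "v \<in> V" "p = component V A u" "q = component V A v"
      using pq(1,2) by (auto simp: components_def)
    assume "\<not> disjnt p q"
    then obtain w where "joined A u w" "joined A v w" using uv by (auto simp: disjnt_def component_def)
    hence "joined A u v" using joined_sym joined_trans by meson
    thus False using pq(3) uv component_eq_iff[OF uv(1,2)] by simp
  qed
  show "{} \<notin> components V A" by (auto simp: components_def component_def)
qed

lemma card_components_coarser:
  assumes "finite V" "\<And>a b. joined A a b \<Longrightarrow> joined B a b"
  shows "card (components V B) \<le> card (components V A)"
proof -
  let ?g = "\<lambda>X. component V B (SOME u. u \<in> X)"
  have "component V B u = ?g (component V A u)" if u: "u \<in> V" for u
  proof -
    let ?s = "SOME v. v \<in> component V A u"
    have "u \<in> component V A u" using u by (simp add: component_def)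
    hence "?s \<in> component V A u" by (rule someI)
    hence "?s \<in> V" "joined B u ?s" using assms(2) by (auto simp: component_def)
    thus ?thesis using component_eq_iff[OF u] by metis
  qed
  hence "components V B = ?g ` components V A" by (force simp: components_def image_image)
  thus ?thesis using assms(1) by (simp add: card_image_le components_def)
qed

lemma card_components_insert_joined:
  assumes "finite V" "joined A u v"
  shows "card (components V (insert {u, v} A)) = card (components V A)"
proof -
  have "joined (insert {u, v} A) a b \<longleftrightarrow> joined A a b" for a b
    using joined_insertD[of u v A a b] joined_mono[of A a b "insert {u, v} A"] assms(2)
      joined_trans joined_sym by (metis subset_insertI)
  thus ?thesis by (simp add: components_def component_def)
qed

lemma card_components_insert_not_joined:
  assumes "finite V" "u \<in> V" "v \<in> V" "\<not> joined A u v"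
  shows "Suc (card (components V (insert {u, v} A))) = card (components V A)"
proof -
  let ?A = "insert {u, v} A" and ?U = "component V A u" and ?W = "component V A v"
  have mono: "joined ?A a b" if "joined A a b" for a b using that by (rule joined_mono) auto
  have uv: "joined ?A u v" by (rule joined_edge) simp
  have new: "component V ?A a = (if joined A u a \<or> joined A v a then ?U \<union> ?W else component V A a)"
    if "a \<in> V" for a
  proof (cases "joined A u a \<or> joined A v a")
    case True
    have "joined ?A a b \<longleftrightarrow> joined A u b \<or> joined A v b" for b
    proof
      assume "joined ?A a b"
      from joined_insertD[OF this] show "joined A u b \<or> joined A v b"
        using True by (meson joined_trans)
    next
      assume b: "joined A u b \<or> joined A v b"
      have "joined ?A u a" "joined ?A u b" using True b mono uv by (meson joined_trans)+
      thus "joined ?A a b" by (meson joined_trans joined_sym)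
    qed
    thus ?thesis using True by (auto simp: component_def)
  next
    case False
    have "joined ?A a b \<longleftrightarrow> joined A a b" for b
      using joined_insertD[of u v A a b] mono[of a b] False joined_sym by metis
    thus ?thesis using False by (simp add: component_def)
  qed
  let ?R = "component V A ` {a \<in> V. \<not> joined A u a \<and> \<not> joined A v a}"
  have "components V ?A = insert (?U \<union> ?W) ?R"
  proof (intro equalityI subsetI)
    fix X assume "X \<in> components V ?A"
    then obtain a where "a \<in> V" "X = component V ?A a" by (auto simp: components_def)
    thus "X \<in> insert (?U \<union> ?W) ?R" using new[of a] by auto
  next
    fix X assume "X \<in> insert (?U \<union> ?W) ?R"
    moreover have "component V ?A u = ?U \<union> ?W" using new[OF assms(2)] by simp
    ultimately show "X \<in> components V ?A" using new assms(2) by (force simp: components_def)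
  qed
  moreover have "components V A = insert ?U (insert ?W ?R)"
  proof (intro equalityI subsetI)
    fix X assume "X \<in> components V A"
    then obtain a where "a \<in> V" "X = component V A a" by (auto simp: components_def)
    thus "X \<in> insert ?U (insert ?W ?R)"
      using component_eq_iff[OF assms(2), of a A] component_eq_iff[OF assms(3), of a A] by auto
  qed (use assms in \<open>auto simp: components_def\<close>)
  moreover have "X \<notin> ?R" if "u \<in> X \<or> v \<in> X" for X
    using that joined_sym[of A] by (auto simp: component_def)
  hence "?U \<union> ?W \<notin> ?R" "?U \<notin> ?R" "?W \<notin> ?R" using assms by (simp_all add: component_def)
  moreover have "?U \<noteq> ?W" using component_eq_iff[OF assms(2,3)] assms(4) by simp
  moreover have "finite ?R" using assms(1) by simp
  ultimately show ?thesis by simp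
qed

text \<open>Starting from isolated vertices, each edge of a forest merges two components.\<close>

lemma forest_card:
  assumes V: "finite V" and "finite A" "forest A" "\<And>e. e \<in> A \<Longrightarrow> e \<subseteq> V \<and> card e = 2"
  shows "card A + card (components V A) = card V"
  using assms(2-)
proof (induction A rule: finite_induct)
  case empty
  have "joined {} a b \<longleftrightarrow> a = b" for a b :: 'a
    by (auto simp: joined_def elim: rtranclp.cases)
  hence "components V {} = (\<lambda>v. {v}) ` V" by (auto simp: components_def component_def)
  thus ?case by (simp add: card_image)
next
  case (insert e A)
  obtain u v where e: "e = {u, v}" "u \<noteq> v" using insert.prems(2)[of e] by (auto simp: card_2_iff)
  have uv: "u \<in> V" "v \<in> V" using insert.prems(2)[of e] e by auto
  have "insert e A - {{u, v}} = A" using insert.hyps e by auto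
  hence "\<not> joined A u v" using insert.prems(1) e unfolding forest_iff by (metis insertI1)
  hence "Suc (card (components V (insert e A))) = card (components V A)"
    unfolding e(1) by (rule card_components_insert_not_joined[OF V uv])
  moreover have "card A + card (components V A) = card V"
    using insert.prems forest_mono[OF insert.prems(1)] by (intro insert.IH) auto
  ultimately show ?case using insert.hyps by simp
qed

section \<open>The cycle matroid of a complete graph\<close>

definition complete_edges :: "'v set \<Rightarrow> 'v set set" where
  "complete_edges V = {e. e \<subseteq> V \<and> card e = 2}"

lemma finite_complete_edges: "finite V \<Longrightarrow> finite (complete_edges V)"
  by (simp add: complete_edges_def)

lemma complete_edgesE:
  assumes "e \<in> complete_edges V"
  obtains u v where "e = {u, v}" "u \<noteq> v" "u \<in> V" "v \<in> V"
  using assms by (auto simp: complete_edges_def card_2_iff)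

lemma doubleton_in_complete_edges: "{u, v} \<in> complete_edges V \<longleftrightarrow> u \<noteq> v \<and> u \<in> V \<and> v \<in> V"
  by (auto simp: complete_edges_def card_2_iff)

abbreviation complete_matroid :: "'v set \<Rightarrow> 'v set matroid" where
  "complete_matroid V \<equiv> cycle_matroid (complete_edges V)"

lemma ground_cycle_matroid [simp]: "ground (cycle_matroid E) = E"
  and indep_cycle_matroid: "indep (cycle_matroid E) = {A. A \<subseteq> E \<and> forest A}"
  by (simp_all add: cycle_matroid_def forest_def)

lemma card_forest_complete:
  assumes "finite V" "A \<subseteq> complete_edges V" "forest A"
  shows "card A + card (components V A) = card V"
  using assms finite_subset[OF assms(2) finite_complete_edges[OF assms(1)]]
  by (intro forest_card) (auto simp: complete_edges_def)

text \<open>Augmentation by counting: the larger forest has fewer components, so one of its edges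
  joins two components of the smaller forest and can be added to it.\<close>

lemma is_matroid_complete:
  assumes V: "finite V"
  shows "is_matroid (complete_matroid V)"
  unfolding is_matroid_def ground_cycle_matroid indep_cycle_matroid
proof (intro conjI allI impI)
  show "finite (complete_edges V)" by (rule finite_complete_edges[OF V])
  show "{A. A \<subseteq> complete_edges V \<and> forest A} \<subseteq> Pow (complete_edges V)" by auto
  show "{} \<in> {A. A \<subseteq> complete_edges V \<and> forest A}" by (simp add: forest_empty)
  show "J \<in> {A. A \<subseteq> complete_edges V \<and> forest A}"
    if "I \<in> {A. A \<subseteq> complete_edges V \<and> forest A}" "J \<subseteq> I" for I J
    using that forest_mono[of I J] by auto
next
  fix I J assume I: "I \<in> {A. A \<subseteq> complete_edges V \<and> forest A}"
    and J: "J \<in> {A. A \<subseteq> complete_edges V \<and> forest A}" and less: "card I < card J"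
  have "card (components V J) < card (components V I)"
    using card_forest_complete[OF V, of I] card_forest_complete[OF V, of J] I J less by simp
  hence "\<not> (\<forall>a b. {a, b} \<in> J \<longrightarrow> joined I a b)"
    using card_components_coarser[OF V, of J I] joined_least[of J _ _ I] by (metis linorder_not_less)
  then obtain a b where ab: "{a, b} \<in> J" "\<not> joined I a b" by blast
  hence "{a, b} \<notin> I" using joined_edge by metis
  moreover have "forest (insert {a, b} I)" using I ab by (intro forest_insert) auto
  ultimately show "\<exists>e\<in>J - I. insert e I \<in> {A. A \<subseteq> complete_edges V \<and> forest A}"
    using ab I J by (intro bexI[of _ "{a, b}"]) auto
qed

lemma loopless_complete: "loopless (complete_matroid V)"
  unfolding loopless_def ground_cycle_matroid indep_cycle_matroid
proof
  fix e :: "'a set" assume e: "e \<in> complete_edges V"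
  then obtain u v where uv: "e = {u, v}" "u \<noteq> v" by (rule complete_edgesE)
  have "\<not> joined {} u v" using uv(2) by (auto simp: joined_def elim: rtranclp.cases)
  hence "forest {e}" unfolding uv(1) by (intro forest_insert forest_empty)
  thus "{e} \<in> {A. A \<subseteq> complete_edges V \<and> forest A}" using e by simp
qed

text \<open>A maximum forest inside \<open>X\<close> joins the ends of every edge of
  \<open>X\<close>, hence has the components of \<open>X\<close>, and \<open>forest_card\<close>
  counts its edges.\<close>

lemma rank_of_complete:
  assumes V: "finite V" and X: "X \<subseteq> complete_edges V"
  shows "rank_of (complete_matroid V) X + card (components V X) = card V"
proof -
  note M = is_matroid_complete[OF V]
  obtain I where I: "I \<in> indep (complete_matroid V)" "I \<subseteq> X" "card I = rank_of (complete_matroid V) X"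
    using rank_of_attained[OF M] .
  have IE: "I \<subseteq> complete_edges V" "forest I" using I(1) by (auto simp: indep_cycle_matroid)
  have "joined I a b" if ab: "{a, b} \<in> X" for a b
  proof (rule ccontr)
    assume n: "\<not> joined I a b"
    have "insert {a, b} I \<in> indep (complete_matroid V)"
      using forest_insert[OF IE(2) n] IE(1) X ab by (auto simp: indep_cycle_matroid)
    hence "card (insert {a, b} I) \<le> card I"
      unfolding I(3) using I(2) ab by (intro card_le_rank_of[OF M]) auto
    moreover have "{a, b} \<notin> I" using n joined_edge by metis
    ultimately show False using finite_indep(1)[OF M I(1)] by simp
  qed
  hence "joined X a b \<longleftrightarrow> joined I a b" for a b
    using joined_least[of X a b I] joined_mono[OF _ I(2)] by blast
  hence "components V X = components V I" by (simp add: components_def component_def)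
  thus ?thesis using card_forest_complete[OF V IE] I(3) by simp
qed

lemma flats_complete:
  assumes V: "finite V"
  shows "F \<in> flats (complete_matroid V) \<longleftrightarrow>
    F \<subseteq> complete_edges V \<and> (\<forall>u\<in>V. \<forall>v\<in>V. u \<noteq> v \<longrightarrow> joined F u v \<longrightarrow> {u, v} \<in> F)"
proof (cases "F \<subseteq> complete_edges V")
  case F: True
  have "rank_of (complete_matroid V) F < rank_of (complete_matroid V) (insert {u, v} F) \<longleftrightarrow> \<not> joined F u v"
    if "u \<in> V" "v \<in> V" "u \<noteq> v" for u v
  proof -
    have "insert {u, v} F \<subseteq> complete_edges V" using F that by (simp add: doubleton_in_complete_edges)
    note * = rank_of_complete[OF V this] rank_of_complete[OF V F]
    show ?thesis
      using * card_components_insert_joined[OF V, of F u v]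
        card_components_insert_not_joined[OF V that(1,2), of F] by (cases "joined F u v") simp_all
  qed
  note gt = this
  show ?thesis
  proof (intro iffI conjI ballI impI)
    fix u v assume fl: "F \<in> flats (complete_matroid V)"
      and uv: "u \<in> V" "v \<in> V" "u \<noteq> v" "joined F u v"
    show "{u, v} \<in> F"
    proof (rule ccontr)
      assume "{u, v} \<notin> F"
      hence "{u, v} \<in> complete_edges V - F" using uv by (simp add: doubleton_in_complete_edges)
      thus False using fl gt[OF uv(1-3)] uv(4) by (simp add: flats_def)
    qed
  next
    assume r: "F \<subseteq> complete_edges V \<and>
      (\<forall>u\<in>V. \<forall>v\<in>V. u \<noteq> v \<longrightarrow> joined F u v \<longrightarrow> {u, v} \<in> F)"
    have "rank_of (complete_matroid V) F < rank_of (complete_matroid V) (insert e F)"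
      if e: "e \<in> complete_edges V - F" for e
    proof -
      obtain u v where uv: "e = {u, v}" "u \<noteq> v" "u \<in> V" "v \<in> V" using e complete_edgesE by blast
      thus ?thesis using gt[OF uv(3,4,2)] r e by blast
    qed
    thus "F \<in> flats (complete_matroid V)" using F by (simp add: flats_def)
  qed (rule F)
qed (auto simp: flats_def)

section \<open>Flats as set partitions\<close>

text \<open>The disjoint union of the complete graphs on the blocks. It is inverse to
  \<open>components V\<close> on flats, and inclusion of flats corresponds to refinement of
  partitions.\<close>

definition block_edges :: "'v set \<Rightarrow> 'v set set \<Rightarrow> 'v set set" where
  "block_edges V P = {e \<in> complete_edges V. \<exists>B\<in>P. e \<subseteq> B}"

lemma joined_block_edges:
  assumes P: "partition_on V P" and B: "B \<in> P" "u \<in> B"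
  shows "joined (block_edges V P) u v \<longleftrightarrow> v \<in> B"
proof
  assume "joined (block_edges V P) u v"
  thus "v \<in> B" unfolding joined_def
  proof (induction rule: rtranclp_induct)
    case (step a b)
    then obtain C where "C \<in> P" "a \<in> C" "b \<in> C" by (auto simp: block_edges_def)
    moreover have "C = B" using partition_onD2[OF P] calculation step.IH B(1)
      unfolding disjoint_def by blast
    ultimately show ?case by simp
  qed (use B in simp)
next
  assume v: "v \<in> B"
  show "joined (block_edges V P) u v"
  proof (cases "u = v")
    case False
    have "{u, v} \<in> block_edges V P"
      using False v B partition_onD1[OF P] by (auto simp: block_edges_def doubleton_in_complete_edges)
    thus ?thesis by (rule joined_edge)
  qed simp
qed

lemma components_block_edges:
  assumes P: "partition_on V P"
  shows "components V (block_edges V P) = P"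
proof -
  have comp: "component V (block_edges V P) u = B" if "B \<in> P" "u \<in> B" for u B
    using joined_block_edges[OF P that] partition_onD1[OF P] that by (auto simp: component_def)
  show ?thesis
  proof (intro equalityI subsetI)
    fix X assume "X \<in> components V (block_edges V P)"
    then obtain u where "u \<in> V" "X = component V (block_edges V P) u" by (auto simp: components_def)
    moreover then obtain B where "B \<in> P" "u \<in> B" using partition_onD1[OF P] by auto
    ultimately show "X \<in> P" using comp by simp
  next
    fix B assume B: "B \<in> P"
    moreover then obtain u where u: "u \<in> B" using partition_onD3[OF P] by (metis ex_in_conv)
    ultimately have "u \<in> V" "B = component V (block_edges V P) u"
      using partition_onD1[OF P] comp by auto
    thus "B \<in> components V (block_edges V P)" by (auto simp: components_def)
  qed
qed

lemma block_edges_in_flats: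
  assumes V: "finite V" and P: "partition_on V P"
  shows "block_edges V P \<in> flats (complete_matroid V)"
  unfolding flats_complete[OF V]
proof (intro conjI ballI impI)
  show "block_edges V P \<subseteq> complete_edges V" by (auto simp: block_edges_def)
  fix u v assume uv: "u \<in> V" "v \<in> V" "u \<noteq> v" "joined (block_edges V P) u v"
  obtain B where B: "B \<in> P" "u \<in> B" using uv(1) partition_onD1[OF P] by auto
  hence "v \<in> B" using joined_block_edges[OF P B] uv(4) by simp
  thus "{u, v} \<in> block_edges V P" using B uv by (auto simp: block_edges_def doubleton_in_complete_edges)
qed

lemma block_edges_components:
  assumes V: "finite V" and F: "F \<in> flats (complete_matroid V)"
  shows "block_edges V (components V F) = F"
proof (intro equalityI subsetI)
  note F' = F[unfolded flats_complete[OF V]]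
  {
    fix e assume e: "e \<in> block_edges V (components V F)"
    then obtain u v where uv: "e = {u, v}" "u \<noteq> v" "u \<in> V" "v \<in> V"
      by (auto simp: block_edges_def elim: complete_edgesE)
    obtain w where "e \<subseteq> component V F w" using e by (auto simp: block_edges_def components_def)
    hence "joined F w u" "joined F w v" using uv(1) by (simp_all add: component_def)
    hence "joined F u v" by (meson joined_sym joined_trans)
    thus "e \<in> F" using F' uv by auto
  next
    fix e assume e: "e \<in> F"
    hence eE: "e \<in> complete_edges V" using F' by auto
    then obtain u v where uv: "e = {u, v}" "u \<noteq> v" "u \<in> V" "v \<in> V" by (rule complete_edgesE)
    hence "e \<subseteq> component V F u" using e by (auto simp: component_def intro: joined_edge)
    thus "e \<in> block_edges V (components V F)" using eE uv by (auto simp: block_edges_def components_def)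
  }
qed

lemma block_edges_subset_iff:
  assumes P: "partition_on V P" and Q: "partition_on V Q"
  shows "block_edges V P \<subseteq> block_edges V Q \<longleftrightarrow> (\<forall>B\<in>P. \<exists>C\<in>Q. B \<subseteq> C)"
proof
  assume sub: "block_edges V P \<subseteq> block_edges V Q"
  show "\<forall>B\<in>P. \<exists>C\<in>Q. B \<subseteq> C"
  proof
    fix B assume B: "B \<in> P"
    then obtain u where u: "u \<in> B" using partition_onD3[OF P] by (metis ex_in_conv)
    hence "u \<in> V" using B partition_onD1[OF P] by auto
    then obtain C where C: "C \<in> Q" "u \<in> C" using partition_onD1[OF Q] by auto
    have "v \<in> C" if "v \<in> B" for v
      using joined_block_edges[OF P B u, of v] joined_block_edges[OF Q C, of v] joined_mono[OF _ sub, of u v] that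
      by blast
    thus "\<exists>C\<in>Q. B \<subseteq> C" using C by blast
  qed
next
  assume r: "\<forall>B\<in>P. \<exists>C\<in>Q. B \<subseteq> C"
  show "block_edges V P \<subseteq> block_edges V Q"
  proof
    fix e assume "e \<in> block_edges V P"
    then obtain B where B: "e \<in> complete_edges V" "B \<in> P" "e \<subseteq> B" unfolding block_edges_def by blast
    obtain C where "C \<in> Q" "B \<subseteq> C" using r B(2) by blast
    hence "C \<in> Q" "e \<subseteq> C" using B(3) by (simp_all add: subset_trans[OF B(3)])
    thus "e \<in> block_edges V Q" using B(1) unfolding block_edges_def by blast
  qed
qed

lemma components_complete_edges:
  assumes "V \<noteq> {}"
  shows "components V (complete_edges V) = {V}"
proof -
  have "component V (complete_edges V) u = V" if "u \<in> V" for u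
  proof -
    have "joined (complete_edges V) u v" if "v \<in> V" for v
      using that \<open>u \<in> V\<close> by (cases "u = v") (auto intro: joined_edge simp: doubleton_in_complete_edges)
    thus ?thesis by (auto simp: component_def)
  qed
  thus ?thesis using assms by (auto simp: components_def)
qed

section \<open>Multiplicative functions on set partitions\<close>

definition partition_sum :: "(nat \<Rightarrow> 'b::comm_ring_1) \<Rightarrow> 'v set \<Rightarrow> 'b" where
  "partition_sum h S = (\<Sum>P | partition_on S P. \<Prod>B\<in>P. h (card B))"

text \<open>The complete Bell polynomial in h 1, h 2, and so on. The recursion chooses the
  \<open>j\<close> companions of a distinguished element in its block.\<close>

fun bell_sum :: "(nat \<Rightarrow> 'b::comm_ring_1) \<Rightarrow> nat \<Rightarrow> 'b" where
  "bell_sum h 0 = 1"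
| "bell_sum h (Suc n) = (\<Sum>j\<le>n. of_nat (n choose j) * h (Suc j) * bell_sum h (n - j))"

text \<open>Partitions are classified by the block of \<open>a\<close>; \<open>T\<close> is that
  block without \<open>a\<close>.\<close>

lemma partition_sum_insert:
  assumes S: "finite S" and a: "a \<notin> S"
  shows "partition_sum h (insert a S) = (\<Sum>T\<in>Pow S. h (Suc (card T)) * partition_sum h (S - T))"
proof -
  define blk where "blk P = \<Union>{B \<in> P. a \<in> B}" for P
  have blk: "blk P \<in> P \<and> a \<in> blk P \<and> (\<forall>B\<in>P. a \<in> B \<longrightarrow> B = blk P)"
    if P: "partition_on (insert a S) P" for P
  proof -
    obtain B where B: "B \<in> P" "a \<in> B" using partition_onD1[OF P] by blast
    have "C = B" if "C \<in> P" "a \<in> C" for C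
      using partition_onD2[OF P] that B unfolding disjoint_def by blast
    hence "{C \<in> P. a \<in> C} = {B}" using B by blast
    thus ?thesis using B unfolding blk_def by auto
  qed
  have "(\<Sum>T\<in>Pow S. h (Suc (card T)) * partition_sum h (S - T)) =
    (\<Sum>(T, P)\<in>Sigma (Pow S) (\<lambda>T. {P. partition_on (S - T) P}). h (Suc (card T)) * (\<Prod>B\<in>P. h (card B)))"
    unfolding partition_sum_def sum_distrib_left using S finitely_many_partition_on
    by (intro sum.Sigma) auto
  also have "\<dots> = (\<Sum>P | partition_on (insert a S) P. \<Prod>B\<in>P. h (card B))"
  proof (rule sum.reindex_bij_witness[where j = "\<lambda>(T, P). insert (insert a T) P"
        and i = "\<lambda>P. (blk P - {a}, P - {blk P})"], goal_cases)
    case (1 TP)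
    then obtain T P where TP: "TP = (T, P)" "T \<subseteq> S" "partition_on (S - T) P" by auto
    have nB: "B \<in> P \<Longrightarrow> a \<notin> B" for B using partition_onD1[OF TP(3)] a by auto
    have "{B \<in> insert (insert a T) P. a \<in> B} = {insert a T}" using nB by auto
    hence "blk (insert (insert a T) P) = insert a T" unfolding blk_def by simp
    moreover have "insert a T \<notin> P" using nB by blast
    moreover have "a \<notin> T" using TP a by auto
    ultimately show ?case by (simp add: TP(1))
  next
    case (2 TP)
    then obtain T P where TP: "TP = (T, P)" "T \<subseteq> S" "partition_on (S - T) P" by auto
    have "\<Union>P = S - T" using partition_onD1[OF TP(3)] by simp
    hence "disjnt (insert a T) (\<Union>P)" using a by (auto simp: disjnt_def)
    moreover have "insert a S - insert a T = S - T" using a by auto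
    ultimately show ?case using TP by (auto simp: partition_on_insert)
  next
    case (3 P)
    hence "blk P \<in> P" "a \<in> blk P" using blk by blast+
    thus ?case by (simp add: insert_absorb)
  next
    case (4 P)
    hence P: "partition_on (insert a S) P" by simp
    have b: "blk P \<in> P" "a \<in> blk P" using blk[OF P] by auto
    have "disjnt (blk P) (\<Union>(P - {blk P}))"
      using partition_onD2[OF P] b(1) unfolding disjoint_def disjnt_def by blast
    hence "partition_on (insert a S - blk P) (P - {blk P})" "blk P \<subseteq> insert a S"
      using partition_on_insert[of "blk P" "P - {blk P}" "insert a S"] P b(1) by (simp_all add: insert_absorb)
    moreover have "insert a S - blk P = S - (blk P - {a})" using b(2) a by auto
    ultimately show ?case by auto
  next
    case (5 TP)
    then obtain T P where TP: "TP = (T, P)" "T \<subseteq> S" "partition_on (S - T) P" by auto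
    have "insert a T \<notin> P" using partition_onD1[OF TP(3)] a by auto
    moreover have "finite P" "finite T" using finite_elements[OF _ TP(3)] S TP(2) finite_subset by auto
    moreover have "a \<notin> T" using TP a by auto
    ultimately show ?case by (simp add: TP(1))
  qed
  finally show ?thesis by (simp add: partition_sum_def)
qed

lemma sum_Pow_card:
  fixes f :: "nat \<Rightarrow> 'b::comm_ring_1"
  assumes "finite S"
  shows "(\<Sum>T\<in>Pow S. f (card T)) = (\<Sum>j\<le>card S. of_nat (card S choose j) * f j)"
proof -
  have "(\<Sum>T\<in>Pow S. f (card T)) = (\<Sum>j\<le>card S. \<Sum>T | T \<in> Pow S \<and> card T = j. f (card T))"
    using assms by (intro sum.group[symmetric]) (auto intro: card_mono)
  also have "\<dots> = (\<Sum>j\<le>card S. of_nat (card S choose j) * f j)"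
    using n_subsets[OF assms] by (intro sum.cong) (simp_all add: Pow_def)
  finally show ?thesis .
qed

lemma partition_sum_eq_bell_sum:
  assumes "finite S"
  shows "partition_sum h S = bell_sum h (card S)"
  using assms
proof (induction "card S" arbitrary: S rule: less_induct)
  case less
  show ?case
  proof (cases "S = {}")
    case True
    thus ?thesis by (simp add: partition_sum_def partition_on_empty)
  next
    case False
    then obtain a R where S: "S = insert a R" "a \<notin> R" by (metis ex_in_conv mk_disjoint_insert)
    hence R: "finite R" "card S = Suc (card R)" using less.prems by auto
    have IH: "partition_sum h (R - T) = bell_sum h (card R - card T)" if "T \<in> Pow R" for T
    proof -
      have "finite T" using that R(1) finite_subset by auto
      hence "card (R - T) = card R - card T" using that by (simp add: card_Diff_subset)
      thus ?thesis using less.hyps[of "R - T"] R by simp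
    qed
    have "partition_sum h S = (\<Sum>T\<in>Pow R. h (Suc (card T)) * bell_sum h (card R - card T))"
      unfolding S(1) partition_sum_insert[OF R(1) S(2)] by (intro sum.cong) (simp_all add: IH)
    also have "\<dots> = bell_sum h (Suc (card R))"
      unfolding sum_Pow_card[OF R(1), where f = "\<lambda>j. h (Suc j) * bell_sum h (card R - j)"]
      by (simp add: mult.assoc)
    finally show ?thesis by (simp add: R(2))
  qed
qed

section \<open>Refinements and products over blocks\<close>

definition refinements :: "'v set set \<Rightarrow> 'v set set set" where
  "refinements Q = {P. partition_on (\<Union>Q) P \<and> (\<forall>C\<in>P. \<exists>B\<in>Q. C \<subseteq> B)}"

text \<open>A refinement amounts to an independent choice of a partition for each block, so the sum
  factors. The induction separates the parts inside \<open>B\<close> from the others; the separation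
  is unambiguous because parts are nonempty.\<close>

lemma sum_refinements:
  fixes h :: "nat \<Rightarrow> 'b::comm_ring_1"
  assumes "finite Q" "disjoint Q" "\<And>B. B \<in> Q \<Longrightarrow> finite B"
  shows "(\<Sum>P\<in>refinements Q. \<Prod>C\<in>P. h (card C)) = (\<Prod>B\<in>Q. partition_sum h B)"
  using assms
proof (induction Q rule: finite_induct)
  case empty
  have "refinements {} = {{} :: 'a set set}" by (auto simp: refinements_def partition_on_empty)
  thus ?case by simp
next
  case (insert B Q)
  have disj: "B \<inter> B' = {}" if "B' \<in> Q" for B'
    using insert.prems(1) insert.hyps(2) that unfolding disjoint_def by auto
  hence disjU: "B \<inter> \<Union>Q = {}" by auto
  have finU: "finite (\<Union>Q)" using insert by auto
  have split: "{C \<in> \<tau> \<union> \<sigma>. C \<subseteq> B} = \<tau>" "{C \<in> \<tau> \<union> \<sigma>. \<not> C \<subseteq> B} = \<sigma>"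
    if "partition_on B \<tau>" "\<sigma> \<in> refinements Q" for \<tau> \<sigma>
  proof -
    have "C \<subseteq> B" if "C \<in> \<tau>" for C using partition_onD1[OF \<open>partition_on B \<tau>\<close>] that by auto
    moreover have "\<not> C \<subseteq> B" if "C \<in> \<sigma>" for C
    proof
      assume "C \<subseteq> B"
      have s: "partition_on (\<Union>Q) \<sigma>" using \<open>\<sigma> \<in> refinements Q\<close> by (simp add: refinements_def)
      have "C \<subseteq> \<Union>Q" using partition_onD1[OF s] that by auto
      hence "C = {}" using disjU \<open>C \<subseteq> B\<close> by auto
      thus False using partition_onD3[OF s] that by simp
    qed
    ultimately show "{C \<in> \<tau> \<union> \<sigma>. C \<subseteq> B} = \<tau>" "{C \<in> \<tau> \<union> \<sigma>. \<not> C \<subseteq> B} = \<sigma>" by blast+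
  qed
  have "(\<Prod>B\<in>insert B Q. partition_sum h B) =
      (\<Sum>\<tau> | partition_on B \<tau>. \<Prod>C\<in>\<tau>. h (card C)) * (\<Sum>\<sigma>\<in>refinements Q. \<Prod>C\<in>\<sigma>. h (card C))"
    using insert by (simp add: partition_sum_def disjoint_def)
  also have "\<dots> = (\<Sum>(\<tau>, \<sigma>)\<in>{\<tau>. partition_on B \<tau>} \<times> refinements Q.
      (\<Prod>C\<in>\<tau>. h (card C)) * (\<Prod>C\<in>\<sigma>. h (card C)))"
    by (simp add: sum_product sum.cartesian_product)
  also have "\<dots> = (\<Sum>P\<in>refinements (insert B Q). \<Prod>C\<in>P. h (card C))"
  proof (rule sum.reindex_bij_witness[where j = "\<lambda>(\<tau>, \<sigma>). \<tau> \<union> \<sigma>"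
        and i = "\<lambda>P. ({C \<in> P. C \<subseteq> B}, {C \<in> P. \<not> C \<subseteq> B})"], goal_cases)
    case (1 ts)
    then obtain \<tau> \<sigma> where ts: "ts = (\<tau>, \<sigma>)" "partition_on B \<tau>" "\<sigma> \<in> refinements Q" by auto
    show ?case using split[OF ts(2,3)] by (simp add: ts(1))
  next
    case (2 ts)
    then obtain \<tau> \<sigma> where ts: "ts = (\<tau>, \<sigma>)" "partition_on B \<tau>" "\<sigma> \<in> refinements Q" by auto
    have s: "partition_on (\<Union>Q) \<sigma>" "\<forall>C\<in>\<sigma>. \<exists>B\<in>Q. C \<subseteq> B" using ts(3) by (simp_all add: refinements_def)
    have U: "\<Union>\<tau> = B" "\<Union>\<sigma> = \<Union>Q" using partition_onD1[OF ts(2)] partition_onD1[OF s(1)] by simp_all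
    have "partition_on (\<Union>(insert B Q)) (\<tau> \<union> \<sigma>)"
    proof (rule partition_onI)
      show "\<Union> (\<tau> \<union> \<sigma>) = \<Union> (insert B Q)" using U by simp
      show "{} \<notin> \<tau> \<union> \<sigma>" using partition_onD3[OF ts(2)] partition_onD3[OF s(1)] by simp
      fix p q assume pq: "p \<in> \<tau> \<union> \<sigma>" "q \<in> \<tau> \<union> \<sigma>" "p \<noteq> q"
      have t: "p \<subseteq> B" if "p \<in> \<tau>" for p using U(1) that by auto
      have u: "p \<subseteq> \<Union>Q" if "p \<in> \<sigma>" for p using U(2) that by auto
      have tt: "disjnt p q" if "p \<in> \<tau>" "q \<in> \<tau>"
        using disjointD[OF partition_onD2[OF ts(2)] that pq(3)] by (simp add: disjnt_def)
      have ss: "disjnt p q" if "p \<in> \<sigma>" "q \<in> \<sigma>"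
        using disjointD[OF partition_onD2[OF s(1)] that pq(3)] by (simp add: disjnt_def)
      have tu: "disjnt x y" if "x \<in> \<tau>" "y \<in> \<sigma>" for x y
        using t[OF that(1)] u[OF that(2)] disjU by (auto simp: disjnt_def)
      show "disjnt p q" using pq(1,2) tt ss tu[of p q] tu[of q p] by (auto simp: disjnt_sym)
    qed
    moreover have "\<exists>B'\<in>insert B Q. C \<subseteq> B'" if "C \<in> \<tau> \<union> \<sigma>" for C
      using that s(2) U(1) by auto
    ultimately show ?case by (simp add: ts(1) refinements_def)
  next
    case (3 P)
    show ?case by auto
  next
    case (4 P)
    hence P: "partition_on (\<Union>(insert B Q)) P" "\<forall>C\<in>P. \<exists>B'\<in>insert B Q. C \<subseteq> B'"
      by (simp_all add: refinements_def)
    have inQ: "\<exists>B'\<in>Q. C \<subseteq> B'" if "C \<in> P" "\<not> C \<subseteq> B" for C using P(2) that by auto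
    have PU: "\<Union>P = B \<union> \<Union>Q" using partition_onD1[OF P(1)] by simp
    have sub: "disjnt p q" if "p \<in> P" "q \<in> P" "p \<noteq> q" for p q
      using disjointD[OF partition_onD2[OF P(1)] that] by (simp add: disjnt_def)
    have "partition_on B {C \<in> P. C \<subseteq> B}"
    proof (rule partition_onI)
      show "\<Union> {C \<in> P. C \<subseteq> B} = B"
      proof (intro equalityI subsetI)
        fix x assume x: "x \<in> B"
        then obtain C where C: "C \<in> P" "x \<in> C" using PU by blast
        have "C \<subseteq> B"
        proof (rule ccontr)
          assume "\<not> C \<subseteq> B"
          thus False using inQ[OF C(1)] C(2) x disj by blast
        qed
        thus "x \<in> \<Union> {C \<in> P. C \<subseteq> B}" using C by blast
      qed blast
    qed (use sub partition_onD3[OF P(1)] in auto)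
    moreover have "partition_on (\<Union>Q) {C \<in> P. \<not> C \<subseteq> B}"
    proof (rule partition_onI)
      show "\<Union> {C \<in> P. \<not> C \<subseteq> B} = \<Union>Q"
      proof (intro equalityI subsetI)
        fix x assume "x \<in> \<Union> {C \<in> P. \<not> C \<subseteq> B}"
        thus "x \<in> \<Union>Q" using inQ by blast
      next
        fix x assume x: "x \<in> \<Union>Q"
        then obtain C where C: "C \<in> P" "x \<in> C" using PU by blast
        moreover have "\<not> C \<subseteq> B" using x disjU C(2) by blast
        ultimately show "x \<in> \<Union> {C \<in> P. \<not> C \<subseteq> B}" by blast
      qed
    qed (use sub partition_onD3[OF P(1)] in auto)
    moreover have "\<forall>C\<in>{C \<in> P. \<not> C \<subseteq> B}. \<exists>B'\<in>Q. C \<subseteq> B'" using inQ by simp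
    ultimately have "{C \<in> P. \<not> C \<subseteq> B} \<in> refinements Q" by (simp only: refinements_def mem_Collect_eq)
    thus ?case using \<open>partition_on B _\<close> by (intro SigmaI) simp_all
  next
    case (5 ts)
    then obtain \<tau> \<sigma> where ts: "ts = (\<tau>, \<sigma>)" "partition_on B \<tau>" "\<sigma> \<in> refinements Q" by auto
    have s: "partition_on (\<Union>Q) \<sigma>" using ts(3) by (simp add: refinements_def)
    have "finite \<tau>" "finite \<sigma>"
      using finite_elements[OF _ ts(2)] finite_elements[OF finU s] insert.prems by auto
    moreover have "{C \<in> \<tau> \<union> \<sigma>. C \<subseteq> B} \<inter> {C \<in> \<tau> \<union> \<sigma>. \<not> C \<subseteq> B} = {}" by blast
    hence "\<tau> \<inter> \<sigma> = {}" unfolding split[OF ts(2,3)] .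
    ultimately show ?case by (simp add: ts(1) prod.union_disjoint)
  qed
  finally show ?case by simp
qed

lemma rev_at_prod:
  assumes "\<And>x. x \<in> A \<Longrightarrow> rev_at (d x) (p x) = p x"
  shows "rev_at (\<Sum>x\<in>A. d x) (\<Prod>x\<in>A. p x) = (\<Prod>x\<in>A. p x)"
  using assms
proof (induction A rule: infinite_finite_induct)
  case (insert x A)
  have px: "rev_at (d x) (p x) = p x" and pA: "rev_at (sum d A) (prod p A) = prod p A" using insert by auto
  have "degree (p x) \<le> d x" "degree (prod p A) \<le> sum d A"
    using degree_le_rev_at[of "d x" "p x"] degree_le_rev_at[of "sum d A" "prod p A"] px pA by simp_all
  from rev_at_mult[OF this] show ?case using insert.hyps px pA by simp
qed (simp_all add: rev_at_def)

text \<open>With \<open>rank_of_complete\<close> this makes the rank of a flat additive over its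
  blocks, so palindromicity and degree bounds can be checked block by block.\<close>

lemma sum_card_minus_one:
  assumes "finite V" "partition_on V P"
  shows "(\<Sum>B\<in>P. card B - 1) + card P = card V"
proof -
  have fin: "finite P" "\<And>B. B \<in> P \<Longrightarrow> finite B"
    using finite_elements[OF assms] partition_onD1[OF assms(2)] assms(1) by (auto intro: finite_subset)
  have "card V = (\<Sum>B\<in>P. card B)"
    unfolding partition_onD1[OF assms(2)] using partition_onD2[OF assms(2)] fin(2)
    by (intro card_Union_disjoint) auto
  also have "\<dots> = (\<Sum>B\<in>P. (card B - 1) + 1)"
  proof (intro sum.cong refl)
    fix B assume "B \<in> P"
    hence "card B \<noteq> 0" using fin(2) partition_onD3[OF assms(2)] by auto
    thus "card B = (card B - 1) + 1" by simp
  qed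
  also have "\<dots> = (\<Sum>B\<in>P. card B - 1) + card P" by (simp only: sum.distrib) simp
  finally show ?thesis by simp
qed

text \<open>Reduces the lattice problem to sequences indexed by block sizes. The factor t =
  \<open>monom 1 1\<close> attached to each block encodes the power of t in \<open>ikl_eqI\<close>:
  a refinement \<open>G\<close> of \<open>F\<close> has as many additional blocks as the rank
  difference, so the product over the blocks of \<open>G\<close> carries the required power times
  the common factor t^(number of blocks of F), which is cancelled.\<close>

lemma ikl_complete_matroid:
  fixes lam c :: "nat \<Rightarrow> rat poly"
  assumes V: "finite V" "V \<noteq> {}"
    and lam1: "lam 1 = 1"
    and pal: "\<And>n. n \<ge> 1 \<Longrightarrow> rev_at (n - 1) (lam n) = lam n"
    and c: "\<And>n. n \<ge> 1 \<Longrightarrow> bell_sum (\<lambda>n. monom 1 1 * lam n) n = monom 1 1 * c n"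
    and deg: "\<And>n. n \<ge> 2 \<Longrightarrow> 2 * degree (c n) < n - 1"
  defines "M \<equiv> complete_matroid V"
  shows "rat_poly (ikl (flats M) (rank_of M) (ground M) {}) = c (card V)"
proof -
  let ?L = "flats M" and ?r = "rank_of M" and ?K = "components V"
  have M: "is_matroid M" "loopless M"
    unfolding M_def by (rule is_matroid_complete[OF V(1)] loopless_complete)+
  interpret ranked_family ?L ?r by (rule ranked_family_flats[OF M(1)])
  have c1: "c 1 = 1"
  proof -
    have "monom 1 1 * c 1 = monom 1 1 * (1 :: rat poly)" using c[of 1] lam1 by simp
    thus ?thesis by (subst (asm) mult_left_cancel) simp_all
  qed
  have sub: "F \<subseteq> complete_edges V" if "F \<in> ?L" for F using flatsD[OF that] by (simp add: M_def)
  have rank: "?r F + card (?K F) = card V" if "F \<in> ?L" for F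
    using rank_of_complete[OF V(1) sub[OF that]] by (simp add: M_def)
  have part: "partition_on V (?K F)" for F by (rule partition_on_components)
  have rank': "?r F = (\<Sum>B\<in>?K F. card B - 1)" if "F \<in> ?L" for F
    using rank[OF that] sum_card_minus_one[OF V(1) part, of F] by simp
  have UK: "\<Union>(?K F) = V" for F using partition_onD1[OF part] by simp
  have finK: "finite (?K F)" for F by (rule finite_elements[OF V(1) part])
  have block: "finite B" "card B \<ge> 1" if "B \<in> ?K F" for B F
  proof -
    show "finite B" using that UK[of F] V(1) by (auto intro: finite_subset)
    moreover have "B \<noteq> {}" using that partition_onD3[OF part, of F] by auto
    ultimately show "card B \<ge> 1" by (simp add: Suc_le_eq card_gt_0_iff)
  qed
  note be = block_edges_components[OF V(1), folded M_def]
  have bij: "bij_betw ?K (ivl ?L {} F) (refinements (?K F))" if F: "F \<in> ?L" for F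
  proof (rule bij_betw_byWitness[where f' = "block_edges V"])
    show "\<forall>G\<in>ivl ?L {} F. block_edges V (?K G) = G" using be by (auto simp: ivl_def)
    show "\<forall>P\<in>refinements (?K F). ?K (block_edges V P) = P"
      using components_block_edges by (auto simp: refinements_def UK)
    have refine: "(\<forall>B\<in>P. \<exists>C\<in>?K F. B \<subseteq> C) \<longleftrightarrow> block_edges V P \<subseteq> F" if "partition_on V P" for P
      using block_edges_subset_iff[OF that part, of F] be[OF F] by simp
    show "?K ` ivl ?L {} F \<subseteq> refinements (?K F)"
    proof
      fix P assume "P \<in> ?K ` ivl ?L {} F"
      then obtain G where G: "G \<in> ?L" "G \<subseteq> F" "P = ?K G" by (auto simp: ivl_def)
      thus "P \<in> refinements (?K F)" using refine[OF part, of G] be[OF G(1)] part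
        by (simp add: refinements_def UK)
    qed
    show "block_edges V ` refinements (?K F) \<subseteq> ivl ?L {} F"
    proof
      fix G assume "G \<in> block_edges V ` refinements (?K F)"
      then obtain P where P: "partition_on V P" "\<forall>B\<in>P. \<exists>C\<in>?K F. B \<subseteq> C" "G = block_edges V P"
        by (auto simp: refinements_def UK)
      thus "G \<in> ivl ?L {} F" using refine[OF P(1)] block_edges_in_flats[OF V(1) P(1)]
        by (simp add: ivl_def M_def)
    qed
  qed
  have r0: "?r {} = 0" by (rule rank_of_empty[OF M(1)])
  define \<Lambda> where "\<Lambda> F = (\<Prod>B\<in>?K F. lam (card B))" for F
  define C where "C F = (\<Prod>B\<in>?K F. c (card B))" for F
  have "rat_poly (ikl ?L ?r (ground M) {}) = C (ground M)"
  proof (rule ikl_eqI[where \<Lambda> = \<Lambda>])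
    show "{} \<in> ?L" by (rule empty_in_flats[OF M])
    have "card B = 1" if "B \<in> ?K {}" for B
    proof -
      have "card B - 1 = 0"
        using rank'[OF empty_in_flats[OF M]] r0 that finK[of "{}"] by simp
      thus ?thesis using block(2)[OF that] by simp
    qed
    thus "\<Lambda> {} = 1" unfolding \<Lambda>_def using lam1 by (intro prod.neutral) simp
    show "ground M \<in> ?L" by (rule ground_in_flats)
    show "rev_at (?r F) (\<Lambda> F) = \<Lambda> F" if "F \<in> ?L" for F
      unfolding \<Lambda>_def rank'[OF that] by (rule rev_at_prod) (rule pal[OF block(2)])
  next
    fix F assume F: "F \<in> ?L"
    have "monom 1 (card (?K F)) * C F = (\<Prod>B\<in>?K F. monom 1 1 * c (card B))"
      by (simp add: C_def prod.distrib monom_power)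
    also have "\<dots> = (\<Prod>B\<in>?K F. partition_sum (\<lambda>n. monom 1 1 * lam n) B)"
    proof (rule prod.cong[OF refl])
      fix B assume B: "B \<in> ?K F"
      show "monom 1 1 * c (card B) = partition_sum (\<lambda>n. monom 1 1 * lam n) B"
        unfolding partition_sum_eq_bell_sum[OF block(1)[OF B]] by (rule c[OF block(2)[OF B], symmetric])
    qed
    also have "\<dots> = (\<Sum>P\<in>refinements (?K F). \<Prod>B\<in>P. monom 1 1 * lam (card B))"
      by (rule sum_refinements[symmetric, OF finK partition_onD2[OF part] block(1)])
    also have "\<dots> = (\<Sum>G\<in>ivl ?L {} F. \<Prod>B\<in>?K G. monom 1 1 * lam (card B))"
      by (rule sum.reindex_bij_betw[OF bij[OF F], symmetric])
    also have "\<dots> = (\<Sum>G\<in>ivl ?L {} F. monom 1 (card (?K F)) * (\<Lambda> G * monom 1 (?r F - ?r G)))"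
    proof (intro sum.cong refl)
      fix G assume G: "G \<in> ivl ?L {} F"
      hence GL: "G \<in> ?L" "G \<subseteq> F" by (auto simp: ivl_def)
      have "card (?K G) = card (?K F) + (?r F - ?r G)"
        using rank[OF F] rank[OF GL(1)] rank_mono[OF GL(1) F GL(2)] by simp
      thus "(\<Prod>B\<in>?K G. monom 1 1 * lam (card B)) = monom 1 (card (?K F)) * (\<Lambda> G * monom 1 (?r F - ?r G))"
        by (simp add: \<Lambda>_def prod.distrib monom_power mult_monom mult.assoc mult.left_commute)
    qed
    finally have "monom 1 (card (?K F)) * C F =
        monom 1 (card (?K F)) * (\<Sum>G\<in>ivl ?L {} F. \<Lambda> G * monom 1 (?r F - ?r G))"
      by (simp add: sum_distrib_left)
    thus "C F = (\<Sum>G\<in>ivl ?L {} F. \<Lambda> G * monom 1 (?r F - ?r G))"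
      by (subst (asm) mult_left_cancel) simp_all
  next
    fix F assume F: "F \<in> ?L" "F \<noteq> {}"
    have le: "2 * degree (c (card B)) \<le> card B - 1" and
      less: "card B \<ge> 2 \<Longrightarrow> 2 * degree (c (card B)) < card B - 1" if "B \<in> ?K F" for B
      using deg[of "card B"] c1 block(2)[OF that] by (cases "card B = 1"; simp)+
    have "?r F \<noteq> 0" using rank_of_eq_0_iff[OF M F(1)] F(2) by simp
    \<comment> \<open>A nonempty flat has a block with at least two vertices. Its strict bound makes
      the total strict, while singletons contribute 0 on both sides.\<close>
    then obtain B where B: "B \<in> ?K F" "card B - 1 \<noteq> 0"
      unfolding rank'[OF F(1)] by (meson sum.neutral)
    have "2 * degree (C F) \<le> (\<Sum>B\<in>?K F. 2 * degree (c (card B)))"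
      using degree_prod_sum_le[OF finK, of "\<lambda>B. c (card B)" F] by (simp add: C_def o_def sum_distrib_left[symmetric])
    also have "\<dots> < (\<Sum>B\<in>?K F. card B - 1)"
      by (rule sum_strict_mono_ex1[OF finK]) (use le less B in \<open>auto intro!: bexI[of _ B]\<close>)
    finally show "2 * degree (C F) < ?r F" unfolding rank'[OF F(1)] .
  qed (simp_all add: r0)
  also have "?K (ground M) = {V}" using components_complete_edges[OF V(2)] by (simp add: M_def)
  hence "C (ground M) = c (card V)" by (simp add: C_def)
  finally show ?thesis .
qed

section \<open>Generating functions\<close>

unbundle fps_syntax

text \<open>The coefficients of \<open>(1 + u)\<^sup>t e\<^sup>-\<^sup>t\<^sup>u\<close> as a power series in \<open>u\<close>.\<close>

fun hcoeff :: "nat \<Rightarrow> rat poly" where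
  "hcoeff 0 = 1"
| "hcoeff (Suc 0) = 0"
| "hcoeff (Suc (Suc j)) =
     smult (- 1 / of_nat (j + 2)) (smult (of_nat (j + 1)) (hcoeff (Suc j)) + pCons 0 (hcoeff j))"

text \<open>The equation (1 + u) h' = - t u h of h = (1 + u)^t exp (- t u), read at u^(j+1)
  t^i.\<close>

lemma coeff_hcoeff_rec:
  "of_nat (j + 2) * coeff (hcoeff (j + 2)) i + of_nat (j + 1) * coeff (hcoeff (j + 1)) i =
     - (if i = 0 then 0 else coeff (hcoeff j) (i - 1))"
  by (auto simp: coeff_pCons field_simps split: nat.split)

text \<open>The logarithm t (ln (1 + u) - u) starts with - t u^2 / 2, so every t is accompanied by
  at least u^2.\<close>

lemma coeff_hcoeff_eq_0: "j < 2 * i \<Longrightarrow> coeff (hcoeff j) i = 0"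
proof (induction j arbitrary: i rule: hcoeff.induct)
  case (3 j)
  have "coeff (hcoeff (Suc j)) i = 0" "coeff (hcoeff j) (i - 1) = 0" using 3 by auto
  thus ?case by (auto simp: coeff_pCons split: nat.split)
qed auto

lemma coeff_0_hcoeff: "j > 0 \<Longrightarrow> coeff (hcoeff j) 0 = 0"
  by (induction j rule: hcoeff.induct) auto

text \<open>The part of the series \<open>(1 + u)\<^sup>t e\<^sup>-\<^sup>t\<^sup>u\<close> formed by the monomials \<open>u\<^sup>j t\<^sup>i\<close> with \<open>j = 2 i + d\<close>, at \<open>t = 1\<close>.\<close>

definition hdiag :: "nat \<Rightarrow> rat fps" where
  "hdiag d = Abs_fps (\<lambda>j. if d \<le> j \<and> even (j - d) then coeff (hcoeff j) ((j - d) div 2) else 0)"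

lemma hdiag_nth: "hdiag d $ (d + 2 * i) = coeff (hcoeff (d + 2 * i)) i"
  by (simp add: hdiag_def)

lemma hdiag_nth_eq_0: "j < d \<or> odd (j + d) \<Longrightarrow> hdiag d $ j = 0"
  by (auto simp: hdiag_def)

lemma hdiag_0_nth_0: "hdiag 0 $ 0 = 1"
  by (simp add: hdiag_def)

text \<open>On the extreme diagonal the middle term of the recurrence falls outside the
  support.\<close>

lemma fps_deriv_hdiag_0: "fps_deriv (hdiag 0) = - fps_X * hdiag 0"
proof (rule fps_ext)
  fix n
  show "fps_deriv (hdiag 0) $ n = (- fps_X * hdiag 0) $ n"
  proof (cases n)
    case (Suc m)
    show ?thesis
    proof (cases "even m")
      case True
      then obtain i where i: "m = 2 * i" by (elim evenE)
      have "coeff (hcoeff (m + 1)) (i + 1) = 0" by (rule coeff_hcoeff_eq_0) (simp add: i)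
      thus ?thesis using coeff_hcoeff_rec[of m "i + 1"] hdiag_nth[of 0 i] hdiag_nth[of 0 "i + 1"]
        by (simp add: Suc i add.commute)
    next
      case False
      thus ?thesis by (simp add: Suc hdiag_nth_eq_0)
    qed
  qed (simp add: hdiag_def)
qed

text \<open>The recurrence sorted by j - 2 i: its outer terms lie on the diagonal Suc d, the middle
  one on the diagonal d.\<close>

lemma fps_deriv_hdiag_Suc:
  "fps_deriv (hdiag (Suc d)) = - fps_X * hdiag (Suc d) - fps_X * fps_deriv (hdiag d)"
proof (rule fps_ext)
  fix n
  show "fps_deriv (hdiag (Suc d)) $ n = (- fps_X * hdiag (Suc d) - fps_X * fps_deriv (hdiag d)) $ n"
  proof (cases n)
    case 0
    thus ?thesis by (simp add: hdiag_def)
  next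
    case (Suc m)
    consider "n < d \<or> odd (n + d)" | "n = d" | "n > d" "even (n + d)" by fastforce
    thus ?thesis
    proof cases
      case 1
      thus ?thesis by (auto simp: Suc hdiag_nth_eq_0)
    next
      case 2
      have "hdiag (Suc d) $ m = 0" using 2 Suc by (intro hdiag_nth_eq_0) simp
      thus ?thesis using 2 coeff_hcoeff_rec[of m 0] Suc by (simp add: hdiag_def)
    next
      case 3
      hence "even (n - d)" by simp
      then obtain k where "n - d = 2 * k" by (elim evenE)
      then obtain i where i: "n - d = 2 * Suc i" using 3 by (cases k) auto
      hence "n = d + 2 * Suc i" using 3 by linarith
      hence n: "n = d + 2 * Suc i" "m = Suc d + 2 * i" "Suc n = Suc d + 2 * Suc i" using Suc by simp_all
      have "hdiag (Suc d) $ Suc n = coeff (hcoeff (Suc n)) (Suc i)"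
        "hdiag (Suc d) $ m = coeff (hcoeff m) i" "hdiag d $ n = coeff (hcoeff n) (Suc i)"
        using hdiag_nth[of "Suc d" "Suc i"] hdiag_nth[of "Suc d" i] hdiag_nth[of d "Suc i"]
        unfolding n(1) n(2) n(3) by (simp_all only: n[symmetric])
      thus ?thesis using coeff_hcoeff_rec[of m "Suc i"] Suc by simp
    qed
  qed
qed

section \<open>The diagonals as polynomials times exp (- u^2 / 2)\<close>

lemma fps_ode_eq_0:
  fixes f :: "rat fps"
  assumes "fps_deriv f = - fps_X * f" "f $ 0 = 0"
  shows "f = 0"
proof (rule fps_ext)
  fix n show "f $ n = 0 $ n"
  proof (induction n rule: less_induct)
    case (less n)
    show ?case
    proof (cases n)
      case (Suc m)
      have "of_nat (Suc m) * f $ Suc m = - (fps_X * f) $ m" using assms(1) by (simp add: fps_eq_iff)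
      also have "\<dots> = 0" using less Suc by (cases m) simp_all
      finally show ?thesis using Suc by (simp del: of_nat_Suc)
    qed (use assms in simp)
  qed
qed

lemma fps_deriv_power_Suc: "fps_deriv (f ^ Suc k) = of_nat (Suc k) * fps_deriv f * f ^ k"
  for f :: "rat fps"
  by (simp only: fps_deriv_power' diff_Suc_1)

text \<open>In exp (- t u^2 / 2) exp (t u^3 / 3 - t u^4 / 4 + ...) the term t u^3 / 3 is the only
  contribution of defect 1. The proof shows that the difference of both sides solves the homogeneous
  equation with initial value 0.\<close>

lemma hdiag_1: "hdiag 1 = fps_const (1/3) * fps_X ^ 3 * hdiag 0"
proof -
  define a :: "rat fps" where "a = fps_const (1/3)"
  have a: "3 * a = 1" "fps_deriv a = 0" by (simp_all add: a_def numeral_fps_const)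
  have X: "fps_deriv (fps_X ^ 3 :: rat fps) = 3 * fps_X ^ 2"
    using fps_deriv_power_Suc[of fps_X 2] by (simp add: eval_nat_numeral)
  let ?f = "hdiag 1 - a * fps_X ^ 3 * hdiag 0"
  have d1: "fps_deriv (hdiag 1) = - fps_X * hdiag 1 - fps_X * (- fps_X * hdiag 0)"
    using fps_deriv_hdiag_Suc[of 0] by (simp add: fps_deriv_hdiag_0)
  have "fps_deriv ?f = fps_deriv (hdiag 1) - ((a * (3 * fps_X ^ 2)) * hdiag 0 + a * fps_X ^ 3 * (- fps_X * hdiag 0))"
    by (simp add: X a(2) fps_deriv_hdiag_0)
  also have "\<dots> = - fps_X * ?f" unfolding d1 using a(1) by algebra
  finally have "?f = 0" by (rule fps_ode_eq_0) (simp add: hdiag_def)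
  thus ?thesis by (simp add: a_def)
qed

text \<open>Defect 2 arises from - t u^4 / 4 and from (t u^3 / 3)^2 / 2, whence the constants 1/4
  and 1/18.\<close>

lemma hdiag_2:
  "hdiag 2 = (fps_const (1/18) * fps_X ^ 6 - fps_const (1/4) * fps_X ^ 4) * hdiag 0"
proof -
  define a b c :: "rat fps" where "a = fps_const (1/3)" and "b = fps_const (1/18)" and "c = fps_const (1/4)"
  have a: "3 * a = 1" "18 * b = 1" "4 * c = 1" "fps_deriv a = 0" "fps_deriv b = 0" "fps_deriv c = 0"
    by (simp_all add: a_def b_def c_def numeral_fps_const)
  have X: "fps_deriv (fps_X ^ 3 :: rat fps) = 3 * fps_X ^ 2"
    "fps_deriv (fps_X ^ 4 :: rat fps) = 4 * fps_X ^ 3" "fps_deriv (fps_X ^ 6 :: rat fps) = 6 * fps_X ^ 5"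
    using fps_deriv_power_Suc[of fps_X 2] fps_deriv_power_Suc[of fps_X 3] fps_deriv_power_Suc[of fps_X 5]
    by (simp_all add: eval_nat_numeral)
  let ?p = "b * fps_X ^ 6 - c * fps_X ^ 4"
  let ?f = "hdiag 2 - ?p * hdiag 0"
  have d1: "fps_deriv (hdiag 1) = a * (3 * fps_X ^ 2) * hdiag 0 + a * fps_X ^ 3 * (- fps_X * hdiag 0)"
    unfolding hdiag_1 a_def[symmetric] by (simp add: X a fps_deriv_hdiag_0)
  have d2: "fps_deriv (hdiag 2) = - fps_X * hdiag 2 - fps_X * fps_deriv (hdiag 1)"
    by (rule fps_deriv_hdiag_Suc[of 1, unfolded Suc_1])
  have "fps_deriv ?f = fps_deriv (hdiag 2) -
      ((b * (6 * fps_X ^ 5) - c * (4 * fps_X ^ 3)) * hdiag 0 + ?p * (- fps_X * hdiag 0))"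
    by (simp add: X a fps_deriv_hdiag_0)
  also have "\<dots> = - fps_X * ?f" unfolding d2 d1 using a(1-3) by algebra
  finally have "?f = 0" by (rule fps_ode_eq_0) (simp add: hdiag_def)
  thus ?thesis by (simp add: b_def c_def)
qed

text \<open>Since \<open>hdiag 0\<close> is \<open>exp (- u\<^sup>2 / 2)\<close>, this is the exponential generating function of rooted
  triangular cacti.\<close>

definition cactus :: "rat fps" where
  "cactus = fps_inv (fps_X * hdiag 0)"

lemma cactus_nth_0 [simp]: "cactus $ 0 = 0"
  by (simp add: cactus_def fps_inv_def)

lemma compose_cactus: "(fps_X * hdiag 0) oo cactus = fps_X"
  unfolding cactus_def by (rule fps_inv_right) (simp_all add: hdiag_0_nth_0)

lemma fps_X_compose_cactus: "fps_X oo cactus = cactus"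
  by (simp add: fps_X_fps_compose fps_eq_iff)

lemma cactus_mult: "cactus * (hdiag 0 oo cactus) = fps_X"
  using compose_cactus by (simp add: fps_compose_mult_distrib fps_X_compose_cactus)

text \<open>Differentiation of T exp (- T^2 / 2) = x.\<close>

lemma deriv_cactus: "fps_deriv cactus * ((1 - cactus ^ 2) * (hdiag 0 oo cactus)) = 1"
proof -
  have "fps_deriv (cactus * (hdiag 0 oo cactus)) = 1" by (simp add: cactus_mult)
  moreover have "fps_deriv (hdiag 0 oo cactus) = - cactus * (hdiag 0 oo cactus) * fps_deriv cactus"
    by (simp add: fps_compose_deriv fps_deriv_hdiag_0 fps_compose_mult_distrib fps_compose_uminus fps_X_compose_cactus)
  ultimately show ?thesis by (simp add: algebra_simps power2_eq_square)
qed

lemma cactus_ode: "cactus = fps_X * fps_deriv cactus * (1 - cactus ^ 2)"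
proof -
  have "cactus = cactus * (fps_deriv cactus * ((1 - cactus ^ 2) * (hdiag 0 oo cactus)))"
    by (simp add: deriv_cactus)
  also have "\<dots> = (cactus * (hdiag 0 oo cactus)) * fps_deriv cactus * (1 - cactus ^ 2)"
    by (simp add: ac_simps)
  finally show ?thesis by (simp add: cactus_mult)
qed

lemma cactus_nth_1: "cactus $ 1 = 1"
proof -
  have "(fps_deriv cactus * ((1 - cactus ^ 2) * (hdiag 0 oo cactus))) $ 0 = 1" by (simp add: deriv_cactus)
  thus ?thesis by (simp add: hdiag_0_nth_0 power2_eq_square)
qed

section \<open>Coefficients of the powers of \<open>cactus\<close>\<close>

lemma cactus_power_nth_less: "n < k \<Longrightarrow> cactus ^ k $ n = 0"
  using startsby_zero_power_prefix[of cactus k] by simp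

lemma cactus_power_nth_same: "cactus ^ k $ k = 1"
  using startsby_zero_power_nth_same[of cactus k] by (simp only: cactus_nth_0 cactus_nth_1 power_one)

text \<open>\<open>cactus_ode\<close> times k (k + 2) T^(k-1) involves only T^k and the derivatives
  of T^k and T^(k+2). Comparing coefficients gives a recurrence in \<open>k\<close> at fixed
  \<open>n\<close>.\<close>

lemma cactus_power_nth_rec:
  assumes "k > 0"
  shows "of_nat k * of_nat n * cactus ^ (k + 2) $ n = of_nat (k + 2) * (of_nat n - of_nat k) * cactus ^ k $ n"
proof -
  obtain j where j: "k = Suc j" using assms by (cases k) auto
  have X: "(fps_X * fps_deriv f) $ n = of_nat n * f $ n" for f :: "rat fps"
    by (cases n) simp_all
  have "fps_deriv (cactus ^ k) * fps_X = of_nat k * (fps_X * fps_deriv cactus * cactus ^ j)"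
    and "fps_deriv (cactus ^ (k + 2)) * fps_X = of_nat (k + 2) * (fps_X * fps_deriv cactus * cactus ^ (k + 1))"
    using fps_deriv_power_Suc[of cactus j] fps_deriv_power_Suc[of cactus "k + 1"]
    by (simp_all add: j ac_simps del: power_Suc of_nat_Suc)
  hence "of_nat (k + 2) * (fps_X * fps_deriv (cactus ^ k)) - of_nat k * (fps_X * fps_deriv (cactus ^ (k + 2))) =
      of_nat (k * (k + 2)) * (cactus ^ j * (fps_X * fps_deriv cactus * (1 - cactus ^ 2)))"
    by (simp add: algebra_simps j power2_eq_square)
  also have "\<dots> = of_nat (k * (k + 2)) * cactus ^ k"
    unfolding cactus_ode[symmetric] by (simp add: j ac_simps)
  finally have "(of_nat (k + 2) * (fps_X * fps_deriv (cactus ^ k)) -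
      of_nat k * (fps_X * fps_deriv (cactus ^ (k + 2)))) $ n = (of_nat (k * (k + 2)) * cactus ^ k) $ n"
    by simp
  thus ?thesis
    by (simp only: fps_sub_nth fps_mult_left_const_nth X flip: fps_of_nat) (simp add: algebra_simps)
qed

text \<open>Expresses that T is odd. Raising \<open>k\<close> by 2 ends above \<open>n\<close>,
  where the coefficient vanishes; by parity \<open>k\<close> never equals \<open>n\<close>, so the
  factor n - k can be cancelled.\<close>

lemma cactus_power_nth_odd: "odd (n + k) \<Longrightarrow> cactus ^ k $ n = 0"
proof (induction "n - k" arbitrary: k rule: less_induct)
  case less
  show ?case
  proof (cases "k = 0 \<or> n < k")
    case True
    thus ?thesis using less.prems by (cases "n = 0") (auto simp: cactus_power_nth_less)
  next
    case False
    have "n \<noteq> k" using less.prems by auto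
    hence k: "k > 0" "n > k" using False by linarith+
    have "cactus ^ (k + 2) $ n = 0" by (rule less.hyps) (use k(2) less.prems in auto)
    moreover have "of_nat (k + 2) * (of_nat n - of_nat k :: rat) \<noteq> 0" using k(2) by (simp del: of_nat_add)
    ultimately show ?thesis using cactus_power_nth_rec[OF k(1), of n] by (metis mult_eq_0_iff)
  qed
qed

text \<open>The value that Lagrange inversion assigns to T = x exp (T^2 / 2). Here the recurrence
  gives it: at the same exponent of x, passing from k to k + 2 lowers \<open>m\<close> by
  one.\<close>

lemma cactus_power_nth:
  "k > 0 \<Longrightarrow> cactus ^ k $ (k + 2 * m) =
    of_nat k / of_nat (k + 2 * m) * (of_nat (k + 2 * m) / 2) ^ m / fact m"
proof (induction m arbitrary: k)
  case 0
  thus ?case by (simp add: cactus_power_nth_same)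
next
  case (Suc m)
  define N :: rat where "N = of_nat (k + 2 * Suc m)"
  have N: "N = of_nat k + 2 * of_nat (Suc m)" "N > 0" by (simp_all add: N_def)
  have eq: "k + 2 + 2 * m = k + 2 * Suc m" by simp
  have IH: "cactus ^ (k + 2) $ (k + 2 * Suc m) = of_nat (k + 2) / N * (N / 2) ^ m / fact m"
    using Suc.IH[of "k + 2"] unfolding eq N_def by simp
  have rec: "of_nat k * N * cactus ^ (k + 2) $ (k + 2 * Suc m) =
      of_nat (k + 2) * (N - of_nat k) * cactus ^ k $ (k + 2 * Suc m)"
    using cactus_power_nth_rec[OF Suc.prems, of "k + 2 * Suc m"] by (simp only: N_def)
  have N': "N - of_nat k = 2 * of_nat (Suc m)" by (simp add: N(1))
  have cancel: "\<kappa> * P / F = D * y" if "\<kappa> * N * (A / N * P / F) = A * D * y" "A \<noteq> 0" for \<kappa> A P F D y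
  proof -
    have "A * (\<kappa> * P / F) = A * (D * y)" using that(1) N(2) by (simp add: ac_simps)
    thus ?thesis using mult_left_cancel[OF that(2)] by blast
  qed
  have "(of_nat (k + 2) :: rat) \<noteq> 0" by (simp only: of_nat_eq_0_iff)
  hence "of_nat k * (N / 2) ^ m / fact m = (2 * of_nat (Suc m)) * cactus ^ k $ (k + 2 * Suc m)"
    by (rule cancel[OF rec[unfolded IH N']])
  hence "cactus ^ k $ (k + 2 * Suc m) = of_nat k * (N / 2) ^ m / fact m / (2 * of_nat (Suc m))"
    by (simp add: field_simps del: of_nat_Suc)
  also have "\<dots> = of_nat k / N * (N / 2) ^ Suc m / fact (Suc m)"
    using N(2) by (simp add: field_simps)
  finally show ?case unfolding N_def .
qed

section \<open>Reinstating the variable t\<close>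

definition supported_mod2 :: "nat \<Rightarrow> rat fps \<Rightarrow> bool" where
  "supported_mod2 i a \<longleftrightarrow> (\<forall>n. a $ n \<noteq> 0 \<longrightarrow> i \<le> n \<and> even (n - i))"

text \<open>The series t^(-i/2) a(t^(1/2) x). The support condition makes the division by 2 exact,
  so exponents add under multiplication.\<close>

definition lift_mod2 :: "nat \<Rightarrow> rat fps \<Rightarrow> rat poly fps" where
  "lift_mod2 i a = Abs_fps (\<lambda>n. monom (a $ n) ((n - i) div 2))"

lemma lift_mod2_mult:
  assumes a: "supported_mod2 i a" and b: "supported_mod2 j b"
  shows "lift_mod2 i a * lift_mod2 j b = lift_mod2 (i + j) (a * b)"
proof (rule fps_ext)
  fix n
  have "monom (a $ k) ((k - i) div 2) * monom (b $ (n - k)) ((n - k - j) div 2) =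
      monom (a $ k * b $ (n - k)) ((n - (i + j)) div 2)" if "k \<le> n" for k
  proof (cases "a $ k = 0 \<or> b $ (n - k) = 0")
    case False
    hence le: "i \<le> k" "j \<le> n - k" and "even (k - i)" "even (n - k - j)"
      using a b by (auto simp: supported_mod2_def)
    then obtain u v where uv: "k - i = 2 * u" "n - k - j = 2 * v" by (elim evenE)
    have "k = i + 2 * u" "n = k + (j + 2 * v)" using le uv that by simp_all
    hence "n - (i + j) = 2 * (u + v)" by simp
    hence "(n - (i + j)) div 2 = u + v" by simp
    thus ?thesis by (simp only: mult_monom uv) simp
  qed auto
  thus "(lift_mod2 i a * lift_mod2 j b) $ n = lift_mod2 (i + j) (a * b) $ n"
    by (simp add: lift_mod2_def fps_mult_nth monom_sum)
qed

text \<open>With \<open>T\<close> = \<open>cactus\<close> this is \<open>t\<^sup>-\<^sup>1\<^sup>/\<^sup>2 T(t\<^sup>1\<^sup>/\<^sup>2 x)\<close>, which is a power series in \<open>t\<close> and \<open>x\<close>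
  because \<open>T\<close> is odd.\<close>

definition tcactus :: "rat poly fps" where
  "tcactus = lift_mod2 1 cactus"

lemma tcactus_power_nth: "tcactus ^ k $ n = monom (cactus ^ k $ n) ((n - k) div 2)"
proof -
  have supp: "supported_mod2 k (cactus ^ k)" for k
    unfolding supported_mod2_def
    using cactus_power_nth_less[of _ k] cactus_power_nth_odd[of _ k] by (metis even_diff_nat not_less)
  have "tcactus ^ k = lift_mod2 k (cactus ^ k)"
  proof (induction k)
    case 0
    show ?case by (rule fps_ext) (simp add: lift_mod2_def)
  next
    case (Suc k)
    have "supported_mod2 1 cactus" using supp[of 1] by simp
    thus ?case using lift_mod2_mult[OF _ supp[of k], of 1 cactus] Suc by (simp add: tcactus_def)
  qed
  thus ?thesis by (simp add: lift_mod2_def)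
qed

lemma tcactus_nth_0 [simp]: "tcactus $ 0 = 0"
  using tcactus_power_nth[of 1 0] by simp

section \<open>The exponential relation between the two series\<close>

abbreviation tvar :: "rat poly fps" where
  "tvar \<equiv> fps_const (monom 1 1)"

definition hser :: "rat poly fps" where
  "hser = Abs_fps hcoeff"

text \<open>The series (1 + t u) (1 + u)^t exp (- t u). That it is the exponential of t times
  \<open>ellser\<close> is expressed by the differential equation \<open>gser_ode\<close>.\<close>

definition gser :: "rat poly fps" where
  "gser = (1 + tvar * fps_X) * hser"

text \<open>The series \<open>ln (1 + t u) / t + ln (1 + u) - u\<close>; up to the factor \<open>t\<close> it is the logarithm of \<open>gser\<close>.\<close>

definition ellser :: "rat poly fps" where
  "ellser = Abs_fps (\<lambda>k. if k = 0 then 0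
     else smult ((- 1) ^ (k - 1) / of_nat k) (monom 1 (k - 1) + (if k = 1 then 0 else 1)))"

lemma coeff_of_nat_mult: "coeff (of_nat n * p) i = of_nat n * coeff p i" for p :: "rat poly"
  by (simp add: of_nat_poly)

lemma hser_ode: "(1 + fps_X) * fps_deriv hser = - tvar * fps_X * hser"
proof (rule fps_ext)
  fix n
  have rec: "of_nat (Suc (Suc m)) * hcoeff (Suc (Suc m)) =
      - (of_nat (Suc m) * hcoeff (Suc m)) - monom 1 1 * hcoeff m" for m
  proof (rule poly_eqI)
    fix i
    have "coeff (monom 1 1 * hcoeff m) i = (if i = 0 then 0 else coeff (hcoeff m) (i - 1))"
      by (auto simp: coeff_monom_mult)
    thus "coeff (of_nat (Suc (Suc m)) * hcoeff (Suc (Suc m))) i =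
        coeff (- (of_nat (Suc m) * hcoeff (Suc m)) - monom 1 1 * hcoeff m) i"
      using coeff_hcoeff_rec[of m i]
      by (simp only: coeff_diff coeff_minus coeff_of_nat_mult add_2_eq_Suc' Suc_eq_plus1[symmetric])
  qed
  show "((1 + fps_X) * fps_deriv hser) $ n = (- tvar * fps_X * hser) $ n"
  proof (cases n)
    case 0
    thus ?thesis by (simp add: hser_def distrib_right)
  next
    case (Suc m)
    have "((1 + fps_X) * fps_deriv hser) $ n =
        of_nat (Suc (Suc m)) * hcoeff (Suc (Suc m)) + of_nat (Suc m) * hcoeff (Suc m)"
      by (simp add: Suc hser_def distrib_right del: of_nat_Suc hcoeff.simps)
    also have "\<dots> = - (monom 1 1 * hcoeff m)" unfolding rec by simp
    also have "\<dots> = (- tvar * fps_X * hser) $ n"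
      by (simp add: Suc hser_def mult.assoc del: hcoeff.simps)
    finally show ?thesis .
  qed
qed

text \<open>The derivative is 1/(1 + t u) + 1/(1 + u) - 1; \<open>A\<close> and \<open>B\<close> are
  the two geometric series. Clearing denominators leaves 1 - t u^2.\<close>

lemma ellser_ode: "(1 + tvar * fps_X) * (1 + fps_X) * fps_deriv ellser = 1 - tvar * fps_X ^ 2"
proof -
  define A :: "rat poly fps" where "A = Abs_fps (\<lambda>n. monom ((- 1) ^ n) n)"
  define B :: "rat poly fps" where "B = Abs_fps (\<lambda>n. (- 1) ^ n)"
  have A: "(1 + tvar * fps_X) * A = 1"
  proof (rule fps_ext)
    fix n show "((1 + tvar * fps_X) * A) $ n = 1 $ n"
      by (cases n) (simp_all add: A_def distrib_right mult.assoc mult_monom add_monom)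
  qed
  have B: "(1 + fps_X) * B = 1"
  proof (rule fps_ext)
    fix n show "((1 + fps_X) * B) $ n = 1 $ n"
      by (cases n) (simp_all add: B_def distrib_right)
  qed
  have "fps_deriv ellser = A + B - 1"
  proof (rule fps_ext)
    fix n
    have one: "smult ((- 1) ^ n) 1 = ((- 1) ^ n :: rat poly)"
      by (cases "even n") (simp, simp, simp add: one_pCons)
    have sm: "of_nat (Suc n) * smult ((- 1) ^ n / of_nat (Suc n)) p = smult ((- 1) ^ n) p" for p :: "rat poly"
      by (simp add: of_nat_poly del: of_nat_Suc)
    have "fps_deriv ellser $ n =
        of_nat (Suc n) * smult ((- 1) ^ n / of_nat (Suc n)) (monom 1 n + (if n = 0 then 0 else 1))"
      by (simp add: ellser_def del: of_nat_Suc)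
    hence "fps_deriv ellser $ n = monom ((- 1) ^ n) n + (if n = 0 then 0 else (- 1) ^ n)"
      unfolding sm using one by (simp add: smult_add_right smult_monom)
    thus "fps_deriv ellser $ n = (A + B - 1) $ n" by (simp add: A_def B_def)
  qed
  thus ?thesis using A B by algebra
qed

lemma gser_ode: "fps_deriv gser = tvar * fps_deriv ellser * gser"
proof -
  have "(1 + x) * (t * h + (1 + t * x) * h') = (1 + x) * (t * e * ((1 + t * x) * h))"
    if "(1 + x) * h' = - t * x * h" "(1 + t * x) * (1 + x) * e = 1 - t * x ^ 2"
    for t x h h' e :: "rat poly fps"
    using that by algebra
  from this[OF hser_ode ellser_ode]
  have "(1 + fps_X) * (tvar * hser + (1 + tvar * fps_X) * fps_deriv hser) =
      (1 + fps_X) * (tvar * fps_deriv ellser * gser)" by (simp only: gser_def)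
  moreover have "fps_deriv gser = tvar * hser + (1 + tvar * fps_X) * fps_deriv hser"
    by (simp add: gser_def algebra_simps)
  ultimately have "(1 + fps_X) * fps_deriv gser = (1 + fps_X) * (tvar * fps_deriv ellser * gser)" by simp
  moreover have "(1 + fps_X :: rat poly fps) $ 0 \<noteq> 0 $ 0" by simp
  hence "(1 + fps_X :: rat poly fps) \<noteq> 0" by metis
  ultimately show ?thesis by simp
qed

text \<open>The exponential formula: G' = F' G is the recursion of \<open>bell_sum\<close> after
  division by factorials.\<close>

lemma bell_sum_fps:
  fixes F G :: "'a::{comm_ring_1,ring_char_0} fps"
  assumes G: "fps_deriv G = fps_deriv F * G" "G $ 0 = 1"
  shows "bell_sum (\<lambda>n. fact n * F $ n) n = fact n * G $ n"
proof (induction n rule: less_induct)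
  case (less n)
  show ?case
  proof (cases n)
    case (Suc m)
    have "of_nat (m choose j) * (fact (Suc j) * F $ Suc j) * (fact (m - j) * G $ (m - j)) =
        fact m * (fps_deriv F $ j * G $ (m - j))" if "j \<le> m" for j
    proof -
      have "(fact m :: 'a) = of_nat (fact j * fact (m - j) * (m choose j))"
        by (simp only: binomial_fact_lemma[OF that] of_nat_fact)
      thus ?thesis by (simp add: algebra_simps)
    qed
    hence "bell_sum (\<lambda>n. fact n * F $ n) n = fact m * (\<Sum>j\<le>m. fps_deriv F $ j * G $ (m - j))"
      using less Suc by (simp add: sum_distrib_left del: fact_Suc fps_deriv_nth)
    also have "\<dots> = fact m * fps_deriv G $ m"
      by (simp add: G(1) fps_mult_nth atMost_atLeast0 del: fps_deriv_nth)
    finally show ?thesis by (simp add: Suc algebra_simps)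
  qed (simp add: G)
qed

definition Lam :: "rat poly fps" where "Lam = ellser oo tcactus"
definition Gam :: "rat poly fps" where "Gam = gser oo tcactus"

definition lam :: "nat \<Rightarrow> rat poly" where "lam n = fact n * Lam $ n"
text \<open>\<open>poly_shift 1\<close> divides by t, exactly for n >= 1 by
  \<open>coeff_0_Gam\<close>; this realises (exp (t L) - 1) / t.\<close>

definition inv_coeff :: "nat \<Rightarrow> rat poly" where "inv_coeff n = fact n * poly_shift 1 (Gam $ n)"

lemma Gam_ode: "fps_deriv Gam = fps_deriv (tvar * Lam) * Gam"
  unfolding Gam_def Lam_def
  by (simp add: fps_compose_deriv gser_ode fps_compose_mult_distrib ac_simps)

lemma gser_nth: "gser $ k = hcoeff k + (if k = 0 then 0 else monom 1 1 * hcoeff (k - 1))"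
  by (cases k) (simp_all add: gser_def hser_def distrib_right mult.assoc del: hcoeff.simps(3))

lemma Gam_nth: "Gam $ n = (\<Sum>k=0..n. gser $ k * monom (cactus ^ k $ n) ((n - k) div 2))"
  by (simp add: Gam_def fps_compose_nth tcactus_power_nth)

lemma coeff_0_Gam: "n > 0 \<Longrightarrow> coeff (Gam $ n) 0 = 0"
  unfolding Gam_nth coeff_sum coeff_mult_0
proof (intro sum.neutral ballI)
  fix k assume "n > 0"
  thus "coeff (gser $ k) 0 * coeff (monom (cactus ^ k $ n) ((n - k) div 2)) 0 = 0"
    by (cases "k = 0") (simp_all add: gser_nth coeff_mult_0 coeff_0_hcoeff)
qed

lemma Gam_nth_0: "Gam $ 0 = 1"
  by (simp add: Gam_def gser_nth)

lemma bell_sum_lam: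
  assumes "n \<ge> 1"
  shows "bell_sum (\<lambda>n. monom 1 1 * lam n) n = monom 1 1 * inv_coeff n"
proof -
  have "bell_sum (\<lambda>n. fact n * (tvar * Lam) $ n) n = fact n * Gam $ n"
    by (rule bell_sum_fps[OF Gam_ode Gam_nth_0])
  moreover have "(\<lambda>n. fact n * (tvar * Lam) $ n) = (\<lambda>n. monom 1 1 * lam n)"
    by (simp add: lam_def mult.left_commute)
  moreover have "Gam $ n = monom 1 1 * poly_shift 1 (Gam $ n)"
    using coeff_0_Gam[of n] assms
    by (intro poly_eqI) (auto simp: coeff_monom_mult coeff_poly_shift)
  ultimately show ?thesis by (metis inv_coeff_def mult.left_commute)
qed

lemma Lam_nth: "Lam $ n = (\<Sum>k=0..n. ellser $ k * monom (cactus ^ k $ n) ((n - k) div 2))"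
  by (simp add: Lam_def fps_compose_nth tcactus_power_nth)

lemma lam_1: "lam 1 = 1"
  using cactus_nth_1 by (simp add: lam_def Lam_nth ellser_def monom_0 one_pCons)

lemma fact_poly: "(fact n :: rat poly) = [:fact n:]"
  by (metis of_nat_fact of_nat_poly)

lemma rev_at_monom: "i \<le> n \<Longrightarrow> rev_at n (monom c i) = monom c (n - i)"
  by (rule poly_eqI) (auto simp: coeff_rev_at)

text \<open>At x^n the power T^k carries t^((n-k)/2), and \<open>ellser\<close> multiplies it by
  t^(k-1) + 1 up to a scalar; the exponents (n-k)/2 and (n+k)/2 - 1 are mirror images in n - 1. For
  k = 1 they coincide, and a single copy is kept, in accordance with lam 1 = 1.\<close>

lemma rev_at_lam: "rev_at (n - 1) (lam n) = lam n"
proof -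
  have "rev_at (n - 1) (ellser $ k * monom (cactus ^ k $ n) ((n - k) div 2)) =
      ellser $ k * monom (cactus ^ k $ n) ((n - k) div 2)" if "k \<le> n" for k
  proof (cases "k = 0 \<or> odd (n + k)")
    case True
    hence "ellser $ k = 0 \<or> cactus ^ k $ n = 0" using cactus_power_nth_odd[of n k]
      by (elim disjE) (simp_all only: ellser_def fps_nth_Abs_fps if_True simp_thms)
    hence "ellser $ k * monom (cactus ^ k $ n) ((n - k) div 2) = 0" by (elim disjE) (simp_all only: mult_zero_left mult_zero_right monom_eq_0)
    thus ?thesis by (simp only:) (simp add: rev_at_def)
  next
    case False
    hence "even (n - k)" using that by simp
    then obtain m where m: "n - k = 2 * m" by (elim evenE)
    obtain j where j: "k = Suc j" using False by (cases k) auto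
    have jm: "k = Suc j" "n = k + 2 * m" using j m that by linarith+
    define y s where "y = cactus ^ k $ n" and "s = (- 1) ^ j / (of_nat k :: rat)"
    have idx: "n - 1 = j + 2 * m" "(n - k) div 2 = m" using jm by simp_all
    have "ellser $ k * monom y m = (if j = 0 then monom (s * y) m else monom (s * y) (j + m) + monom (s * y) m)"
      by (simp add: ellser_def jm(1) s_def distrib_right mult_monom smult_monom smult_add_right
          monom_0[symmetric] del: of_nat_Suc)
    moreover have "rev_at (j + 2 * m) (p + q) = rev_at (j + 2 * m) p + rev_at (j + 2 * m) q" for p q :: "rat poly"
      by (rule poly_eqI) (simp add: coeff_rev_at)
    ultimately have "rev_at (j + 2 * m) (ellser $ k * monom y m) = ellser $ k * monom y m"
      by (simp add: rev_at_monom add.commute)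
    thus ?thesis unfolding idx y_def .
  qed
  hence "rev_at (n - 1) (Lam $ n) = Lam $ n"
    unfolding Lam_nth rev_at_sum by (intro sum.cong) auto
  thus ?thesis by (simp add: lam_def fact_poly rev_at_smult)
qed

section \<open>Degree bound and extremal diagonals\<close>

text \<open>The part of \<open>gser\<close> with k + 1 = 2 i + d, at t = 1. The factor t u lowers k
  - 2 i by one, which is why two neighbouring diagonals of \<open>hser\<close> meet. For d = 0 only
  u exp (- u^2 / 2) remains, the series inverted by \<open>cactus\<close>.\<close>

definition kdiag :: "nat \<Rightarrow> rat fps" where
  "kdiag d = (if d = 0 then 0 else hdiag (d - 1)) + fps_X * hdiag d"

lemma coeff_gser:
  assumes "k + 1 = 2 * i + d"
  shows "coeff (gser $ k) i = kdiag d $ k"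
proof -
  have 1: "coeff (hcoeff k) i = (if d = 0 then 0 else hdiag (d - 1) $ k)"
  proof (cases d)
    case 0
    thus ?thesis using assms by (simp add: coeff_hcoeff_eq_0)
  next
    case (Suc d')
    hence "k = d' + 2 * i" using assms by simp
    thus ?thesis using hdiag_nth[of d' i] Suc by simp
  qed
  have 2: "coeff (monom 1 1 * hcoeff (k - 1)) i = hdiag d $ (k - 1)" if "k \<noteq> 0"
  proof (cases i)
    case 0
    hence "k - 1 < d" using assms that by simp
    thus ?thesis using 0 by (simp add: coeff_monom_mult hdiag_nth_eq_0)
  next
    case (Suc i')
    hence "k - 1 = d + 2 * i'" using assms that by simp
    thus ?thesis using hdiag_nth[of d i'] Suc by (simp add: coeff_monom_mult)
  qed
  show ?thesis using 1 2 by (auto simp: gser_nth kdiag_def)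
qed

lemma coeff_gser_eq_0:
  assumes "k + 1 < 2 * i"
  shows "coeff (gser $ k) i = 0"
  using assms by (auto simp: gser_nth coeff_monom_mult coeff_hcoeff_eq_0)

lemma coeff_gser_mult_monom:
  assumes "k \<le> n" "even (n + k)"
  obtains m where "n = k + 2 * m" "coeff (gser $ k * monom y ((n - k) div 2)) e =
    (if e < m then 0 else coeff (gser $ k) (e - m) * y)"
proof -
  have "even (n - k)" using assms by simp
  then obtain m where "n - k = 2 * m" by (elim evenE)
  thus ?thesis using that[of m] assms(1) by (simp add: mult.commute[of "gser $ k"] coeff_monom_mult)
qed

text \<open>Replacing u^k by x^n t^((n-k)/2) increases the exponent of the series variable and twice
  that of t by the same amount, so the defect \<open>d\<close> is preserved and t may be set to 1 on
  each diagonal.\<close>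

lemma coeff_Gam:
  assumes "n + 1 = 2 * e + d"
  shows "coeff (Gam $ n) e = (kdiag d oo cactus) $ n"
  unfolding Gam_nth coeff_sum fps_compose_nth
proof (intro sum.cong refl)
  fix k assume "k \<in> {0..n}"
  hence k: "k \<le> n" by simp
  show "coeff (gser $ k * monom (cactus ^ k $ n) ((n - k) div 2)) e = kdiag d $ k * cactus ^ k $ n"
  proof (cases "even (n + k)")
    case True
    obtain m where m: "n = k + 2 * m"
      "coeff (gser $ k * monom (cactus ^ k $ n) ((n - k) div 2)) e =
        (if e < m then 0 else coeff (gser $ k) (e - m) * cactus ^ k $ n)"
      by (rule coeff_gser_mult_monom[OF k True])
    show ?thesis
    proof (cases "e < m")
      case True
      hence "k + 1 < d" using assms m(1) by simp
      hence "k < d - 1" "k - 1 < d" by linarith+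
      hence "hdiag (d - 1) $ k = 0" "hdiag d $ (k - 1) = 0" by (simp_all add: hdiag_nth_eq_0)
      hence "kdiag d $ k = 0" by (cases "k = 0") (simp_all add: kdiag_def)
      thus ?thesis using True m(2) by simp
    next
      case False
      hence "coeff (gser $ k) (e - m) = kdiag d $ k" using assms m(1) by (intro coeff_gser) simp
      thus ?thesis using False m(2) by simp
    qed
  qed (simp add: cactus_power_nth_odd)
qed

lemma coeff_Gam_eq_0:
  assumes "n + 1 < 2 * e"
  shows "coeff (Gam $ n) e = 0"
  unfolding Gam_nth coeff_sum
proof (intro sum.neutral ballI)
  fix k assume "k \<in> {0..n}"
  hence k: "k \<le> n" by simp
  show "coeff (gser $ k * monom (cactus ^ k $ n) ((n - k) div 2)) e = 0"
  proof (cases "even (n + k)")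
    case True
    obtain m where m: "n = k + 2 * m"
      "coeff (gser $ k * monom (cactus ^ k $ n) ((n - k) div 2)) e =
        (if e < m then 0 else coeff (gser $ k) (e - m) * cactus ^ k $ n)"
      by (rule coeff_gser_mult_monom[OF k True])
    thus ?thesis using assms by (simp add: coeff_gser_eq_0)
  qed (simp add: cactus_power_nth_odd)
qed

lemma coeff_inv_coeff: "coeff (inv_coeff n) i = fact n * coeff (Gam $ n) (Suc i)"
  by (simp add: inv_coeff_def fact_poly coeff_poly_shift)

text \<open>Coefficients violating the bound have defect 0 or less. Negative defects do not occur,
  and defect 0 yields the coefficients of x, which vanish for n >= 2.\<close>

lemma degree_inv_coeff:
  assumes "n \<ge> 2"
  shows "2 * degree (inv_coeff n) < n - 1"
proof (cases "inv_coeff n = 0")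
  case False
  let ?i = "degree (inv_coeff n)"
  have "coeff (Gam $ n) (Suc ?i) = 0" if "n - 1 \<le> 2 * ?i"
  proof (cases "n + 1 = 2 * Suc ?i")
    case True
    hence "coeff (Gam $ n) (Suc ?i) = (kdiag 0 oo cactus) $ n" by (intro coeff_Gam) simp
    thus ?thesis using assms by (simp add: kdiag_def compose_cactus)
  qed (use that in \<open>simp add: coeff_Gam_eq_0\<close>)
  moreover have "coeff (inv_coeff n) ?i \<noteq> 0" using False by simp
  ultimately show ?thesis unfolding coeff_inv_coeff by (cases "n - 1 \<le> 2 * ?i") auto
qed (use assms in simp)

text \<open>The factor (1 - u^2) exp (- u^2 / 2) is the derivative of the series inverted by
  \<open>cactus\<close>, so the chain rule cancels it and removes the exponential.\<close>

lemma fps_deriv_compose_cactus: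
  assumes "fps_deriv f = (1 - fps_X ^ 2) * hdiag 0 * p"
  shows "fps_deriv (f oo cactus) = p oo cactus"
proof -
  have "(1 - fps_X ^ 2) oo cactus = 1 - cactus ^ 2"
    by (simp add: fps_compose_sub_distrib fps_X_compose_cactus flip: fps_compose_power)
  hence "fps_deriv (f oo cactus) = (p oo cactus) * (fps_deriv cactus * ((1 - cactus ^ 2) * (hdiag 0 oo cactus)))"
    by (simp add: fps_compose_deriv assms fps_compose_mult_distrib ac_simps)
  thus ?thesis by (simp add: deriv_cactus)
qed

lemma kdiag_1_nth:
  "of_nat (Suc n) * (kdiag 1 oo cactus) $ Suc n = cactus ^ 3 $ n / 3 - cactus $ n"
proof -
  define a :: "rat fps" where "a = fps_const (1/3)"
  have a: "3 * a = 1" "fps_deriv a = 0" by (simp_all add: a_def numeral_fps_const)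
  have X: "fps_deriv (fps_X ^ 4 :: rat fps) = 4 * fps_X ^ 3"
    using fps_deriv_power_Suc[of fps_X 3] by (simp add: eval_nat_numeral)
  have "kdiag 1 = (1 + a * fps_X ^ 4) * hdiag 0"
    by (simp add: kdiag_def hdiag_1[simplified] a_def algebra_simps eval_nat_numeral)
  hence "fps_deriv (kdiag 1) = a * (4 * fps_X ^ 3) * hdiag 0 + (1 + a * fps_X ^ 4) * (- fps_X * hdiag 0)"
    by (simp add: X a fps_deriv_hdiag_0)
  also have "\<dots> = (1 - fps_X ^ 2) * hdiag 0 * (a * fps_X ^ 3 - fps_X)" using a(1) by algebra
  finally have "fps_deriv (kdiag 1 oo cactus) = (a * fps_X ^ 3 - fps_X) oo cactus"
    by (rule fps_deriv_compose_cactus)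
  also have "\<dots> = a * cactus ^ 3 - cactus"
    by (simp add: fps_compose_sub_distrib fps_compose_mult_distrib a_def
        fps_X_compose_cactus flip: fps_compose_power)
  finally have "fps_deriv (kdiag 1 oo cactus) $ n = (a * cactus ^ 3 - cactus) $ n" by simp
  thus ?thesis by (simp add: a_def)
qed

lemma kdiag_2_nth:
  "of_nat (Suc n) * (kdiag 2 oo cactus) $ Suc n =
     cactus ^ 2 $ n - 7/12 * cactus ^ 4 $ n + cactus ^ 6 $ n / 18"
proof -
  define a b c d :: "rat fps" where "a = fps_const (1/3)" and "b = fps_const (1/18)"
    and "c = fps_const (1/4)" and "d = fps_const (7/12)"
  have a: "3 * a = 1" "18 * b = 1" "4 * c = 1" "12 * d = 7"
    "fps_deriv a = 0" "fps_deriv b = 0" "fps_deriv c = 0"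
    by (simp_all add: a_def b_def c_def d_def numeral_fps_const)
  have X: "fps_deriv (fps_X ^ 3 :: rat fps) = 3 * fps_X ^ 2" "fps_deriv (fps_X ^ 5 :: rat fps) = 5 * fps_X ^ 4"
    "fps_deriv (fps_X ^ 7 :: rat fps) = 7 * fps_X ^ 6"
    using fps_deriv_power_Suc[of fps_X 2] fps_deriv_power_Suc[of fps_X 4] fps_deriv_power_Suc[of fps_X 6]
    by (simp_all add: eval_nat_numeral)
  let ?p = "a * fps_X ^ 3 + b * fps_X ^ 7 - c * fps_X ^ 5"
  have "kdiag 2 = hdiag 1 + fps_X * hdiag 2" by (simp add: kdiag_def)
  also have "\<dots> = ?p * hdiag 0"
    unfolding hdiag_1 hdiag_2 a_def b_def c_def by algebra
  finally have "fps_deriv (kdiag 2) =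
      (a * (3 * fps_X ^ 2) + b * (7 * fps_X ^ 6) - c * (5 * fps_X ^ 4)) * hdiag 0 + ?p * (- fps_X * hdiag 0)"
    by (simp add: X a fps_deriv_hdiag_0)
  also have "\<dots> = (1 - fps_X ^ 2) * hdiag 0 * (fps_X ^ 2 - d * fps_X ^ 4 + b * fps_X ^ 6)"
  proof -
    \<comment> \<open>36 is the least common multiple of the denominators 3, 18, 4 and 12.\<close>
    have "36 * (a * (3 * x ^ 2) + b * (7 * x ^ 6) - c * (5 * x ^ 4)) * h + 36 * (a * x ^ 3 + b * x ^ 7 - c * x ^ 5) * (- x * h) =
      36 * ((1 - x ^ 2) * h * (x ^ 2 - d * x ^ 4 + b * x ^ 6))" for x h :: "rat fps"
      using a(1-4) by algebra
    from this[of fps_X "hdiag 0"] have "36 * ((a * (3 * fps_X ^ 2) + b * (7 * fps_X ^ 6) - c * (5 * fps_X ^ 4)) * hdiag 0 +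
        ?p * (- fps_X * hdiag 0)) = 36 * ((1 - fps_X ^ 2) * hdiag 0 * (fps_X ^ 2 - d * fps_X ^ 4 + b * fps_X ^ 6))"
      by (simp only: distrib_left mult.assoc)
    thus ?thesis by (subst (asm) mult_left_cancel) simp_all
  qed
  finally have "fps_deriv (kdiag 2 oo cactus) = (fps_X ^ 2 - d * fps_X ^ 4 + b * fps_X ^ 6) oo cactus"
    by (rule fps_deriv_compose_cactus)
  also have "\<dots> = cactus ^ 2 - d * cactus ^ 4 + b * cactus ^ 6"
    by (simp add: fps_compose_sub_distrib fps_compose_add_distrib
        fps_compose_mult_distrib b_def d_def fps_X_compose_cactus flip: fps_compose_power)
  finally have "fps_deriv (kdiag 2 oo cactus) $ n = (cactus ^ 2 - d * cactus ^ 4 + b * cactus ^ 6) $ n" by simp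
  thus ?thesis by (simp add: b_def d_def)
qed

section \<open>Closed forms\<close>

lemma double_fact_odd: "double_fact (2 * j + 1) * (2 ^ j * fact j) = fact (2 * j + 1)"
proof (induction j)
  case (Suc j)
  have "double_fact (2 * Suc j + 1) * (2 ^ Suc j * fact (Suc j)) =
      (2 * j + 3) * (2 * j + 2) * (double_fact (2 * j + 1) * (2 ^ j * fact j))"
    by (simp add: algebra_simps)
  also have "\<dots> = fact (2 * Suc j + 1)" unfolding Suc.IH by (simp add: algebra_simps)
  finally show ?case .
qed simp

text \<open>With 2 j + 4 vertices the highest degree allowed by the bound has defect 1, as 2 j + 5 =
  2 (j + 2) + 1. The minus sign is compensated by (-1)^rk, the rank being odd.\<close>

lemma coeff_inv_coeff_even:
  "coeff (inv_coeff (2 * j + 4)) (j + 1) =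
     - of_nat ((2 * j + 3) ^ j * double_fact (2 * j + 1))"
proof -
  define N :: rat where "N = of_nat (2 * j + 3)"
  have N: "N = 2 * of_nat j + 3" "N > 0" by (simp_all add: N_def)
  have c1: "cactus $ (2 * j + 3) = 1 / N * (N / 2) ^ Suc j / fact (Suc j)"
  proof -
    have "1 + 2 * Suc j = 2 * j + 3" by simp
    thus ?thesis using cactus_power_nth[of 1 "Suc j"] by (simp only: N_def power_one_right of_nat_1)
  qed
  have c3: "cactus ^ 3 $ (2 * j + 3) = 3 / N * (N / 2) ^ j / fact j"
  proof -
    have "3 + 2 * j = 2 * j + 3" by simp
    thus ?thesis using cactus_power_nth[of 3 j] by (simp only: N_def of_nat_numeral)
  qed
  have f: "fact (2 * j + 4) = of_nat (Suc (2 * j + 3)) * (N * (2 * of_nat (Suc j)) * fact (2 * j + 1) :: rat)"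
    by (simp add: N eval_nat_numeral algebra_simps)
  have "coeff (inv_coeff (2 * j + 4)) (j + 1) = fact (2 * j + 4) * (kdiag 1 oo cactus) $ Suc (2 * j + 3)"
    using coeff_Gam[of "2 * j + 4" "j + 2" 1] by (simp add: coeff_inv_coeff eval_nat_numeral)
  also have "\<dots> = N * (2 * of_nat (Suc j)) * fact (2 * j + 1) *
      (cactus ^ 3 $ (2 * j + 3) / 3 - cactus $ (2 * j + 3))"
    unfolding f kdiag_1_nth[symmetric] by (simp only: ac_simps)
  also have "\<dots> = 2 * of_nat (Suc j) * fact (2 * j + 1) *
      ((N / 2) ^ j / fact j - (N / 2) ^ j * (N / 2) / (of_nat (Suc j) * fact j))"
    unfolding c1 c3 using N(2) by (simp add: field_simps del: of_nat_Suc)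
  also have "\<dots> = fact (2 * j + 1) * (N / 2) ^ j / fact j * (2 * of_nat (Suc j) - N)"
    by (simp add: field_simps del: of_nat_Suc)
  \<comment> \<open>The contributions of T^3 and T nearly cancel; this leaves a pure power of
    \<open>N\<close>.\<close>
  also have "2 * of_nat (Suc j) - N = - 1" by (simp add: N)
  also have "fact (2 * j + 1) = (of_nat (double_fact (2 * j + 1)) * (2 ^ j * fact j) :: rat)"
    using double_fact_odd[of j] by (metis of_nat_fact of_nat_mult of_nat_numeral of_nat_power)
  finally show ?thesis by (simp add: N_def power_divide field_simps)
qed

text \<open>With 2 m + 1 vertices the highest degree allowed by the bound has defect 2, as 2 m + 2 =
  2 m + 2 after passing to the exponent m of t in \<open>Gam\<close>.\<close>

lemma coeff_inv_coeff_odd: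
  assumes "m \<ge> 1"
  shows "coeff (inv_coeff (2 * m + 1)) (m - 1) =
    of_nat m powi (int m - 4) * fact (2 * m + 1) / (3 * fact (m - 1))"
proof -
  define x :: rat where "x = of_nat m"
  have x: "x > 0" using assms by (simp add: x_def)
  have "coeff (inv_coeff (2 * m + 1)) (m - 1) = fact (2 * m + 1) * (kdiag 2 oo cactus) $ Suc (2 * m)"
    using coeff_Gam[of "2 * m + 1" m 2] assms by (simp add: coeff_inv_coeff)
  also have "\<dots> = fact (2 * m) * (cactus ^ 2 $ (2 * m) - 7/12 * cactus ^ 4 $ (2 * m) + cactus ^ 6 $ (2 * m) / 18)"
    unfolding kdiag_2_nth[symmetric] by (simp add: algebra_simps)
  finally have eq: "coeff (inv_coeff (2 * m + 1)) (m - 1) =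
    fact (2 * m) * (cactus ^ 2 $ (2 * m) - 7/12 * cactus ^ 4 $ (2 * m) + cactus ^ 6 $ (2 * m) / 18)" .
  have y: "cactus ^ (2 * i) $ (2 * m) = of_nat i / x * x ^ (m - i) / fact (m - i)" if "0 < i" "i \<le> m" for i
  proof -
    have "2 * i + 2 * (m - i) = 2 * m" using that by simp
    thus ?thesis using cactus_power_nth[of "2 * i" "m - i"] that by (simp add: x_def)
  qed
  \<comment> \<open>For m = 1 and m = 2 the power T^6, and for m = 1 also T^4, starts beyond x^(2
    m), so the general formula for its coefficient does not apply.\<close>
  consider "m = 1" | "m = 2" | j where "m = j + 3"
    using assms by (metis One_nat_def Suc_1 add.commute le_antisym less_eq_Suc_le nat_le_iff_add not_less numeral_3_eq_3)
  thus ?thesis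
  proof cases
    case 1
    have "cactus ^ 2 $ 2 = 1" "cactus ^ 4 $ 2 = 0" "cactus ^ 6 $ 2 = 0"
      by (simp_all add: cactus_power_nth_same cactus_power_nth_less)
    thus ?thesis using eq 1 by (simp add: eval_nat_numeral)
  next
    case 2
    have "cactus ^ 2 $ 4 = 1" using y[of 1] 2 by (simp add: x_def)
    moreover have "cactus ^ 4 $ 4 = 1" "cactus ^ 6 $ 4 = 0"
      by (simp_all add: cactus_power_nth_same cactus_power_nth_less)
    ultimately show ?thesis using eq 2 by (simp add: fact_numeral power_int_minus)
  next
    case 3
    have p: "x powi (int m - 4) = x ^ j / x"
      using x by (simp add: 3 power_int_diff)
    have f: "fact (j + 2) = (of_nat (j + 2) * of_nat (j + 1) * fact j :: rat)"
      "fact (j + 1) = (of_nat (j + 1) * fact j :: rat)" by (simp_all add: algebra_simps)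
    have xj: "of_nat j = x - 3" by (simp add: x_def 3)
    have nz: "x - 1 \<noteq> 0" "x - 2 \<noteq> 0" using xj by (auto simp: x_def 3)
    have c: "cactus ^ 2 $ (2 * m) = 1 / x * x ^ (j + 2) / fact (j + 2)"
      "cactus ^ 4 $ (2 * m) = 2 / x * x ^ (j + 1) / fact (j + 1)"
      "cactus ^ 6 $ (2 * m) = 3 / x * x ^ j / fact j"
      using y[of 1] y[of 2] y[of 3] by (simp_all add: 3)
    have "fact (2 * m + 1) = (2 * x + 1) * (fact (2 * m) :: rat)" by (simp add: x_def)
    moreover have "m - 1 = j + 2" using 3 by simp
    moreover have "1 / x * x ^ (j + 2) / fact (j + 2) - 7/12 * (2 / x * x ^ (j + 1) / fact (j + 1)) + 3 / x * x ^ j / fact j / 18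
        = x ^ j / x * (2 * x + 1) / (3 * fact (j + 2))"
    proof -
      have "of_nat (j + 2) = x - 1" "of_nat (j + 1) = x - 2" by (simp_all add: xj)
      hence F: "fact (j + 2) = (x - 1) * (x - 2) * fact j" "fact (j + 1) = (x - 2) * fact j"
        unfolding f by (simp_all only:)
      have "1 / x * (y * x ^ 2) / (u * v * F) - 7/12 * (2 / x * (y * x) / (v * F)) + 3 / x * y / F / 18
          = y / x * (2 * x + 1) / (3 * (u * v * F))"
        if uv: "u = x - 1" "v = x - 2" and F0: "u \<noteq> 0" "v \<noteq> 0" "F \<noteq> 0" for F y u v
      proof -
        have "1 / x * (y * x ^ 2) / (u * v * F) = y / (x * u * v * F) * x ^ 2"
          "7/12 * (2 / x * (y * x) / (v * F)) = y / (x * u * v * F) * (7/6 * u * x)"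
          "3 / x * y / F / 18 = y / (x * u * v * F) * (1/6 * u * v)"
          "y / x * (2 * x + 1) / (3 * (u * v * F)) = y / (x * u * v * F) * ((2 * x + 1) / 3)"
          using x F0 by (simp_all add: divide_simps)
        \<comment> \<open>The quadratic terms cancel. The remaining 2 x + 1 = 2 m + 1 completes (2
          m)! to (2 m + 1)!.\<close>
        moreover have "x ^ 2 - 7/6 * u * x + 1/6 * u * v = (2 * x + 1) / 3"
          by (simp add: uv field_simps power2_eq_square)
        ultimately show ?thesis by (metis (no_types, lifting) distrib_left right_diff_distrib)
      qed
      from this[OF refl refl nz fact_nonzero[of j], of "x ^ j"] show ?thesis
        unfolding F by (simp only: power_add power_one_right)
    qed
    ultimately show ?thesis unfolding eq c x_def[symmetric] p by simp
  qed
qed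

lemma coeff_inverse_KL_braid:
  assumes "k \<ge> 1"
  shows "rat_of_int (coeff (inverse_KL_poly (braid_matroid k)) i) = (- 1) ^ (k - 1) * coeff (inv_coeff k) i"
proof -
  let ?V = "{..<k}"
  let ?M = "complete_matroid ?V"
  have V: "finite ?V" "?V \<noteq> {}" "card ?V = k" using assms by (auto simp: lessThan_empty_iff)
  have M: "is_matroid ?M" "loopless ?M" by (rule is_matroid_complete[OF V(1)] loopless_complete)+
  have "braid_matroid k = ?M" by (simp add: braid_matroid_def complete_edges_def)
  hence "inverse_KL_poly (braid_matroid k) = (- 1) ^ rk ?M * ikl (flats ?M) (rank_of ?M) (ground ?M) {}"
    using M by (simp add: inverse_KL_poly_eq lattice_inverse_KL_def)
  moreover have "rk ?M = k - 1"
    using rank_of_complete[OF V(1), of "complete_edges ?V"] components_complete_edges[OF V(2)] V(3)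
    by (simp add: rk_def)
  moreover have "rat_poly (ikl (flats ?M) (rank_of ?M) (ground ?M) {}) = inv_coeff (card ?V)"
    using V(1,2) lam_1 rev_at_lam bell_sum_lam degree_inv_coeff by (rule ikl_complete_matroid)
  hence "rat_of_int (coeff (ikl (flats ?M) (rank_of ?M) (ground ?M) {}) i) = coeff (inv_coeff k) i"
    unfolding V(3) by (metis coeff_map_poly of_int_0)
  moreover have "coeff ((- 1) ^ e * p) i = (- 1) ^ e * coeff p i" for e and p :: "int poly"
    by (cases "even e") simp_all
  ultimately show ?thesis by simp
qed

theorem theorem1p7:
  fixes n :: nat
  assumes "n > 1"
  shows "coeff (inverse_KL_poly (braid_matroid (2 * n))) (n - 1) =
           int ((2 * n - 1) ^ (n - 2) * double_fact (2 * n - 3)) \<and>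
         rat_of_int (coeff (inverse_KL_poly (braid_matroid (2 * n - 1))) (n - 2)) =
           rat_of_nat (n - 1) powi (int n - 5) * fact (2 * n - 1) / (3 * fact (n - 2))"
proof
  obtain j where n: "n = j + 2" using assms by (metis add.commute le_Suc_ex Suc_1 Suc_leI)
  have "2 * n = 2 * j + 4" "n - 1 = j + 1" "2 * n - 1 = 2 * j + 3" "n - 2 = j" "2 * n - 3 = 2 * j + 1"
    using n by simp_all
  note idx = this
  have "rat_of_int (coeff (inverse_KL_poly (braid_matroid (2 * n))) (n - 1)) =
      of_nat ((2 * j + 3) ^ j * double_fact (2 * j + 1))"
    unfolding idx by (subst coeff_inverse_KL_braid) (simp_all only: coeff_inv_coeff_even, simp_all)
  also have "\<dots> = rat_of_int (int ((2 * j + 3) ^ j * double_fact (2 * j + 1)))" by simp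
  finally show "coeff (inverse_KL_poly (braid_matroid (2 * n))) (n - 1) =
      int ((2 * n - 1) ^ (n - 2) * double_fact (2 * n - 3))"
    unfolding of_int_eq_iff unfolding idx(3,5) unfolding idx .
  have "2 * n - 1 = 2 * (n - 1) + 1" "n - 2 = n - 1 - 1" "int n - 5 = int (n - 1) - 4" using assms by simp_all
  thus "rat_of_int (coeff (inverse_KL_poly (braid_matroid (2 * n - 1))) (n - 2)) =
      rat_of_nat (n - 1) powi (int n - 5) * fact (2 * n - 1) / (3 * fact (n - 2))"
    using coeff_inverse_KL_braid[of "2 * n - 1" "n - 2"] coeff_inv_coeff_odd[of "n - 1"] assms by simp
qed

end
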